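(* Let $P$ be the $K$-subalgebra of $K[T_3]^{\mathrm{SO}_3(K)}$ generated by $\mathrm{tr}(t_1^2),\mathrm{tr}(t_2^2),\mathrm{tr}(t_3^2),\mathrm{tr}(t_1t_2),\mathrm{tr}(t_1t_3),\mathrm{tr}(t_2t_3)$; $\mathcal E_3$ is a $P$-module via $f\cdot m=(fI)m$. (i) The $P$-module $\mathcal E_3$ decomposes as \[\mathcal E_3=\mathcal E_{3,1}\oplus\mathcal E^{(1)}_{3,2}\oplus\mathcal E^{(0)}_{3,2}\oplus\mathcal E^{(0)}_{3,3}\oplus\mathcal E^{(1)}_{3,3},\] where $\mathcal E_{3,1}=P\cdot I\oplus P\cdot\mathrm{tr}(t_1t_2t_3)I=K[T_3]^{\mathrm{SO}_3(K)}\cdot I$, $\mathcal E^{(1)}_{3,2}=P\cdot\langle t_1\rangle_{\mathrm{GL}_3(K)}$, $\mathcal E^{(0)}_{3,2}=P\cdot\langle[t_1,t_2]\rangle_{\mathrm{GL}_3(K)}$, $\mathcal E^{(0)}_{3,3}=P\cdot\langle t_1^2-\frac13\mathrm{tr}(t_1^2)I\rangle_{\mathrm{GL}_3(K)}$, $\mathcal E^{(1)}_{3,3}=P\cdot\langle[t_1^2,t_2]\rangle_{\mathrm{GL}_3(K)}$. (ii) $\mathcal E^{(1)}_{3,2}=Pt_1\oplus Pt_2\oplus Pt_3$ and $\mathcal E^{(0)}_{3,2}=P[t_1,t_2]\oplus P[t_1,t_3]\oplus P[t_2,t_3]$ are free $P$-modules of rank $3$. (iii) The $K$-space $\langle t_1^2-\frac13\mathrm{tr}(t_1^2)I\rangle_{\mathrm{GL}_3(K)}$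 has basis $\{f_{ij}=\frac12(t_it_j+t_jt_i)-\frac13\mathrm{tr}(t_it_j)I\mid 1\le i\le j\le 3\}$, and $\mathcal E^{(0)}_{3,3}$ has the free resolution $0\to P\xrightarrow{\mu^{(0)}}P^{\oplus6}\xrightarrow{\eta^{(0)}}\mathcal E^{(0)}_{3,3}\to0$, where with $e_1,\dots,e_6$ the standard generators of $P^{\oplus 6}$, $\eta^{(0)}$ is the $P$-module surjection $e_1\mapsto f_{11},e_2\mapsto f_{12},e_3\mapsto f_{13},e_4\mapsto f_{22},e_5\mapsto f_{23},e_6\mapsto f_{33}$, and $\mu^{(0)}$ sends the generator $1$ of $P$ to the column vector \[\Big(\tfrac12(\mathrm{tr}(t_2^2)\mathrm{tr}(t_3^2)-\mathrm{tr}(t_2t_3)^2),\ \mathrm{tr}(t_1t_3)\mathrm{tr}(t_2t_3)-\mathrm{tr}(t_1t_2)\mathrm{tr}(t_3^2),\ \mathrm{tr}(t_1t_2)\mathrm{tr}(t_2t_3)-\mathrm{tr}(t_1t_3)\mathrm{tr}(t_2^2),\ \tfrac12(\mathrm{tr}(t_1^2)\mathrm{tr}(t_3^2)-\mathrm{tr}(t_1t_3)^2),\ \mathrm{tr}(t_1t_2)\mathrm{tr}(t_1t_3)-\mathrm{tr}(t_1^2)\mathrm{tr}(t_2t_3),\ \tfrac12(\mathrm{tr}(t_1^2)\mathrm{tr}(t_2^2)-\mathrm{tr}(t_1t_2)^2)\Big)^T.\] (iv) The $K$-space $\langle[t_1^2,t_2]\rangle_{\mathrm{GL}_3(K)}$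 has basis $\{f_{iij}=[t_i^2,t_j]\ (i\ne j\in\{1,2,3\}),\ f_{132}=[t_1t_3+t_3t_1,t_2],\ f_{123}=[t_1t_2+t_2t_1,t_3]\}$, and $\mathcal E^{(1)}_{3,3}$ has the free resolution $0\to P^{\oplus3}\xrightarrow{\mu^{(1)}}P^{\oplus8}\xrightarrow{\eta^{(1)}}\mathcal E^{(1)}_{3,3}\to0$, where with $e_1,\dots,e_8$ the standard generators of $P^{\oplus8}$, $\eta^{(1)}$ is the $P$-module surjection $e_1\mapsto f_{112},e_2\mapsto f_{221},e_3\mapsto f_{113},e_4\mapsto f_{331},e_5\mapsto f_{223},e_6\mapsto f_{332},e_7\mapsto f_{132},e_8\mapsto f_{123}$, and $\mu^{(1)}$ is given by the $8\times3$ matrix whose rows are \[(\mathrm{tr}(t_2t_3),0,-\mathrm{tr}(t_3^2)),\ (\mathrm{tr}(t_1t_3),-\mathrm{tr}(t_3^2),0),\ (-\mathrm{tr}(t_2^2),0,\mathrm{tr}(t_2t_3)),\ (0,-\mathrm{tr}(t_2^2),\mathrm{tr}(t_1t_2)),\] \[(-\mathrm{tr}(t_1^2),\mathrm{tr}(t_1t_3),0),\ (0,\mathrm{tr}(t_1t_2),-\mathrm{tr}(t_1^2)),\ (0,-\mathrm{tr}(t_2t_3),\mathrm{tr}(t_1t_3)),\ (\mathrm{tr}(t_1t_2),-\mathrm{tr}(t_2t_3),0).\]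
   Context: $K$ is a field of characteristic $0$; $so_3(K)$ is the space of $3\times3$ skew-symmetric matrices. $T_3=\{t^{(k)}_{ij}\mid 1\le i<j\le3,\ k=1,2,3\}$ are commuting indeterminates; $t_k\in M_3(K[T_3])$ is the generic skew-symmetric matrix with zero diagonal, $(i,j)$ entry $t^{(k)}_{ij}$ and $(j,i)$ entry $-t^{(k)}_{ij}$ ($i<j$). Elements of $M_3(K[T_3])$ are viewed as polynomial maps $so_3(K)^{\oplus3}\to M_3(K)$; $\mathrm{SO}_3(K)$ acts by simultaneous conjugation on $so_3(K)^{\oplus3}$ and by conjugation on $M_3(K)$. $\mathcal E_3$ is the $K$-algebra of $\mathrm{SO}_3(K)$-equivariant polynomial maps $so_3(K)^{\oplus 3}\to M_3(K)$, and $K[T_3]^{\mathrm{SO}_3(K)}$ the algebra of invariant polynomials. $\mathrm{GL}_3(K)$ acts on $K[T_3]$ by $g\cdot t^{(k)}_{ij}=\sum_l g_{lk}t^{(l)}_{ij}$ and entrywise on matrices; $\langle U\rangle_{\mathrm{GL}_3(K)}$ is the $\mathrm{GL}_3(K)$-submodule generated by $U$; $I$ is the $3\times3$ identity matrix and $[a,b]=ab-ba$. *)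

theory Defs
  imports "HOL-Analysis.Analysis"
begin

(* A point of so_3(K)^{\<oplus>3} is given by its 9 coordinates c $ k $ m, where
   k \<in> {1,2,3} numbers the matrix t_k and m = 1,2,3 numbers the coordinates
   t^{(k)}_{12}, t^{(k)}_{13}, t^{(k)}_{23}.  (Indices live in the numeral type 3,
   whose elements are written 1,2,3.) *)
type_synonym 'a pt = "'a^3^3"
type_synonym 'a mmap = "'a pt \<Rightarrow> 'a^3^3"

definition skew :: "'a::ring_1^3 \<Rightarrow> 'a^3^3" where
  "skew v = vector [vector [0, v$1, v$2], vector [- v$1, 0, v$3], vector [- v$2, - v$3, 0]]"

definition unskew :: "'a::ring_1^3^3 \<Rightarrow> 'a^3" where
  "unskew M = vector [M$1$2, M$1$3, M$2$3]"

definition tv :: "3 \<Rightarrow> 'a::ring_1 mmap" where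
  "tv k = (\<lambda>c. skew (c $ k))"

text \<open>polynomial functions in the coordinates t^{(k)}_{ij} (K infinite, so these are K[T_3])\<close>
inductive is_poly :: "('a::comm_ring_1 pt \<Rightarrow> 'a) \<Rightarrow> bool" where
  const: "is_poly (\<lambda>c. a)"
| coord: "is_poly (\<lambda>c. c $ k $ m)"
| add: "is_poly f \<Longrightarrow> is_poly g \<Longrightarrow> is_poly (\<lambda>c. f c + g c)"
| mult: "is_poly f \<Longrightarrow> is_poly g \<Longrightarrow> is_poly (\<lambda>c. f c * g c)"

definition SO3 :: "('a::comm_ring_1^3^3) set" where
  "SO3 = {g. transpose g ** g = mat 1 \<and> det g = 1}"

text \<open>simultaneous conjugation g X g^{-1} (= g X g^T for g in SO3) on so_3^3\<close>
definition so_act :: "'a::comm_ring_1^3^3 \<Rightarrow> 'a pt \<Rightarrow> 'a pt" where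
  "so_act g c = (\<chi> k. unskew (g ** skew (c $ k) ** transpose g))"

definition Inv3 :: "('a::comm_ring_1 pt \<Rightarrow> 'a) set" where
  "Inv3 = {f. is_poly f \<and> (\<forall>g\<in>SO3. \<forall>c. f (so_act g c) = f c)}"

definition E3 :: "('a::comm_ring_1 mmap) set" where
  "E3 = {F. (\<forall>i j. is_poly (\<lambda>c. F c $ i $ j)) \<and>
            (\<forall>g\<in>SO3. \<forall>c. F (so_act g c) = g ** F c ** transpose g)}"

definition trP :: "3 \<Rightarrow> 3 \<Rightarrow> ('a::comm_ring_1 pt \<Rightarrow> 'a)" where
  "trP i j = (\<lambda>c. trace (tv i c ** tv j c))"

inductive_set Palg :: "('a::comm_ring_1 pt \<Rightarrow> 'a) set" where
  const: "(\<lambda>c. a) \<in> Palg"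
| gen: "f \<in> {trP 1 1, trP 2 2, trP 3 3, trP 1 2, trP 1 3, trP 2 3} \<Longrightarrow> f \<in> Palg"
| add: "f \<in> Palg \<Longrightarrow> g \<in> Palg \<Longrightarrow> (\<lambda>c. f c + g c) \<in> Palg"
| mult: "f \<in> Palg \<Longrightarrow> g \<in> Palg \<Longrightarrow> (\<lambda>c. f c * g c) \<in> Palg"

definition lincomb :: "('a::comm_ring_1 pt \<Rightarrow> 'a) list \<Rightarrow> 'a mmap list \<Rightarrow> 'a mmap" where
  "lincomb ps Fs = (\<lambda>c. \<Sum>i<length Fs. mat ((ps ! i) c) ** (Fs ! i) c)"

definition Pspan :: "('a::comm_ring_1 mmap) set \<Rightarrow> 'a mmap set" where
  "Pspan S = {lincomb ps Fs | ps Fs. length ps = length Fs \<and> set Fs \<subseteq> S \<and> set ps \<subseteq> Palg}"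

definition Kspan :: "('a::comm_ring_1 mmap) set \<Rightarrow> 'a mmap set" where
  "Kspan S = {lincomb ps Fs | ps Fs. length ps = length Fs \<and> set Fs \<subseteq> S
                \<and> set ps \<subseteq> range (\<lambda>a. \<lambda>c. a)}"

definition P_indep :: "('a::comm_ring_1 mmap) list \<Rightarrow> bool" where
  "P_indep Fs = (\<forall>ps. length ps = length Fs \<and> set ps \<subseteq> Palg \<and> lincomb ps Fs = (\<lambda>c. 0)
                   \<longrightarrow> (\<forall>p\<in>set ps. p = (\<lambda>c. 0)))"

definition K_indep :: "('a::comm_ring_1 mmap) list \<Rightarrow> bool" where
  "K_indep Fs = (\<forall>ps. length ps = length Fs \<and> set ps \<subseteq> range (\<lambda>a. \<lambda>c. a)
                   \<and> lincomb ps Fs = (\<lambda>c. 0) \<longrightarrow> (\<forall>p\<in>set ps. p = (\<lambda>c. 0)))"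

text \<open>GL_3 action: substitution t^{(k)}_{ij} \<mapsto> \<Sum>_l g_{lk} t^{(l)}_{ij}\<close>
definition gl_act :: "'a::comm_ring_1^3^3 \<Rightarrow> 'a mmap \<Rightarrow> 'a mmap" where
  "gl_act g F = (\<lambda>c. F (\<chi> k m. \<Sum>l\<in>UNIV. g $ l $ k * c $ l $ m))"

definition GLmod :: "('a::comm_ring_1 mmap) set \<Rightarrow> 'a mmap set" where
  "GLmod U = Kspan {gl_act g u | g u. invertible g \<and> u \<in> U}"

definition msum :: "('a::comm_ring_1 mmap) list \<Rightarrow> 'a mmap" where
  "msum Fs = (\<lambda>c. sum_list (map (\<lambda>F. F c) Fs))"

definition internal_dsum :: "('a::comm_ring_1 mmap) set \<Rightarrow> 'a mmap set list \<Rightarrow> bool" where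
  "internal_dsum M Ms =
     ((\<forall>N\<in>set Ms. N \<subseteq> M) \<and>
      (\<forall>F\<in>M. \<exists>Fs. length Fs = length Ms \<and> (\<forall>i<length Ms. Fs ! i \<in> Ms ! i) \<and> F = msum Fs) \<and>
      (\<forall>Fs. length Fs = length Ms \<and> (\<forall>i<length Ms. Fs ! i \<in> Ms ! i) \<and> msum Fs = (\<lambda>c. 0)
            \<longrightarrow> (\<forall>i<length Ms. Fs ! i = (\<lambda>c. 0))))"

definition comm :: "'a::ring_1^3^3 \<Rightarrow> 'a^3^3 \<Rightarrow> 'a^3^3" where
  "comm A B = A ** B - B ** A"

definition Imap :: "'a::comm_ring_1 mmap" where
  "Imap = (\<lambda>c. mat 1)"

definition tr3I :: "'a::comm_ring_1 mmap" where
  "tr3I = (\<lambda>c. mat (trace (tv 1 c ** tv 2 c ** tv 3 c)))"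

definition E31 :: "('a::comm_ring_1 mmap) set" where
  "E31 = Pspan {Imap, tr3I}"

definition E32_1 :: "('a::comm_ring_1 mmap) set" where
  "E32_1 = Pspan (GLmod {tv 1})"

definition E32_0 :: "('a::comm_ring_1 mmap) set" where
  "E32_0 = Pspan (GLmod {\<lambda>c. comm (tv 1 c) (tv 2 c)})"

definition g33_0 :: "'a::field_char_0 mmap" where
  "g33_0 = (\<lambda>c. tv 1 c ** tv 1 c - mat (1/3 * trP 1 1 c))"

definition g33_1 :: "'a::field_char_0 mmap" where
  "g33_1 = (\<lambda>c. comm (tv 1 c ** tv 1 c) (tv 2 c))"

definition E33_0 :: "('a::field_char_0 mmap) set" where
  "E33_0 = Pspan (GLmod {g33_0})"

definition E33_1 :: "('a::field_char_0 mmap) set" where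
  "E33_1 = Pspan (GLmod {g33_1})"

definition fsym :: "3 \<Rightarrow> 3 \<Rightarrow> 'a::field_char_0 mmap" where
  "fsym i j = (\<lambda>c. mat (1/2) ** (tv i c ** tv j c + tv j c ** tv i c) - mat (1/3 * trP i j c))"

definition F0 :: "'a::field_char_0 mmap list" where
  "F0 = [fsym 1 1, fsym 1 2, fsym 1 3, fsym 2 2, fsym 2 3, fsym 3 3]"

definition mu0 :: "('a::field_char_0 pt \<Rightarrow> 'a) list" where
  "mu0 = [(\<lambda>c. 1/2 * (trP 2 2 c * trP 3 3 c - (trP 2 3 c)^2)),
          (\<lambda>c. trP 1 3 c * trP 2 3 c - trP 1 2 c * trP 3 3 c),
          (\<lambda>c. trP 1 2 c * trP 2 3 c - trP 1 3 c * trP 2 2 c),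
          (\<lambda>c. 1/2 * (trP 1 1 c * trP 3 3 c - (trP 1 3 c)^2)),
          (\<lambda>c. trP 1 2 c * trP 1 3 c - trP 1 1 c * trP 2 3 c),
          (\<lambda>c. 1/2 * (trP 1 1 c * trP 2 2 c - (trP 1 2 c)^2))]"

definition fiij :: "3 \<Rightarrow> 3 \<Rightarrow> 'a::field_char_0 mmap" where
  "fiij i j = (\<lambda>c. comm (tv i c ** tv i c) (tv j c))"

definition fijk :: "3 \<Rightarrow> 3 \<Rightarrow> 3 \<Rightarrow> 'a::field_char_0 mmap" where
  "fijk i j k = (\<lambda>c. comm (tv i c ** tv j c + tv j c ** tv i c) (tv k c))"

definition F1 :: "'a::field_char_0 mmap list" where
  "F1 = [fiij 1 2, fiij 2 1, fiij 1 3, fiij 3 1, fiij 2 3, fiij 3 2, fijk 1 3 2, fijk 1 2 3]"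

definition zf :: "'a::field_char_0 pt \<Rightarrow> 'a" where "zf = (\<lambda>c. 0)"

definition mu1 :: "('a::field_char_0 pt \<Rightarrow> 'a) list list" where
  "mu1 = [[trP 2 3, zf, (\<lambda>c. - trP 3 3 c)],
          [trP 1 3, (\<lambda>c. - trP 3 3 c), zf],
          [(\<lambda>c. - trP 2 2 c), zf, trP 2 3],
          [zf, (\<lambda>c. - trP 2 2 c), trP 1 2],
          [(\<lambda>c. - trP 1 1 c), trP 1 3, zf],
          [zf, trP 1 2, (\<lambda>c. - trP 1 1 c)],
          [zf, (\<lambda>c. - trP 2 3 c), trP 1 3],
          [trP 1 2, (\<lambda>c. - trP 2 3 c), zf]]"

definition mu1_app :: "('a::field_char_0 pt \<Rightarrow> 'a) list \<Rightarrow> ('a pt \<Rightarrow> 'a) list" where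
  "mu1_app qs = map (\<lambda>row. \<lambda>c. \<Sum>j<3. (row ! j) c * (qs ! j) c) mu1"

end

theory Submission
  imports Defs
begin

text \<open>Write \<open>C\<close> for the matrix whose rows are the axis vectors \<open>v\<^sub>1, v\<^sub>2, v\<^sub>3\<close> of \<open>t\<^sub>1, t\<^sub>2, t\<^sub>3\<close>, and
  \<open>G = C C\<^sup>T\<close> for their Gram matrix; its six entries are algebraically independent and generate \<open>P\<close>.

  Invariants: rotating \<open>C\<close> to lower triangular form shows that an invariant \<open>f\<close> with \<open>f (- C) = f C\<close>
  (respectively \<open>- f C\<close>) becomes an element of \<open>P\<close> (respectively of \<open>det C \<cdot> P\<close>) after multiplication by
  a power of \<open>G11 (G11 G22 - G12\<^sup>2)\<close>. Exchanging \<open>v\<^sub>1\<close> and \<open>v\<^sub>3\<close> gives a second denominator coprime to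
  the first one, so \<open>f\<close> itself lies in \<open>P\<close> (in \<open>det C \<cdot> P\<close>).

  Equivariant maps: split \<open>F\<close> into even and odd, symmetric and skew-symmetric parts. The invariants
  obtained by contracting \<open>F\<close> with \<open>C\<close> and \<open>adj C\<close> express the skew-symmetric parts by \<open>C\<^sup>T b\<close> and
  \<open>adj C b\<close> with \<open>b\<close> over \<open>P\<close>. An even symmetric \<open>F\<close> yields a matrix \<open>Y = C F C\<^sup>-\<^sup>1\<close> over \<open>P\<close> with \<open>Y G\<close>
  symmetric, whence \<open>Y = p I + G Z\<close> and \<open>F = p I + C\<^sup>T Z C\<close>; an odd symmetric traceless \<open>F\<close> yields
  \<open>C F C\<^sup>T = det C \<cdot> B\<close> with \<open>tr (adj G B) = 0\<close>, whence \<open>B = G X + X\<^sup>T G\<close>. These statements, and the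
  determination of the relations, say that the complex resolving the ideal of \<open>2 \<times> 2\<close> minors of a
  generic symmetric \<open>3 \<times> 3\<close> matrix and its dual are exact. Exactness lifts along each variable, so it
  suffices to check it for a matrix with zero diagonal, where it reduces to Koszul relations.\<close>

section \<open>Polynomial functions\<close>

text \<open>The field need not be closed under square roots, so \<open>C\<close> can be rotated to
  triangular form only at special points; polynomial identities tolerate this because the special
  points supply infinitely many values of a coordinate. Parity is the second ingredient:
  \<open>-1\<close> commutes with all rotations, and composed with a half turn it becomes a
  reflection in a coordinate plane, so the parity of an invariant fixes its behaviour under every
  single sign change. All contractions of an equivariant map with \<open>C\<close> and
  \<open>adj C\<close> are chosen with odd total parity. The resulting invariants are then divisible
  by \<open>det C\<close>, and cancelling this factor is what removes the inverse of
  \<open>C\<close> from the formulas. Setting the diagonal of \<open>G\<close> to zero is compatible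
  with exactness because the 2x2 minors still generate the square of the ideal (G12, G13, G23),
  whose depth is 3 as for the generic matrix. Polynomials are treated as functions on K-points
  throughout, which loses nothing over an infinite field.\<close>

text \<open>\<open>pd n\<close> consists of the polynomial functions of degree less than \<open>n\<close>, so that
  \<open>pd 0\<close> is zero and truncated subtraction \<open>n - 1\<close> is harmless in degree bounds.\<close>

inductive pd :: "nat \<Rightarrow> (('i \<Rightarrow> 'a::comm_ring_1) \<Rightarrow> 'a) \<Rightarrow> bool" where
  zero: "pd n (\<lambda>x. 0)"
| const: "pd (Suc n) (\<lambda>x. a)"
| add: "pd n f \<Longrightarrow> pd n g \<Longrightarrow> pd n (\<lambda>x. f x + g x)"
| var: "pd n f \<Longrightarrow> pd (Suc n) (\<lambda>x. x i * f x)"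

definition pol :: "(('i \<Rightarrow> 'a::comm_ring_1) \<Rightarrow> 'a) \<Rightarrow> bool" where
  "pol f \<longleftrightarrow> (\<exists>n. pd n f)"

lemma pd_mono: "pd n f \<Longrightarrow> n \<le> m \<Longrightarrow> pd m f"
proof (induction arbitrary: m rule: pd.induct)
  case (const n a)
  then show ?case by (cases m) (simp_all add: pd.const)
next
  case (var n f i)
  then show ?case by (cases m) (simp_all add: pd.var)
qed (simp_all add: pd.zero pd.add)

lemma pd_0: "pd 0 f \<Longrightarrow> f = (\<lambda>x. 0)"
  by (induction "0::nat" f rule: pd.induct) auto

lemma pd_var: "pd (n - 1) f \<Longrightarrow> pd n (\<lambda>x. x i * f x)"
proof (cases n)
  case 0
  assume "pd (n - 1) f"
  then show ?thesis using 0 pd_0[of f] by (simp add: pd.zero)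
qed (simp add: pd.var)

lemma pd_smult: "pd n f \<Longrightarrow> pd n (\<lambda>x. a * f x)"
proof (induction rule: pd.induct)
  case (var n f i)
  have "(\<lambda>x. a * (x i * f x)) = (\<lambda>x. x i * (a * f x))" by (auto simp: mult_ac)
  then show ?case using pd.var[OF var.IH] by simp
qed (simp_all add: pd.zero pd.const pd.add distrib_left)

lemma pd_uminus: "pd n f \<Longrightarrow> pd n (\<lambda>x. - f x)"
  using pd_smult[of n f "-1"] by simp

lemma pd_diff: "pd n f \<Longrightarrow> pd n g \<Longrightarrow> pd n (\<lambda>x. f x - g x)"
  using pd.add[OF _ pd_uminus, of n f g] by simp

lemma pd_mult: "pd n f \<Longrightarrow> pd m g \<Longrightarrow> pd (n + m) (\<lambda>x. f x * g x)"
proof (induction rule: pd.induct)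
  case (const n a)
  have "pd (Suc n + m) (\<lambda>x. a * g x)" by (rule pd_mono[OF pd_smult[OF const]]) simp
  then show ?case .
next
  case (add n f g')
  show ?case unfolding distrib_right by (intro pd.add add.IH add.prems)
next
  case (var n f i)
  have "(\<lambda>x. x i * f x * g x) = (\<lambda>x. x i * (f x * g x))" by (auto simp: mult_ac)
  then show ?case using pd.var[OF var.IH[OF var.prems]] by simp
qed (simp_all add: pd.zero)

lemma pol_const [simp, intro!]: "pol (\<lambda>x. a)"
  unfolding pol_def using pd.const by blast

lemma pol_add [intro]: "pol f \<Longrightarrow> pol g \<Longrightarrow> pol (\<lambda>x. f x + g x)"
proof -
  assume "pol f" "pol g"
  then obtain n m where "pd n f" "pd m g" unfolding pol_def by blast
  then have "pd (max n m) f" "pd (max n m) g" by (simp_all add: pd_mono)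
  then show ?thesis unfolding pol_def by (blast intro: pd.add)
qed

lemma pol_mult [intro]: "pol f \<Longrightarrow> pol g \<Longrightarrow> pol (\<lambda>x. f x * g x)"
  unfolding pol_def using pd_mult by blast

lemma pol_uminus [intro]: "pol f \<Longrightarrow> pol (\<lambda>x. - f x)"
  unfolding pol_def using pd_uminus by blast

lemma pol_diff [intro]: "pol f \<Longrightarrow> pol g \<Longrightarrow> pol (\<lambda>x. f x - g x)"
  using pol_add[OF _ pol_uminus, of f g] by simp

lemma pol_power [intro]: "pol f \<Longrightarrow> pol (\<lambda>x. f x ^ k)"
proof (induction k)
  case (Suc k)
  then show ?case using pol_mult[of f "\<lambda>x. f x ^ k"] by simp
qed simp

lemma pol_var [simp, intro!]: "pol (\<lambda>x :: 'i \<Rightarrow> 'a::comm_ring_1. x i)"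
proof -
  have "pd (Suc (Suc 0)) (\<lambda>x. x i * (1 :: 'a))" by (intro pd.var pd.const)
  then show ?thesis unfolding pol_def by auto
qed

lemma pol_induct [consumes 1, case_names const add var]:
  assumes "pol f" and "\<And>a. P (\<lambda>x. a)"
    and "\<And>f g. pol f \<Longrightarrow> pol g \<Longrightarrow> P f \<Longrightarrow> P g \<Longrightarrow> P (\<lambda>x. f x + g x)"
    and "\<And>f i. pol f \<Longrightarrow> P f \<Longrightarrow> P (\<lambda>x. x i * f x)"
  shows "P f"
proof -
  obtain n where "pd n f" using assms(1) unfolding pol_def by blast
  then show ?thesis
  proof (induction rule: pd.induct)
    case (zero n)
    show ?case by (rule assms(2))
  next
    case (const n a)
    show ?case by (rule assms(2))
  next
    case (add n f g)
    then show ?case using assms(3) unfolding pol_def by blast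
  next
    case (var n f i)
    then show ?case using assms(4) unfolding pol_def by blast
  qed
qed

text \<open>A product \<open>x j * f\<close> either is a multiple of \<open>x i\<close> already or
  inherits the splitting of \<open>f\<close>. The bound \<open>n - 1\<close> for the quotient is
  what makes the later inductions on the degree descend.\<close>

lemma pd_split:
  assumes "pd n f"
  shows "pd n (\<lambda>x. f (x(i := 0))) \<and>
         (\<exists>q. pd (n - 1) q \<and> (\<forall>x. f x = f (x(i := 0)) + x i * q x))"
  using assms
proof (induction rule: pd.induct)
  case (zero n)
  show ?case by (intro conjI exI[of _ "\<lambda>x. 0"]) (simp_all add: pd.zero)
next
  case (const n a)
  show ?case by (intro conjI exI[of _ "\<lambda>x. 0"]) (simp_all add: pd.zero pd.const)
next
  case (add n f g)
  then obtain q r where q: "pd (n - 1) q" "\<And>x. f x = f (x(i := 0)) + x i * q x"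
    and r: "pd (n - 1) r" "\<And>x. g x = g (x(i := 0)) + x i * r x" by blast
  have "f x + g x = (f (x(i := 0)) + g (x(i := 0))) + x i * (q x + r x)" for x
    by (subst q(2), subst r(2)) (simp add: algebra_simps)
  moreover have "pd n (\<lambda>x. f (x(i := 0)))" "pd n (\<lambda>x. g (x(i := 0)))" using add.IH by blast+
  ultimately show ?case using q(1) r(1)
    by (intro conjI exI[of _ "\<lambda>x. q x + r x"] pd.add) blast+
next
  case (var n f j)
  then obtain q where q: "pd (n - 1) q" "\<And>x. f x = f (x(i := 0)) + x i * q x" by blast
  show ?case
  proof (cases "j = i")
    case True
    then show ?thesis using var.hyps by (intro conjI exI[of _ f]) (simp_all add: pd.zero)
  next
    case False
    have "x j * f x = (x(i := 0)) j * f (x(i := 0)) + x i * (x j * q x)" for x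
      using False by (subst q(2)) (simp add: distrib_left mult_ac)
    moreover have "pd (Suc n) (\<lambda>x. (x(i := 0)) j * f (x(i := 0)))"
      using pd.var[of n "\<lambda>x. f (x(i := 0))" j] var.IH False by simp
    moreover have "pd (Suc n - 1) (\<lambda>x. x j * q x)"
      using pd_var[OF q(1)] by simp
    ultimately show ?thesis by blast
  qed
qed

lemma pd_div:
  assumes "pd n f" and "\<And>x. x i = 0 \<Longrightarrow> f x = 0"
  obtains q where "pd (n - 1) q" and "\<And>x. f x = x i * q x"
proof -
  obtain q where "pd (n - 1) q" and q: "\<And>x. f x = f (x(i := 0)) + x i * q x"
    using pd_split[OF assms(1), of i] by blast
  moreover have "f (x(i := 0)) = 0" for x by (rule assms(2)) simp
  ultimately show ?thesis using that[of q] by (metis add_0)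
qed

section \<open>Restriction to curves and identity arguments over an infinite field\<close>

lemma pol_curve:
  fixes f :: "('i \<Rightarrow> 'a::comm_ring_1) \<Rightarrow> 'a"
  assumes "pol f" and "\<And>i. \<exists>q. \<forall>t. \<gamma> t i = poly q t"
  shows "\<exists>q. \<forall>t. f (\<gamma> t) = poly q t"
  using assms(1)
proof (induction rule: pol_induct)
  case (const a)
  then show ?case by (intro exI[of _ "[:a:]"]) simp
next
  case (add f g)
  then obtain p q where "\<forall>t. f (\<gamma> t) = poly p t" "\<forall>t. g (\<gamma> t) = poly q t" by blast
  then show ?case by (intro exI[of _ "p + q"]) simp
next
  case (var f i)
  then obtain p where "\<forall>t. f (\<gamma> t) = poly p t" by blast
  moreover obtain q where "\<forall>t. \<gamma> t i = poly q t" using assms(2) by blast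
  ultimately show ?case by (intro exI[of _ "q * p"]) simp
qed

lemma pol_upd:
  fixes f :: "('i \<Rightarrow> 'a::comm_ring_1) \<Rightarrow> 'a"
  assumes "pol f"
  shows "\<exists>q. \<forall>t. f (x(i := t)) = poly q t"
proof (rule pol_curve[OF assms])
  fix j
  show "\<exists>q. \<forall>t. (x(i := t)) j = poly q t"
    by (cases "j = i") (auto intro: exI[of _ "[:0,1:]"] exI[of _ "[:x j:]"])
qed

lemma poly_eq_0_if_infinite:
  fixes q :: "'a::idom poly"
  assumes "infinite S" and "\<And>t. t \<in> S \<Longrightarrow> poly q t = 0"
  shows "q = 0"
  using poly_roots_finite[of q] assms finite_subset[of S "{t. poly q t = 0}"] by blast

text \<open>Diagonal entries of Gram matrices of triangular triples are only reached in the form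
  \<open>b + y\<^sup>2\<close>; infinitely many such values suffice to kill a polynomial. Squares of
  positive integers are distinct in characteristic 0.\<close>

lemma infinite_squares: "infinite {b + y\<^sup>2 | y :: 'a::field_char_0. y \<noteq> 0}"
proof -
  have "inj (\<lambda>n. b + (of_nat (Suc n))\<^sup>2 :: 'a)"
  proof (rule injI)
    fix m n :: nat assume "b + (of_nat (Suc m))\<^sup>2 = b + (of_nat (Suc n) :: 'a)\<^sup>2"
    then have "(of_nat ((Suc m)\<^sup>2) :: 'a) = of_nat ((Suc n)\<^sup>2)" by (simp only: of_nat_power) simp
    then have "(Suc m)\<^sup>2 = (Suc n)\<^sup>2" by (simp only: of_nat_eq_iff)
    then show "m = n" by simp
  qed
  then have "infinite (range (\<lambda>n. b + (of_nat (Suc n))\<^sup>2 :: 'a))" by (rule range_inj_infinite)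
  moreover have "range (\<lambda>n. b + (of_nat (Suc n))\<^sup>2 :: 'a) \<subseteq> {b + y\<^sup>2 | y. y \<noteq> 0}"
    using of_nat_neq_0 by blast
  ultimately show ?thesis using finite_subset by blast
qed

text \<open>These are the \<open>u\<close> for which the parametrization of the conic
  \<open>w\<^sup>2 = u\<^sup>2 + r\<^sup>2\<close> by \<open>t = w - u\<close> yields a nonzero
  rational \<open>w\<close>.\<close>

lemma infinite_pythagorean:
  fixes r :: "'a::field_char_0"
  assumes "r \<noteq> 0"
  shows "infinite {(r\<^sup>2 / t - t) / 2 | t. t \<noteq> 0 \<and> r\<^sup>2 / t + t \<noteq> 0}" (is "infinite ?S")
proof
  assume fin: "finite ?S"
  \<comment> \<open>The excluded \<open>t\<close> are roots of \<open>t^3 + r^2 t\<close>, and the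
    \<open>t\<close> leading to a given \<open>u\<close> are roots of
    \<open>t^2 + 2 u t - r^2\<close>. If \<open>?S\<close> were finite, the field would be a finite
    union of finite sets.\<close>
  have "(UNIV :: 'a set) \<subseteq> {t. poly [:0, r\<^sup>2, 0, 1:] t = 0} \<union> (\<Union>u\<in>?S. {t. poly [:-(r\<^sup>2), 2*u, 1:] t = 0})"
  proof
    fix t :: 'a
    show "t \<in> {t. poly [:0, r\<^sup>2, 0, 1:] t = 0} \<union> (\<Union>u\<in>?S. {t. poly [:-(r\<^sup>2), 2*u, 1:] t = 0})"
    proof (cases "t = 0 \<or> r\<^sup>2 / t + t = 0")
      case True
      moreover have "t \<noteq> 0 \<Longrightarrow> poly [:0, r\<^sup>2, 0, 1:] t = t * t * (r\<^sup>2 / t + t)"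
        by (simp add: field_simps power2_eq_square)
      ultimately have "poly [:0, r\<^sup>2, 0, 1:] t = 0"
        using True by (cases "t = 0") auto
      then show ?thesis by blast
    next
      case False
      then have "(r\<^sup>2 / t - t) / 2 \<in> ?S" by blast
      moreover have "poly [:-(r\<^sup>2), 2*((r\<^sup>2 / t - t) / 2), 1:] t = 0"
        using False by (simp add: field_simps power2_eq_square)
      ultimately show ?thesis by blast
    qed
  qed
  moreover have "finite ({t. poly [:0, r\<^sup>2, 0, 1:] t = 0} \<union> (\<Union>u\<in>?S. {t. poly [:-(r\<^sup>2), 2*u, 1:] t = 0}))"
    using fin by (intro finite_UnI finite_UN_I poly_roots_finite) auto
  ultimately show False using infinite_UNIV_char_0[where 'a='a] finite_subset by blast
qed

text \<open>On the line through \<open>z\<close> and \<open>x\<close> both factors become univariate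
  polynomials, and these form an integral domain.\<close>

lemma pol_domain:
  fixes f g :: "('i \<Rightarrow> 'a::field_char_0) \<Rightarrow> 'a"
  assumes "pol f" "pol g" and "\<And>x. f x * g x = 0" and "f z \<noteq> 0"
  shows "g x = 0"
proof (rule ccontr)
  assume gx: "g x \<noteq> 0"
  define \<gamma> where "\<gamma> t = (\<lambda>i. z i + t * (x i - z i))" for t
  have \<gamma>: "\<exists>q. \<forall>t. \<gamma> t i = poly q t" for i
    by (rule exI[of _ "[:z i, x i - z i:]"]) (simp add: \<gamma>_def)
  obtain p q where p: "\<And>t. f (\<gamma> t) = poly p t" and q: "\<And>t. g (\<gamma> t) = poly q t"
    using pol_curve[OF assms(1), of \<gamma>] pol_curve[OF assms(2), of \<gamma>] \<gamma> by blast
  have "poly (p * q) t = 0" for t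
    using assms(3)[of "\<gamma> t"] p q by simp
  then have "p * q = 0"
    using poly_eq_0_if_infinite[OF infinite_UNIV_char_0] by blast
  moreover have "\<gamma> 0 = z" "\<gamma> 1 = x" by (auto simp: \<gamma>_def)
  ultimately show False using p[of 0] q[of 1] assms(4) gx by auto
qed

lemma pol_cancel_var:
  fixes f :: "('i \<Rightarrow> 'a::field_char_0) \<Rightarrow> 'a"
  assumes "pol f" and "\<And>x. x i * f x = 0"
  shows "f x = 0"
  using pol_domain[OF pol_var assms(1), of i "\<lambda>j. 1"] assms(2) by simp

lemma pd_pol: "pd n f \<Longrightarrow> pol f"
  unfolding pol_def by blast

section \<open>Lifting exactness along a variable\<close>

definition res :: "'i set \<Rightarrow> ('i \<Rightarrow> 'a::zero) \<Rightarrow> 'i \<Rightarrow> 'a" where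
  "res D x = (\<lambda>i. if i \<in> D then x i else 0)"

lemma res_UNIV [simp]: "res UNIV x = x"
  by (simp add: res_def)

lemma pd_res_mult: "pd (n - 1) f \<Longrightarrow> pd n (\<lambda>x. res D x i * f x)"
  by (cases "i \<in> D") (simp_all add: res_def pd_var pd.zero)

lemma pd_res: "pd n f \<Longrightarrow> pd n (\<lambda>x. f (res D x))"
proof (induction rule: pd.induct)
  case (var n f i)
  then show ?case using pd_res_mult[of "Suc n" "\<lambda>x. f (res D x)" D i] by simp
qed (simp_all add: pd.zero pd.const pd.add)

lemma pol_res: "pol f \<Longrightarrow> pol (\<lambda>x. f (res D x))"
  unfolding pol_def using pd_res by blast

text \<open>A complex \<open>U \<longrightarrow> V \<longrightarrow> W\<close> of free modules over the polynomial ring in the variables \<open>'i\<close>,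
  whose maps are given by matrices evaluated at \<open>res D x\<close>, i.e. with the variables outside \<open>D\<close>
  specialised to zero. If the specialised complex is exact then so is the complex itself: restrict
  a cycle to \<open>x i = 0\<close>, subtract a boundary, divide by \<open>x i\<close> and induct on the degree.\<close>

locale graded_complex =
  fixes \<phi> :: "('i \<Rightarrow> 'a::field_char_0) \<Rightarrow> ('u \<Rightarrow> 'a) \<Rightarrow> ('v \<Rightarrow> 'a)"
    and \<psi> :: "('i \<Rightarrow> 'a) \<Rightarrow> ('v \<Rightarrow> 'a) \<Rightarrow> ('w \<Rightarrow> 'a)"
    and \<delta> :: "'u \<Rightarrow> nat"
  assumes phi_zero: "\<phi> y (\<lambda>k. 0) = (\<lambda>j. 0)"
    and phi_lin: "\<phi> y (\<lambda>k. u k + s * u' k) = (\<lambda>j. \<phi> y u j + s * \<phi> y u' j)"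
    and psi_lin: "\<psi> y (\<lambda>j. v j - s * v' j) = (\<lambda>k. \<psi> y v k - s * \<psi> y v' k)"
    and psi_phi: "\<psi> y (\<phi> y u) = (\<lambda>k. 0)"
    and phi_deg: "(\<And>k. pd (n - \<delta> k) (\<lambda>x. U x k)) \<Longrightarrow> pd n (\<lambda>x. \<phi> (res D x) (U x) j)"
    and psi_pol: "(\<And>j. pol (\<lambda>x. V x j)) \<Longrightarrow> pol (\<lambda>x. \<psi> (res D x) (V x) k)"
begin

text \<open>The number \<open>\<delta> k\<close> is the degree of the coefficients with which the
  \<open>k\<close>-th component enters \<open>\<phi>\<close>. The degree bound on \<open>U\<close>
  belongs to the notion because lifting subtracts the boundary of \<open>U\<close> and then needs
  that the degree of the cycle has not grown.\<close>

definition exact :: "'i set \<Rightarrow> bool" where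
  "exact D \<longleftrightarrow> (\<forall>n V. (\<forall>j. pd n (\<lambda>x. V x j)) \<and> (\<forall>x k. \<psi> (res D x) (V x) k = 0) \<longrightarrow>
      (\<exists>U. (\<forall>k. pd (n - \<delta> k) (\<lambda>x. U x k)) \<and> (\<forall>x. V x = \<phi> (res D x) (U x))))"

lemma exact_insert:
  assumes D: "exact D" and i: "i \<notin> D"
  shows "exact (insert i D)"
proof -
  let ?E = "insert i D"
  have "\<exists>U. (\<forall>k. pd (n - \<delta> k) (\<lambda>x. U x k)) \<and> (\<forall>x. V x = \<phi> (res ?E x) (U x))"
    if "\<forall>j. pd n (\<lambda>x. V x j)" "\<forall>x k. \<psi> (res ?E x) (V x) k = 0" for n and V :: "('i \<Rightarrow> 'a) \<Rightarrow> 'v \<Rightarrow> 'a"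
    using that
  proof (induction n arbitrary: V)
    case 0
    then have "V x j = 0" for x j using fun_cong[OF pd_0[of "\<lambda>x. V x j"]] by blast
    then have "V x = \<phi> (res ?E x) (\<lambda>k. 0)" for x unfolding phi_zero by (intro ext)
    then show ?case by (intro exI[of _ "\<lambda>x k. 0"] conjI allI pd.zero)
  next
    case (Suc n)
    define V0 where "V0 x = V (x(i := 0))" for x
    \<comment> \<open>As \<open>i\<close> lies outside \<open>D\<close>, on the hyperplane
      \<open>x i = 0\<close> the larger specialisation agrees with the smaller one, whose exactness
      is known.\<close>
    have r1: "res ?E (x(i := 0)) = res D x" for x :: "'i \<Rightarrow> 'a"
      using i by (auto simp: res_def)
    have r2: "res D (x(i := 0)) = res D x" for x :: "'i \<Rightarrow> 'a"
      using i by (auto simp: res_def)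
    have "pd (Suc n) (\<lambda>x. V0 x j)" for j
      unfolding V0_def using pd_split[of "Suc n" "\<lambda>x. V x j" i] Suc.prems(1) by blast
    moreover have "\<psi> (res D x) (V0 x) k = 0" for x k
      using Suc.prems(2) unfolding V0_def r1[symmetric] by blast
    ultimately obtain U where U: "\<And>k. pd (Suc n - \<delta> k) (\<lambda>x. U x k)"
      and V0: "\<And>x. V0 x = \<phi> (res D x) (U x)"
      using D unfolding exact_def by blast
    define W where "W x = (\<lambda>j. V x j - 1 * \<phi> (res ?E x) (U x) j)" for x
    have "pd (Suc n) (\<lambda>x. W x j)" for j
      unfolding W_def using Suc.prems(1) phi_deg[OF U] by (simp add: pd_diff)
    moreover have "W x j = 0" if "x i = 0" for x j
    proof -
      have "x(i := 0) = x" using that by auto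
      then have "V x = \<phi> (res ?E x) (U x)" using V0[of x] r1[of x] unfolding V0_def by metis
      then show ?thesis by (simp add: W_def)
    qed
    ultimately have W: "pd (Suc n) (\<lambda>x. W x j)" "x i = 0 \<Longrightarrow> W x j = 0" for x j by blast+
    have "\<exists>q. pd n q \<and> (\<forall>x. W x j = x i * q x)" for j
    proof (rule pd_div[OF W])
      show "\<exists>q. pd n q \<and> (\<forall>x. W x j = x i * q x)"
        if "pd (Suc n - 1) q" "\<And>x. W x j = x i * q x" for q
        using that by auto
    qed
    then have "\<forall>j. \<exists>q. pd n q \<and> (\<forall>x. W x j = x i * q x)" by (rule allI)
    from choice[OF this] obtain Q where Q: "\<And>j. pd n (Q j)" "\<And>x j. W x j = x i * Q j x" by blast
    define V' where "V' x = (\<lambda>j. Q j x)" for x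
    have V'_pd: "\<forall>j. pd n (\<lambda>x. V' x j)" unfolding V'_def using Q(1) by simp
    have V': "V x = (\<lambda>j. \<phi> (res ?E x) (U x) j + x i * V' x j)" for x
    proof (rule ext)
      show "V x j = \<phi> (res ?E x) (U x) j + x i * V' x j" for j
        using Q(2)[of x j] by (simp add: W_def V'_def diff_eq_eq add.commute)
    qed
    \<comment> \<open>\<open>V\<close> and the boundary are cycles, so \<open>x i * V'\<close> is
      one too; the factor \<open>x i\<close> then cancels because the components of
      \<open>\<psi>\<close> at \<open>V'\<close> are polynomials.\<close>
    have "x i * \<psi> (res ?E x) (V' x) k = 0" for x k
    proof -
      have eq: "(\<lambda>j. V x j - x i * V' x j) = \<phi> (res ?E x) (U x)" by (subst V') simp
      have "\<psi> (res ?E x) (V x) k - x i * \<psi> (res ?E x) (V' x) k = 0"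
        using fun_cong[OF psi_lin[of "res ?E x" "V x" "x i" "V' x"], of k]
        unfolding eq psi_phi by simp
      then show ?thesis using Suc.prems(2) by simp
    qed
    moreover have "pol (\<lambda>x. \<psi> (res ?E x) (V' x) k)" for k
      using V'_pd by (intro psi_pol pd_pol) blast
    ultimately have "\<psi> (res ?E x) (V' x) k = 0" for x k
      using pol_cancel_var[of "\<lambda>x. \<psi> (res ?E x) (V' x) k" i] by blast
    then obtain U' where U': "\<And>k. pd (n - \<delta> k) (\<lambda>x. U' x k)" "\<And>x. V' x = \<phi> (res ?E x) (U' x)"
      using Suc.IH[of V'] V'_pd by blast
    \<comment> \<open>If \<open>\<delta> k\<close> exceeds \<open>n\<close>, truncation makes
      \<open>U' x k\<close> zero, so the bound holds in that range as well.\<close>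
    have "pd (Suc n - \<delta> k) (\<lambda>x. U x k + x i * U' x k)" for k
    proof (intro pd.add pd_var U)
      show "pd (Suc n - \<delta> k - 1) (\<lambda>x. U' x k)" using U'(1)[of k] by (rule pd_mono) simp
    qed
    moreover have "V x = \<phi> (res ?E x) (\<lambda>k. U x k + x i * U' x k)" for x
      using V'[of x] unfolding phi_lin U'(2) .
    ultimately show ?case by (intro exI[of _ "\<lambda>x k. U x k + x i * U' x k"]) blast
  qed
  then show ?thesis unfolding exact_def by blast
qed

lemma exact_UNIV:
  assumes "exact UNIV" and "\<And>j. pol (\<lambda>x. V x j)" and "\<And>x k. \<psi> x (V x) k = 0" and "finite (UNIV :: 'v set)"
  obtains U where "\<And>k. pol (\<lambda>x. U x k)" and "\<And>x. V x = \<phi> x (U x)"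
proof -
  obtain N where N: "\<And>j. pd (N j) (\<lambda>x. V x j)" using assms(2) unfolding pol_def by metis
  define n where "n = Max (range N)"
  have "pd n (\<lambda>x. V x j)" for j
    by (rule pd_mono[OF N]) (simp add: n_def assms(4) Max_ge)
  then obtain U where "\<And>k. pd (n - \<delta> k) (\<lambda>x. U x k)" "\<And>x. V x = \<phi> x (U x)"
    using assms(1,3) unfolding exact_def res_UNIV by blast
  then show ?thesis using that unfolding pol_def by blast
qed

end

section \<open>Koszul relations\<close>

text \<open>The coordinate subspace given by \<open>Z\<close> is irreducible and \<open>x k\<close>
  is not identically zero on it. Composing \<open>f\<close> with the projection
  \<open>res (- Z)\<close> reduces the claim to cancelling a variable.\<close>

lemma pol_vanish:
  fixes f :: "('i \<Rightarrow> 'a::field_char_0) \<Rightarrow> 'a"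
  assumes "pol f" and "k \<notin> Z" and "\<And>x. (\<forall>i\<in>Z. x i = 0) \<Longrightarrow> x k * f x = 0"
    and "\<forall>i\<in>Z. x i = 0"
  shows "f x = 0"
proof -
  have "y k * f (res (- Z) y) = 0" for y
    using assms(3)[of "res (- Z) y"] assms(2) by (simp add: res_def)
  then have "f (res (- Z) x) = 0"
    using pol_cancel_var[OF pol_res[OF assms(1)]] by blast
  moreover have "res (- Z) x = x" using assms(4) by (auto simp: res_def)
  ultimately show ?thesis by simp
qed

lemma pol_vanish2:
  fixes f :: "('i \<Rightarrow> 'a::field_char_0) \<Rightarrow> 'a"
  assumes "pol f" and "k \<notin> Z" "l \<notin> Z" and "\<And>x. (\<forall>i\<in>Z. x i = 0) \<Longrightarrow> x k * (x l * f x) = 0"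
    and "\<forall>i\<in>Z. x i = 0"
  shows "f x = 0"
proof -
  have "x l * f x = 0" if "\<forall>i\<in>Z. x i = 0" for x
    by (rule pol_vanish[of "\<lambda>x. x l * f x" k Z, OF _ assms(2,4) that]) (intro pol_mult pol_var assms(1))
  then show ?thesis by (rule pol_vanish[OF assms(1,3) _ assms(5)])
qed

lemma ideal2:
  fixes f :: "('i \<Rightarrow> 'a::field_char_0) \<Rightarrow> 'a"
  assumes "pd n f" and "i \<noteq> j" and "\<And>x. x i = 0 \<Longrightarrow> x j = 0 \<Longrightarrow> f x = 0"
  obtains p q where "pd (n - 1) p" "pd (n - 1) q" "\<And>x. f x = x i * p x + x j * q x"
proof -
  obtain p where p: "pd (n - 1) p" "\<And>x. f x = f (x(i := 0)) + x i * p x"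
    using pd_split[OF assms(1), of i] by blast
  have "pd n (\<lambda>x. f (x(i := 0)))" using pd_split[OF assms(1), of i] by blast
  moreover have "f (x(i := 0)) = 0" if "x j = 0" for x
    by (rule assms(3)) (use that assms(2) in auto)
  ultimately obtain q where q: "pd (n - 1) q" "\<And>x. f (x(i := 0)) = x j * q x"
    using pd_div[of n "\<lambda>x. f (x(i := 0))" j] by blast
  have "f x = x i * p x + x j * q x" for x
    using p(2)[of x] q(2)[of x] by (simp add: add.commute)
  with p(1) q(1) show ?thesis by (rule that)
qed

text \<open>Modulo \<open>x j\<close> the relation reads \<open>x i * f = 0\<close>, so
  \<open>x j\<close> divides \<open>f\<close>; cancelling \<open>x j\<close> then determines
  \<open>g\<close>. This is exactness of the Koszul complex of two variables, with degrees.\<close>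

lemma koszul2:
  fixes f :: "('i \<Rightarrow> 'a::field_char_0) \<Rightarrow> 'a"
  assumes "pd n f" "pd n g" and "i \<noteq> j" and "\<And>x. x i * f x = x j * g x"
  obtains h where "pd (n - 1) h" "\<And>x. f x = x j * h x" "\<And>x. g x = x i * h x"
proof -
  have "f x = 0" if "x j = 0" for x
    by (rule pol_vanish[of f i "{j}", OF pd_pol[OF assms(1)]]) (use that assms(3,4) in auto)
  then obtain h where h: "pd (n - 1) h" "\<And>x. f x = x j * h x"
    using pd_div[OF assms(1)] by blast
  have "x j * (g x - x i * h x) = 0" for x
    unfolding right_diff_distrib mult.left_commute[of "x j" "x i"] h(2)[symmetric] assms(4) by simp
  moreover have "pol (\<lambda>x. g x - x i * h x)"
    using assms(2) h(1) by (intro pol_diff pol_mult pol_var) (auto simp: pol_def)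
  ultimately have "g x - x i * h x = 0" for x
    using pol_cancel_var[of "\<lambda>x. g x - x i * h x" j] by blast
  then show ?thesis using that[OF h] by simp
qed

text \<open>Exactness of the Koszul complex of three variables in the middle: \<open>f\<close>
  vanishes where \<open>x j\<close> and \<open>x k\<close> do, and removing the relations with
  coefficients \<open>r\<close> and \<open>s\<close> leaves a relation between \<open>x j\<close>
  and \<open>x k\<close> alone.\<close>

lemma koszul3:
  fixes f :: "('i \<Rightarrow> 'a::field_char_0) \<Rightarrow> 'a"
  assumes "pd n f" "pd n g" "pd n h" and "i \<noteq> j" "i \<noteq> k" "j \<noteq> k"
    and eq: "\<And>x. x i * f x + x j * g x + x k * h x = 0"
  obtains r s t where "pd (n - 1) r" "pd (n - 1) s" "pd (n - 1) t"
    "\<And>x. f x = x j * r x + x k * s x" "\<And>x. g x = x k * t x - x i * r x"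
    "\<And>x. h x = - (x i * s x) - x j * t x"
proof -
  have xf: "x i * f x = 0" if "\<forall>l\<in>{j, k}. x l = 0" for x
    using eq[of x] that by simp
  have "f x = 0" if "x j = 0" "x k = 0" for x
    by (rule pol_vanish[of f i "{j, k}", OF pd_pol[OF assms(1)] _ xf]) (use that assms(4,5) in auto)
  then obtain r s where rs: "pd (n - 1) r" "pd (n - 1) s" "\<And>x. f x = x j * r x + x k * s x"
    using ideal2[OF assms(1,6)] by blast
  have "x j * (g x + x i * r x) = x k * (- h x - x i * s x)" for x
  proof -
    have "x j * (g x + x i * r x) - x k * (- h x - x i * s x) = x i * f x + x j * g x + x k * h x"
      by (simp add: rs(3) algebra_simps)
    then show ?thesis using eq[of x] by simp
  qed
  moreover have "pd n (\<lambda>x. g x + x i * r x)" "pd n (\<lambda>x. - h x - x i * s x)"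
    using assms(2,3) rs by (simp_all add: pd.add pd_diff pd_uminus pd_var)
  ultimately obtain t where t: "pd (n - 1) t" "\<And>x. g x + x i * r x = x k * t x"
    "\<And>x. - h x - x i * s x = x j * t x"
    using koszul2[of n "\<lambda>x. g x + x i * r x" "\<lambda>x. - h x - x i * s x" j k] assms(6) by blast
  show ?thesis
  proof (rule that[OF rs(1,2) t(1) rs(3)])
    show "g x = x k * t x - x i * r x" for x using t(2)[of x] by (simp add: algebra_simps)
    show "h x = - (x i * s x) - x j * t x" for x
    proof -
      have "- h x = x j * t x + x i * s x" using t(3)[of x] by (simp add: diff_eq_eq)
      then have "h x = - (x j * t x + x i * s x)" by (metis minus_minus)
      then show ?thesis by simp
    qed
  qed
qed

section \<open>The complexes attached to a generic symmetric matrix\<close>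

text \<open>\<open>gi\<close> indexes the entries of the generic symmetric matrix \<open>G\<close>, \<open>mi\<close> those of an arbitrary matrix.\<close>

datatype gi = G11 | G12 | G13 | G22 | G23 | G33
datatype mi = M11 | M12 | M13 | M21 | M22 | M23 | M31 | M32 | M33

lemma UNIV_gi: "UNIV = {G11, G12, G13, G22, G23, G33}"
  using gi.exhaust by auto

lemma UNIV_mi: "UNIV = {M11, M12, M13, M21, M22, M23, M31, M32, M33}"
  using mi.exhaust by auto

lemma finite_gi [simp]: "finite (UNIV :: gi set)" and finite_mi [simp]: "finite (UNIV :: mi set)"
  by (simp_all add: UNIV_gi UNIV_mi)

abbreviation D0 :: "gi set" where "D0 \<equiv> {G12, G13, G23}"

lemma res_D0 [simp]: "res D0 x G11 = 0" "res D0 x G12 = x G12" "res D0 x G13 = x G13"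
  "res D0 x G22 = 0" "res D0 x G23 = x G23" "res D0 x G33 = 0"
  by (simp_all add: res_def)

lemma pol_res_var: "pol (\<lambda>x. res D x i)"
  by (cases "i \<in> D") (simp_all add: res_def)

lemma pd_res_mult2: "pd (n - 2) f \<Longrightarrow> pd n (\<lambda>x. res D x i * (res D x j * f x))"
  by (intro pd_res_mult) (simp add: numeral_2_eq_2)

lemma insert_D0: "insert G33 (insert G22 (insert G11 D0)) = UNIV"
  by (auto simp: UNIV_gi)

subsection \<open>Solutions of \<open>G X + X\<^sup>T G = 0\<close>\<close>

text \<open>The entries of \<open>S G\<close>, where \<open>S\<close> is skew-symmetric with
  \<open>w G12\<close>, \<open>w G13\<close>, \<open>w G23\<close> above the diagonal. As
  \<open>G S G\<close> is skew-symmetric, these are the evident solutions of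
  \<open>G X + X\<^sup>T G = 0\<close>.\<close>

definition phi3 :: "(gi \<Rightarrow> 'a::comm_ring_1) \<Rightarrow> (gi \<Rightarrow> 'a) \<Rightarrow> mi \<Rightarrow> 'a" where
  "phi3 g w m = (case m of
     M11 \<Rightarrow> g G12 * w G12 + g G13 * w G13 | M12 \<Rightarrow> g G22 * w G12 + g G23 * w G13
   | M13 \<Rightarrow> g G23 * w G12 + g G33 * w G13 | M21 \<Rightarrow> g G13 * w G23 - g G11 * w G12
   | M22 \<Rightarrow> g G23 * w G23 - g G12 * w G12 | M23 \<Rightarrow> g G33 * w G23 - g G13 * w G12
   | M31 \<Rightarrow> - (g G11 * w G13) - g G12 * w G23 | M32 \<Rightarrow> - (g G12 * w G13) - g G22 * w G23
   | M33 \<Rightarrow> - (g G13 * w G13) - g G23 * w G23)"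

definition phi2 :: "(gi \<Rightarrow> 'a::comm_ring_1) \<Rightarrow> (mi \<Rightarrow> 'a) \<Rightarrow> gi \<Rightarrow> 'a" where
  "phi2 g x m = (case m of
     G11 \<Rightarrow> 2 * (g G11 * x M11 + g G12 * x M21 + g G13 * x M31)
   | G22 \<Rightarrow> 2 * (g G12 * x M12 + g G22 * x M22 + g G23 * x M32)
   | G33 \<Rightarrow> 2 * (g G13 * x M13 + g G23 * x M23 + g G33 * x M33)
   | G12 \<Rightarrow> g G11 * x M12 + g G12 * x M22 + g G13 * x M32 + g G12 * x M11 + g G22 * x M21 + g G23 * x M31
   | G13 \<Rightarrow> g G11 * x M13 + g G12 * x M23 + g G13 * x M33 + g G13 * x M11 + g G23 * x M21 + g G33 * x M31
   | G23 \<Rightarrow> g G12 * x M13 + g G22 * x M23 + g G23 * x M33 + g G13 * x M12 + g G23 * x M22 + g G33 * x M32)"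

interpretation cx3: graded_complex phi3 "phi2 :: (gi \<Rightarrow> 'a::field_char_0) \<Rightarrow> _" "\<lambda>_. 1"
proof
  show "pd n (\<lambda>x. phi3 (res D x) (U x) j)" if "\<And>k. pd (n - 1) (\<lambda>x. U x k)" for D n j and U :: "(gi \<Rightarrow> 'a) \<Rightarrow> _"
    by (cases j) (simp_all add: phi3_def, (intro pd.add pd_diff pd_uminus pd_res_mult that)+)
  show "pol (\<lambda>x. phi2 (res D x) (V x) k)" if "\<And>j. pol (\<lambda>x. V x j)" for D k and V :: "(gi \<Rightarrow> 'a) \<Rightarrow> _"
    by (cases k) (simp_all add: phi2_def, (intro pol_add pol_mult pol_const pol_res_var that)+)
qed (rule ext; rename_tac m; case_tac m; simp add: phi3_def phi2_def algebra_simps)+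

lemma two_cancel:
  fixes a :: "'a::field_char_0"
  shows "2 * (a + c * b) = 0 \<Longrightarrow> a = c * - b"
  by (simp add: eq_neg_iff_add_eq_0 del: distrib_left_numeral)

text \<open>With zero diagonal the three diagonal equations are two-term Koszul relations for the
  off-diagonal entries of \<open>X\<close>. After substituting their solutions, each off-diagonal
  equation acquires a common factor, and cancelling it gives the three pairwise sums of the diagonal
  entries.\<close>

lemma cx3_base: "cx3.exact TYPE('a::field_char_0) D0"
  unfolding cx3.exact_def
proof (intro allI impI, elim conjE)
  fix n and V :: "(gi \<Rightarrow> 'a) \<Rightarrow> mi \<Rightarrow> 'a"
  assume V: "\<forall>j. pd n (\<lambda>x. V x j)" and eq: "\<forall>x k. phi2 (res D0 x) (V x) k = 0"
  note Vj = V[THEN spec]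
  have e11: "x G12 * V x M21 = x G13 * - V x M31" for x
    by (rule two_cancel) (use eq[rule_format, of x G11] in \<open>simp add: phi2_def\<close>)
  have e22: "x G12 * V x M12 = x G23 * - V x M32" for x
    by (rule two_cancel) (use eq[rule_format, of x G22] in \<open>simp add: phi2_def\<close>)
  have e33: "x G13 * V x M13 = x G23 * - V x M23" for x
    by (rule two_cancel) (use eq[rule_format, of x G33] in \<open>simp add: phi2_def\<close>)
  obtain \<alpha> where \<alpha>: "pd (n - 1) \<alpha>" "\<And>x. V x M21 = x G13 * \<alpha> x" "\<And>x. - V x M31 = x G12 * \<alpha> x"
    using koszul2[OF Vj[of M21] pd_uminus[OF Vj[of M31]] _ e11] by blast
  obtain \<beta> where \<beta>: "pd (n - 1) \<beta>" "\<And>x. V x M12 = x G23 * \<beta> x" "\<And>x. - V x M32 = x G12 * \<beta> x"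
    using koszul2[OF Vj[of M12] pd_uminus[OF Vj[of M32]] _ e22] by blast
  obtain \<gamma> where \<gamma>: "pd (n - 1) \<gamma>" "\<And>x. V x M13 = x G23 * \<gamma> x" "\<And>x. - V x M23 = x G13 * \<gamma> x"
    using koszul2[OF Vj[of M13] pd_uminus[OF Vj[of M23]] _ e33] by blast
  have neg: "V x M31 = - (x G12 * \<alpha> x)" "V x M32 = - (x G12 * \<beta> x)" "V x M23 = - (x G13 * \<gamma> x)" for x
    using \<alpha>(3)[of x] \<beta>(3)[of x] \<gamma>(3)[of x] by (metis minus_minus)+
  have p: "pol (\<lambda>x. V x j)" "pol \<alpha>" "pol \<beta>" "pol \<gamma>" for j using Vj \<alpha>(1) \<beta>(1) \<gamma>(1) by (blast intro: pd_pol)+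
  have "x G12 * (V x M11 + V x M22 - x G13 * \<beta> x - x G23 * \<alpha> x) = 0" for x
    using eq[rule_format, of x G12] by (simp add: phi2_def neg \<alpha>(2) \<beta>(2) \<gamma>(2) algebra_simps)
  then have 1: "V x M11 + V x M22 - x G13 * \<beta> x - x G23 * \<alpha> x = 0" for x
    by (rule pol_cancel_var[rotated]) (intro pol_add pol_diff pol_mult pol_var p)
  have "x G13 * (V x M11 + V x M33 - x G12 * \<gamma> x + x G23 * \<alpha> x) = 0" for x
    using eq[rule_format, of x G13] by (simp add: phi2_def neg \<alpha>(2) \<beta>(2) \<gamma>(2) algebra_simps)
  then have 2: "V x M11 + V x M33 - x G12 * \<gamma> x + x G23 * \<alpha> x = 0" for x
    by (rule pol_cancel_var[rotated]) (intro pol_add pol_diff pol_mult pol_var p)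
  have "x G23 * (V x M22 + V x M33 + x G12 * \<gamma> x + x G13 * \<beta> x) = 0" for x
    using eq[rule_format, of x G23] by (simp add: phi2_def neg \<alpha>(2) \<beta>(2) \<gamma>(2) algebra_simps)
  then have 3: "V x M22 + V x M33 + x G12 * \<gamma> x + x G13 * \<beta> x = 0" for x
    by (rule pol_cancel_var[rotated]) (intro pol_add pol_diff pol_mult pol_var p)
  \<comment> \<open>The first two sums minus the third; dividing by 2 separates the diagonal
    entries.\<close>
  have "2 * (V x M11 - (x G12 * \<gamma> x + x G13 * \<beta> x)) = 0" for x
    using 1[of x] 2[of x] 3[of x] by algebra
  then have "V x M11 - (x G12 * \<gamma> x + x G13 * \<beta> x) = 0" for x
    by (metis mult_eq_0_iff zero_neq_numeral)
  then have d1: "V x M11 = x G12 * \<gamma> x + x G13 * \<beta> x" for x by simp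
  have d2: "V x M22 = x G23 * \<alpha> x - x G12 * \<gamma> x" and d3: "V x M33 = - (x G13 * \<beta> x) - x G23 * \<alpha> x" for x
    using 1[of x] 2[of x] unfolding d1 by algebra+
  define U where "U x k = (case k of G12 \<Rightarrow> \<gamma> x | G13 \<Rightarrow> \<beta> x | G23 \<Rightarrow> \<alpha> x | _ \<Rightarrow> 0)" for x k
  have "pd (n - 1) (\<lambda>x. U x k)" for k
    unfolding U_def by (cases k; simp only: gi.case; intro \<alpha> \<beta> \<gamma> pd.zero)
  moreover have "V x = phi3 (res D0 x) (U x)" for x
    by (rule ext, rename_tac m, case_tac m) (simp_all add: phi3_def U_def neg \<alpha>(2) \<beta>(2) \<gamma>(2) d1 d2 d3)
  ultimately show "\<exists>U. (\<forall>k. pd (n - 1) (\<lambda>x. U x k)) \<and> (\<forall>x. V x = phi3 (res D0 x) (U x))" by blast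
qed

lemma gram_skew:
  assumes "\<And>j. pol (\<lambda>x :: gi \<Rightarrow> 'a::field_char_0. V x j)" and "\<And>x k. phi2 x (V x) k = 0"
  obtains U where "\<And>k. pol (\<lambda>x. U x k)" and "\<And>x. V x = phi3 x (U x)"
proof -
  have "cx3.exact TYPE('a) (UNIV :: gi set)"
    unfolding insert_D0[symmetric] by (intro cx3.exact_insert cx3_base) simp_all
  then show ?thesis by (rule cx3.exact_UNIV[OF _ assms finite_mi]) (rule that)
qed

subsection \<open>Symmetric matrices \<open>B\<close> with \<open>tr (adj G B) = 0\<close>\<close>

definition psi2 :: "(gi \<Rightarrow> 'a::comm_ring_1) \<Rightarrow> (gi \<Rightarrow> 'a) \<Rightarrow> unit \<Rightarrow> 'a" where
  "psi2 g b _ = (g G22 * g G33 - g G23 * g G23) * b G11 + (g G11 * g G33 - g G13 * g G13) * b G22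
     + (g G11 * g G22 - g G12 * g G12) * b G33 + 2 * ((g G13 * g G23 - g G12 * g G33) * b G12
     + (g G12 * g G23 - g G13 * g G22) * b G13 + (g G12 * g G13 - g G11 * g G23) * b G23)"

text \<open>Because \<open>tr (adj G (G X + X\<^sup>T G)) = 2 det G tr X\<close>, only traceless
  \<open>X\<close> produce cycles; overwriting the last diagonal entry parametrizes them.\<close>

definition traceless :: "(mi \<Rightarrow> 'a::comm_ring_1) \<Rightarrow> mi \<Rightarrow> 'a" where
  "traceless x = x(M33 := - x M11 - x M22)"

interpretation cx2: graded_complex "\<lambda>g x. phi2 g (traceless x)" "psi2 :: (gi \<Rightarrow> 'a::field_char_0) \<Rightarrow> _" "\<lambda>_. 1"
proof
  show "pd n (\<lambda>x. phi2 (res D x) (traceless (U x)) j)" if "\<And>k. pd (n - 1) (\<lambda>x. U x k)" for D n j and U :: "(gi \<Rightarrow> 'a) \<Rightarrow> _"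
    by (cases j) (simp_all add: phi2_def traceless_def, (intro pd_smult pd.add pd_diff pd_uminus pd_res_mult that)+)
  show "pol (\<lambda>x. psi2 (res D x) (V x) k)" if "\<And>j. pol (\<lambda>x. V x j)" for D k and V :: "(gi \<Rightarrow> 'a) \<Rightarrow> _"
    unfolding psi2_def by (intro pol_add pol_diff pol_mult pol_const pol_res_var that)
  show "psi2 y (phi2 y (traceless u)) = (\<lambda>k. 0)" for y and u :: "mi \<Rightarrow> 'a"
    by (rule ext) (simp add: psi2_def phi2_def traceless_def algebra_simps)
  show "psi2 y (\<lambda>j. v j - s * v' j) = (\<lambda>k. psi2 y v k - s * psi2 y v' k)" for y v s and v' :: "gi \<Rightarrow> 'a"
    by (rule ext) (simp add: psi2_def algebra_simps)
qed (rule ext; rename_tac m; case_tac m; simp add: phi2_def traceless_def algebra_simps)+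

text \<open>With zero diagonal, setting two of the variables to zero isolates one diagonal entry of
  \<open>B\<close>, multiplied by a square, so this entry lies in the ideal of those two variables.
  Once the diagonal is accounted for, each remaining off-diagonal entry is divisible by its own
  variable, and the three quotients add up to zero.\<close>

lemma cx2_base: "cx2.exact TYPE('a::field_char_0) D0"
  unfolding cx2.exact_def
proof (intro allI impI, elim conjE)
  fix n and V :: "(gi \<Rightarrow> 'a) \<Rightarrow> gi \<Rightarrow> 'a"
  assume V: "\<forall>j. pd n (\<lambda>x. V x j)" and eq: "\<forall>x k. psi2 (res D0 x) (V x) k = 0"
  note Vj = V[THEN spec] and Vp = pd_pol[OF V[THEN spec]]
  have eq': "x G12 * (x G12 * V x G33) + x G13 * (x G13 * V x G22) + x G23 * (x G23 * V x G11)
      = 2 * (x G13 * x G23 * V x G12 + x G12 * x G23 * V x G13 + x G12 * x G13 * V x G23)" for x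
    using eq[rule_format, of x "()"] by (simp add: psi2_def algebra_simps eq_neg_iff_add_eq_0)
  have v11: "V x G11 = 0" if "x G12 = 0" "x G13 = 0" for x
  proof (rule pol_vanish2[of "\<lambda>x. V x G11" G23 "{G12, G13}" G23, OF Vp])
    show "y G23 * (y G23 * V y G11) = 0" if "\<forall>i\<in>{G12, G13}. y i = 0" for y
      using eq'[of y] that by simp
  qed (use that in simp_all)
  have v22: "V x G22 = 0" if "x G12 = 0" "x G23 = 0" for x
  proof (rule pol_vanish2[of "\<lambda>x. V x G22" G13 "{G12, G23}" G13, OF Vp])
    show "y G13 * (y G13 * V y G22) = 0" if "\<forall>i\<in>{G12, G23}. y i = 0" for y
      using eq'[of y] that by simp
  qed (use that in simp_all)
  have v33: "V x G33 = 0" if "x G13 = 0" "x G23 = 0" for x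
  proof (rule pol_vanish2[of "\<lambda>x. V x G33" G12 "{G13, G23}" G12, OF Vp])
    show "y G12 * (y G12 * V y G33) = 0" if "\<forall>i\<in>{G13, G23}. y i = 0" for y
      using eq'[of y] that by simp
  qed (use that in simp_all)
  obtain P1 Q1 where 1: "pd (n - 1) P1" "pd (n - 1) Q1" "\<And>x. V x G11 = x G12 * P1 x + x G13 * Q1 x"
    using ideal2[OF Vj _ v11] by blast
  obtain P2 Q2 where 2: "pd (n - 1) P2" "pd (n - 1) Q2" "\<And>x. V x G22 = x G12 * P2 x + x G23 * Q2 x"
    using ideal2[OF Vj _ v22] by blast
  obtain P3 Q3 where 3: "pd (n - 1) P3" "pd (n - 1) Q3" "\<And>x. V x G33 = x G13 * P3 x + x G23 * Q3 x"
    using ideal2[OF Vj _ v33] by blast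
  \<comment> \<open>What remains of the off-diagonal entries after subtracting the boundary that
    produces the diagonal; the factor 1/2 compensates the 2 in the diagonal entries of
    \<open>phi2\<close>.\<close>
  define b12 where "b12 x = V x G12 - 1/2 * (x G13 * Q2 x + x G23 * Q1 x)" for x
  define b13 where "b13 x = V x G13 - 1/2 * (x G12 * Q3 x + x G23 * P1 x)" for x
  define b23 where "b23 x = V x G23 - 1/2 * (x G12 * P3 x + x G13 * P2 x)" for x
  have bd: "pd n b12" "pd n b13" "pd n b23" unfolding b12_def b13_def b23_def
    by (intro pd_diff Vj pd_smult pd.add pd_var 1 2 3)+
  have "2 * (x G13 * (x G23 * b12 x) + x G12 * (x G23 * b13 x) + x G12 * (x G13 * b23 x)) = 0" for x
    using eq'[of x] by (simp add: b12_def b13_def b23_def 1 2 3 algebra_simps)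
  then have b: "x G13 * (x G23 * b12 x) + x G12 * (x G23 * b13 x) + x G12 * (x G13 * b23 x) = 0" for x
    by (metis mult_eq_0_iff zero_neq_numeral)
  have b12: "b12 x = 0" if "x G12 = 0" for x
  proof (rule pol_vanish2[of "\<lambda>x. b12 x" G13 "{G12}" G23, OF pd_pol[OF bd(1)]])
    show "y G13 * (y G23 * b12 y) = 0" if "\<forall>i\<in>{G12}. y i = 0" for y
      using b[of y] that by simp
  qed (use that in simp_all)
  have b13: "b13 x = 0" if "x G13 = 0" for x
  proof (rule pol_vanish2[of "\<lambda>x. b13 x" G12 "{G13}" G23, OF pd_pol[OF bd(2)]])
    show "y G12 * (y G23 * b13 y) = 0" if "\<forall>i\<in>{G13}. y i = 0" for y
      using b[of y] that by simp
  qed (use that in simp_all)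
  have b23: "b23 x = 0" if "x G23 = 0" for x
  proof (rule pol_vanish2[of "\<lambda>x. b23 x" G12 "{G23}" G13, OF pd_pol[OF bd(3)]])
    show "y G12 * (y G13 * b23 y) = 0" if "\<forall>i\<in>{G23}. y i = 0" for y
      using b[of y] that by simp
  qed (use that in simp_all)
  obtain e where e: "pd (n - 1) e" "\<And>x. b12 x = x G12 * e x" using pd_div[OF bd(1) b12] by blast
  obtain f where f: "pd (n - 1) f" "\<And>x. b13 x = x G13 * f x" using pd_div[OF bd(2) b13] by blast
  obtain g where g: "pd (n - 1) g" "\<And>x. b23 x = x G23 * g x" using pd_div[OF bd(3) b23] by blast
  note efg = e(1)[THEN pd_pol] f(1)[THEN pd_pol] g(1)[THEN pd_pol]
  have "x G12 * (x G13 * (x G23 * (e x + f x + g x))) = 0" for x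
    using b[of x] by (simp add: e f g algebra_simps)
  then have "x G13 * (x G23 * (e x + f x + g x)) = 0" for x
    by (rule pol_cancel_var[rotated]) (intro pol_add pol_mult pol_var efg)
  then have "x G23 * (e x + f x + g x) = 0" for x
    by (rule pol_cancel_var[rotated]) (intro pol_add pol_mult pol_var efg)
  then have "e x + f x + g x = 0" for x
    by (rule pol_cancel_var[rotated]) (intro pol_add pol_mult pol_var efg)
  then have ge: "g x = - (e x + f x)" for x using add_eq_0_iff[of "e x + f x" "g x"] by simp
  have V12: "V x G12 = x G12 * e x + 1/2 * (x G13 * Q2 x + x G23 * Q1 x)" for x
    using e(2)[of x] unfolding b12_def diff_eq_eq .
  have V13: "V x G13 = x G13 * f x + 1/2 * (x G12 * Q3 x + x G23 * P1 x)" for x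
    using f(2)[of x] unfolding b13_def diff_eq_eq .
  have V23: "V x G23 = x G23 * g x + 1/2 * (x G12 * P3 x + x G13 * P2 x)" for x
    using g(2)[of x] unfolding b23_def diff_eq_eq .
  \<comment> \<open>\<open>traceless\<close> replaces the entry 0 at \<open>M33\<close> by
    \<open>g + f\<close>. The pairwise sums of the diagonal are then \<open>e\<close>,
    \<open>f\<close> and \<open>g\<close>, since \<open>e + f + g = 0\<close>.\<close>
  define U where "U x k = (case k of M11 \<Rightarrow> - g x | M22 \<Rightarrow> - f x | M33 \<Rightarrow> 0
     | M21 \<Rightarrow> 1/2 * P1 x | M31 \<Rightarrow> 1/2 * Q1 x | M12 \<Rightarrow> 1/2 * P2 x | M32 \<Rightarrow> 1/2 * Q2 x
     | M13 \<Rightarrow> 1/2 * P3 x | M23 \<Rightarrow> 1/2 * Q3 x)" for x k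
  have "pd (n - 1) (\<lambda>x. U x k)" for k
    unfolding U_def by (cases k; simp only: mi.case; intro pd_smult pd_uminus e f g 1 2 3 pd.zero)
  moreover have "V x = phi2 (res D0 x) (traceless (U x))" for x
    by (rule ext, rename_tac m, case_tac m)
      (simp_all add: phi2_def traceless_def U_def 1 2 3 V12 V13 V23 ge algebra_simps)
  ultimately show "\<exists>U. (\<forall>k. pd (n - 1) (\<lambda>x. U x k)) \<and> (\<forall>x. V x = phi2 (res D0 x) (traceless (U x)))" by blast
qed

lemma gram_adj_trace:
  assumes "\<And>j. pol (\<lambda>x :: gi \<Rightarrow> 'a::field_char_0. V x j)" and "\<And>x k. psi2 x (V x) k = 0"
  obtains U where "\<And>k. pol (\<lambda>x. U x k)" and "\<And>x. V x = phi2 x (traceless (U x))"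
proof -
  have "cx2.exact TYPE('a) (UNIV :: gi set)"
    unfolding insert_D0[symmetric] by (intro cx2.exact_insert cx2_base) simp_all
  then show ?thesis by (rule cx2.exact_UNIV[OF _ assms finite_gi]) (rule that)
qed

subsection \<open>Matrices \<open>Y\<close> with \<open>Y G\<close> symmetric\<close>

text \<open>The argument of \<open>phi1\<close> encodes a polynomial \<open>p\<close> (at \<open>None\<close>) and a symmetric matrix \<open>Z\<close>.\<close>

definition phi1 :: "(gi \<Rightarrow> 'a::comm_ring_1) \<Rightarrow> (gi option \<Rightarrow> 'a) \<Rightarrow> mi \<Rightarrow> 'a" where
  "phi1 g u m = (case m of
     M11 \<Rightarrow> u None + g G11 * u (Some G11) + g G12 * u (Some G12) + g G13 * u (Some G13)
   | M12 \<Rightarrow> g G11 * u (Some G12) + g G12 * u (Some G22) + g G13 * u (Some G23)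
   | M13 \<Rightarrow> g G11 * u (Some G13) + g G12 * u (Some G23) + g G13 * u (Some G33)
   | M21 \<Rightarrow> g G12 * u (Some G11) + g G22 * u (Some G12) + g G23 * u (Some G13)
   | M22 \<Rightarrow> u None + g G12 * u (Some G12) + g G22 * u (Some G22) + g G23 * u (Some G23)
   | M23 \<Rightarrow> g G12 * u (Some G13) + g G22 * u (Some G23) + g G23 * u (Some G33)
   | M31 \<Rightarrow> g G13 * u (Some G11) + g G23 * u (Some G12) + g G33 * u (Some G13)
   | M32 \<Rightarrow> g G13 * u (Some G12) + g G23 * u (Some G22) + g G33 * u (Some G23)
   | M33 \<Rightarrow> u None + g G13 * u (Some G13) + g G23 * u (Some G23) + g G33 * u (Some G33))"

text \<open>The entries of \<open>Y G - (Y G)\<^sup>T\<close> above the diagonal, padded by zeros to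
  the index type \<open>gi\<close>.\<close>

definition psi1 :: "(gi \<Rightarrow> 'a::comm_ring_1) \<Rightarrow> (mi \<Rightarrow> 'a) \<Rightarrow> gi \<Rightarrow> 'a" where
  "psi1 g y k = (case k of
     G12 \<Rightarrow> y M11 * g G12 + y M12 * g G22 + y M13 * g G23 - (y M21 * g G11 + y M22 * g G12 + y M23 * g G13)
   | G13 \<Rightarrow> y M11 * g G13 + y M12 * g G23 + y M13 * g G33 - (y M31 * g G11 + y M32 * g G12 + y M33 * g G13)
   | G23 \<Rightarrow> y M21 * g G13 + y M22 * g G23 + y M23 * g G33 - (y M31 * g G12 + y M32 * g G22 + y M33 * g G23)
   | _ \<Rightarrow> 0)"

interpretation cx1: graded_complex "phi1 :: (gi \<Rightarrow> 'a::field_char_0) \<Rightarrow> _" psi1 "\<lambda>k. if k = None then 0 else 1"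
proof
  show "pd n (\<lambda>x. phi1 (res D x) (U x) j)"
    if U: "\<And>k. pd (n - (if k = None then 0 else 1)) (\<lambda>x. U x k)" for D n j and U :: "(gi \<Rightarrow> 'a) \<Rightarrow> _"
  proof -
    have "pd n (\<lambda>x. U x None)" "pd (n - 1) (\<lambda>x. U x (Some k))" for k
      using U[of None] U[of "Some k"] by simp_all
    then show ?thesis
      unfolding phi1_def by (cases j; simp only: mi.case; intro pd.add pd_res_mult)
  qed
  show "pol (\<lambda>x. psi1 (res D x) (V x) k)" if "\<And>j. pol (\<lambda>x. V x j)" for D k and V :: "(gi \<Rightarrow> 'a) \<Rightarrow> _"
    unfolding psi1_def by (cases k; simp only: gi.case; intro pol_add pol_diff pol_mult pol_const pol_res_var that)
qed (rule ext; rename_tac m; case_tac m; simp add: phi1_def psi1_def algebra_simps)+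

text \<open>With zero diagonal, the entries (1,2), (1,3) and (2,1) of \<open>Y\<close> lie in ideals
  of two variables. Removing what a first choice of \<open>Z\<close> contributes leaves two
  relations of Koszul type in two variables; their solutions turn the third one into a relation in
  three variables, whose coefficients \<open>r\<close>, \<open>s\<close>, \<open>t\<close> correct
  \<open>Z\<close>.\<close>

lemma cx1_base: "cx1.exact TYPE('a::field_char_0) D0"
  unfolding cx1.exact_def
proof (intro allI impI, elim conjE)
  fix n and V :: "(gi \<Rightarrow> 'a) \<Rightarrow> mi \<Rightarrow> 'a"
  assume V: "\<forall>j. pd n (\<lambda>x. V x j)" and eq: "\<forall>x k. psi1 (res D0 x) (V x) k = 0"
  note Vj = V[THEN spec] and Vp = pd_pol[OF V[THEN spec]]
  have e12: "x G12 * (V x M11 - V x M22) + x G23 * V x M13 - x G13 * V x M23 = 0" for x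
    using eq[rule_format, of x G12] by (simp add: psi1_def algebra_simps)
  have e13: "x G13 * (V x M11 - V x M33) + x G23 * V x M12 - x G12 * V x M32 = 0" for x
    using eq[rule_format, of x G13] by (simp add: psi1_def algebra_simps)
  have e23: "x G23 * (V x M22 - V x M33) + x G13 * V x M21 - x G12 * V x M31 = 0" for x
    using eq[rule_format, of x G23] by (simp add: psi1_def algebra_simps)
  have v12: "V x M12 = 0" if "x G12 = 0" "x G13 = 0" for x
  proof (rule pol_vanish[of "\<lambda>x. V x M12" G23 "{G12, G13}", OF Vp])
    show "y G23 * V y M12 = 0" if "\<forall>i\<in>{G12, G13}. y i = 0" for y
      using e13[of y] that by simp
  qed (use that in simp_all)
  have v13: "V x M13 = 0" if "x G12 = 0" "x G13 = 0" for x
  proof (rule pol_vanish[of "\<lambda>x. V x M13" G23 "{G12, G13}", OF Vp])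
    show "y G23 * V y M13 = 0" if "\<forall>i\<in>{G12, G13}. y i = 0" for y
      using e12[of y] that by simp
  qed (use that in simp_all)
  have v21: "V x M21 = 0" if "x G12 = 0" "x G23 = 0" for x
  proof (rule pol_vanish[of "\<lambda>x. V x M21" G13 "{G12, G23}", OF Vp])
    show "y G13 * V y M21 = 0" if "\<forall>i\<in>{G12, G23}. y i = 0" for y
      using e23[of y] that by simp
  qed (use that in simp_all)
  obtain \<alpha> \<beta> where 1: "pd (n - 1) \<alpha>" "pd (n - 1) \<beta>" "\<And>x. V x M12 = x G12 * \<alpha> x + x G13 * \<beta> x"
    using ideal2[OF Vj _ v12] by blast
  obtain \<gamma> \<delta> where 2: "pd (n - 1) \<gamma>" "pd (n - 1) \<delta>" "\<And>x. V x M13 = x G12 * \<gamma> x + x G13 * \<delta> x"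
    using ideal2[OF Vj _ v13] by blast
  obtain \<eta> \<epsilon> where 3: "pd (n - 1) \<eta>" "pd (n - 1) \<epsilon>" "\<And>x. V x M21 = x G12 * \<eta> x + x G23 * \<epsilon> x"
    using ideal2[OF Vj _ v21] by blast
  text \<open>Subtracting the contribution of \<open>Z\<close> with entries \<open>\<eta>, \<alpha>, \<delta>\<close> on the diagonal and
    \<open>\<epsilon>, \<beta>\<close> in the last column makes the entries (1,2), (2,1) of \<open>Y\<close> vanish and the entry (1,3)
    divisible by \<open>G12\<close>.\<close>
  define y11 where "y11 x = V x M11 - x G13 * \<epsilon> x" for x
  define y22 where "y22 x = V x M22 - x G23 * \<beta> x" for x
  define y33 where "y33 x = V x M33 - (x G13 * \<epsilon> x + x G23 * \<beta> x)" for x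
  define g' where "g' x = \<gamma> x - \<beta> x" for x
  define y23 where "y23 x = V x M23 - (x G12 * \<epsilon> x + x G23 * \<delta> x)" for x
  define y31 where "y31 x = V x M31 - x G13 * \<eta> x" for x
  define y32 where "y32 x = V x M32 - x G23 * \<alpha> x" for x
  have yd: "pd n y11" "pd n y22" "pd n y33" "pd n y23" "pd n y31" "pd n y32" "pd (n - 1) g'"
    unfolding y11_def y22_def y33_def y23_def y31_def y32_def g'_def
    by (intro pd_diff pd.add pd_var Vj 1 2 3)+
  have f12: "x G12 * (y11 x - y22 x) + x G23 * (x G12 * g' x) = x G13 * y23 x" for x
    using e12[of x] by (simp add: y11_def y22_def y23_def g'_def 2 algebra_simps)
  have f13: "x G13 * (y11 x - y33 x) = x G12 * y32 x" for x
    using e13[of x] by (simp add: y11_def y33_def y32_def 1 algebra_simps)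
  have f23: "x G23 * (y22 x - y33 x) = x G12 * y31 x" for x
    using e23[of x] by (simp add: y22_def y33_def y31_def 3 algebra_simps)
  obtain k where k: "pd (n - 1) k" "\<And>x. y11 x - y33 x = x G12 * k x" "\<And>x. y32 x = x G13 * k x"
    using koszul2[OF pd_diff[OF yd(1,3)] yd(6) _ f13] by blast
  obtain l where l: "pd (n - 1) l" "\<And>x. y22 x - y33 x = x G12 * l x" "\<And>x. y31 x = x G23 * l x"
    using koszul2[OF pd_diff[OF yd(2,3)] yd(5) _ f23] by blast
  have y1122: "y11 x - y22 x = x G12 * (k x - l x)" for x
    using k(2)[of x] l(2)[of x] by (simp add: algebra_simps)
  have f12': "x G12 * (x G12 * (k x - l x) + x G23 * g' x) = x G13 * y23 x" for x
    using f12[of x] unfolding y1122 by (simp add: algebra_simps)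
  have "pd n (\<lambda>x. x G12 * (k x - l x) + x G23 * g' x)" by (intro pd.add pd_var pd_diff k l yd)
  then obtain m where m: "pd (n - 1) m" "\<And>x. x G12 * (k x - l x) + x G23 * g' x = x G13 * m x"
      "\<And>x. y23 x = x G12 * m x"
    using koszul2[OF _ yd(4) _ f12'] by blast
  have "x G12 * (k x - l x) + x G13 * - m x + x G23 * g' x = 0" for x
    using m(2)[of x] by (simp add: algebra_simps)
  then obtain r s t where rst: "pd (n - 1 - 1) r" "pd (n - 1 - 1) s" "pd (n - 1 - 1) t"
    "\<And>x. k x - l x = x G13 * r x + x G23 * s x" "\<And>x. - m x = x G23 * t x - x G12 * r x"
    "\<And>x. g' x = - (x G12 * s x) - x G13 * t x"
    using koszul3[of "n - 1" "\<lambda>x. k x - l x" "\<lambda>x. - m x" g' G12 G13 G23] k l m yd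
    by (blast intro: pd_diff pd_uminus gi.distinct)
  \<comment> \<open>The scalar component is chosen so that the entry (3,3) comes out right, the
    contribution of \<open>G33\<close> being zero here.\<close>
  define U where "U x j = (case j of None \<Rightarrow> V x M33 - x G13 * (\<epsilon> x + x G12 * r x) - x G23 * (\<beta> x - x G12 * s x)
     | Some i \<Rightarrow> (case i of G11 \<Rightarrow> \<eta> x - x G23 * r x | G12 \<Rightarrow> l x + x G13 * r x | G13 \<Rightarrow> \<epsilon> x + x G12 * r x
       | G22 \<Rightarrow> \<alpha> x + x G13 * s x | G23 \<Rightarrow> \<beta> x - x G12 * s x | G33 \<Rightarrow> \<delta> x - x G12 * t x))" for x j
  have pU: "pd (n - 1) (\<lambda>x. \<epsilon> x + x G12 * r x)" "pd (n - 1) (\<lambda>x. \<beta> x - x G12 * s x)"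
    by (intro pd.add pd_diff pd_var 1 3 rst)+
  have "pd (n - (if j = None then 0 else 1)) (\<lambda>x. U x j)" for j
  proof (cases j)
    case None
    have "pd n (\<lambda>x. V x M33 - x G13 * (\<epsilon> x + x G12 * r x) - x G23 * (\<beta> x - x G12 * s x))"
      by (intro pd_diff[of n] pd_var[of n] Vj pU)
    then show ?thesis using None by (simp add: U_def)
  next
    case (Some i)
    have "pd (n - 1) (\<lambda>x. U x (Some i))"
      unfolding U_def option.case
      by (cases i; simp only: gi.case; intro pU pd.add pd_diff pd_var 1 2 3 k l rst)
    then show ?thesis using Some by simp
  qed
  moreover have "V x = phi1 (res D0 x) (U x)" for x
  proof -
    have k': "k x = l x + x G13 * r x + x G23 * s x" using rst(4)[of x] by (simp add: diff_eq_eq add_ac)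
    have m': "m x = x G12 * r x - x G23 * t x" using rst(5)[of x] by (metis minus_diff_eq minus_minus)
    have g'': "\<gamma> x = \<beta> x - x G12 * s x - x G13 * t x" using rst(6)[of x] unfolding g'_def
      by (simp add: diff_eq_eq)
    have V11: "V x M11 = x G13 * \<epsilon> x + (V x M33 - (x G13 * \<epsilon> x + x G23 * \<beta> x)) + x G12 * k x"
      using k(2)[of x] unfolding y11_def y33_def by (simp add: algebra_simps)
    have V22: "V x M22 = x G23 * \<beta> x + (V x M33 - (x G13 * \<epsilon> x + x G23 * \<beta> x)) + x G12 * l x"
      using l(2)[of x] unfolding y22_def y33_def by (simp add: algebra_simps)
    have V23: "V x M23 = x G12 * \<epsilon> x + x G23 * \<delta> x + x G12 * m x"
      using m(3)[of x] unfolding y23_def by (simp add: diff_eq_eq add_ac)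
    have V31: "V x M31 = x G13 * \<eta> x + x G23 * l x"
      using l(3)[of x] unfolding y31_def by (simp add: diff_eq_eq add_ac)
    have V32: "V x M32 = x G23 * \<alpha> x + x G13 * k x"
      using k(3)[of x] unfolding y32_def by (simp add: diff_eq_eq add_ac)
    show ?thesis
    proof (rule ext)
      show "V x j = phi1 (res D0 x) (U x) j" for j
        by (cases j; simp only: phi1_def mi.case res_D0 U_def option.case gi.case 1 2 3 V11 V22 V23 V31 V32 k' m' g'')
          (simp_all add: algebra_simps)
    qed
  qed
  ultimately show "\<exists>U. (\<forall>k. pd (n - (if k = None then 0 else 1)) (\<lambda>x. U x k)) \<and> (\<forall>x. V x = phi1 (res D0 x) (U x))"
    by blast
qed

lemma gram_symmetric:
  assumes "\<And>j. pol (\<lambda>x :: gi \<Rightarrow> 'a::field_char_0. V x j)" and "\<And>x k. psi1 x (V x) k = 0"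
  obtains U where "\<And>k. pol (\<lambda>x. U x k)" and "\<And>x. V x = phi1 x (U x)"
proof -
  have "cx1.exact TYPE('a) (UNIV :: gi set)"
    unfolding insert_D0[symmetric] by (intro cx1.exact_insert cx1_base) simp_all
  then show ?thesis by (rule cx1.exact_UNIV[OF _ assms finite_mi]) (rule that)
qed

subsection \<open>Symmetric matrices \<open>Z\<close> with \<open>G Z\<close> scalar\<close>

definition phi0 :: "(gi \<Rightarrow> 'a::comm_ring_1) \<Rightarrow> (unit \<Rightarrow> 'a) \<Rightarrow> gi \<Rightarrow> 'a" where
  "phi0 g q m = (case m of
     G11 \<Rightarrow> g G22 * (g G33 * q ()) - g G23 * (g G23 * q ())
   | G12 \<Rightarrow> g G13 * (g G23 * q ()) - g G12 * (g G33 * q ())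
   | G13 \<Rightarrow> g G12 * (g G23 * q ()) - g G13 * (g G22 * q ())
   | G22 \<Rightarrow> g G11 * (g G33 * q ()) - g G13 * (g G13 * q ())
   | G23 \<Rightarrow> g G12 * (g G13 * q ()) - g G11 * (g G23 * q ())
   | G33 \<Rightarrow> g G11 * (g G22 * q ()) - g G12 * (g G12 * q ()))"

text \<open>The six off-diagonal entries of \<open>G Z\<close>, so that a cycle is a symmetric
  \<open>Z\<close> making \<open>G Z\<close> diagonal. Exactness shows that \<open>Z\<close> is then
  a multiple of \<open>adj G\<close>.\<close>

definition psi0 :: "(gi \<Rightarrow> 'a::comm_ring_1) \<Rightarrow> (gi \<Rightarrow> 'a) \<Rightarrow> mi \<Rightarrow> 'a" where
  "psi0 g z m = (case m of
     M12 \<Rightarrow> g G11 * z G12 + g G12 * z G22 + g G13 * z G23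
   | M13 \<Rightarrow> g G11 * z G13 + g G12 * z G23 + g G13 * z G33
   | M21 \<Rightarrow> g G12 * z G11 + g G22 * z G12 + g G23 * z G13
   | M23 \<Rightarrow> g G12 * z G13 + g G22 * z G23 + g G23 * z G33
   | M31 \<Rightarrow> g G13 * z G11 + g G23 * z G12 + g G33 * z G13
   | M32 \<Rightarrow> g G13 * z G12 + g G23 * z G22 + g G33 * z G23
   | _ \<Rightarrow> 0)"

interpretation cx0: graded_complex "phi0 :: (gi \<Rightarrow> 'a::field_char_0) \<Rightarrow> _" psi0 "\<lambda>_. 2"
proof
  show "pd n (\<lambda>x. phi0 (res D x) (U x) j)" if "\<And>k. pd (n - 2) (\<lambda>x. U x k)" for D n j and U :: "(gi \<Rightarrow> 'a) \<Rightarrow> _"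
    unfolding phi0_def by (cases j; simp only: gi.case; intro pd_diff pd_res_mult2 that)
  show "pol (\<lambda>x. psi0 (res D x) (V x) k)" if "\<And>j. pol (\<lambda>x. V x j)" for D k and V :: "(gi \<Rightarrow> 'a) \<Rightarrow> _"
    unfolding psi0_def by (cases k; simp only: mi.case; intro pol_add pol_diff pol_mult pol_const pol_res_var that)
qed (rule ext; rename_tac m; case_tac m; simp add: phi0_def psi0_def algebra_simps)+

text \<open>The entries (1,2) and (1,3) of \<open>G Z\<close> give two-term relations linking
  \<open>Z22\<close>, \<open>Z23\<close> and \<open>Z33\<close>, which three divisions reduce to a
  common factor \<open>\<mu>\<close>. The remaining entries of \<open>Z\<close> follow by cancelling
  a variable.\<close>

lemma cx0_base: "cx0.exact TYPE('a::field_char_0) D0"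
  unfolding cx0.exact_def
proof (intro allI impI, elim conjE)
  fix n and V :: "(gi \<Rightarrow> 'a) \<Rightarrow> gi \<Rightarrow> 'a"
  assume V: "\<forall>j. pd n (\<lambda>x. V x j)" and eq: "\<forall>x k. psi0 (res D0 x) (V x) k = 0"
  note Vj = V[THEN spec] and Vp = pd_pol[OF V[THEN spec]]
  have e12: "x G12 * V x G22 = x G13 * - V x G23" for x
    using eq[rule_format, of x M12] by (simp add: psi0_def eq_neg_iff_add_eq_0)
  have e13: "x G13 * V x G33 = x G12 * - V x G23" for x
    using eq[rule_format, of x M13] by (simp add: psi0_def eq_neg_iff_add_eq_0 add.commute)
  have e21: "x G12 * V x G11 + x G23 * V x G13 = 0" and e23: "x G12 * V x G13 + x G23 * V x G33 = 0"
    and e31: "x G13 * V x G11 + x G23 * V x G12 = 0" for x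
    using eq[rule_format, of x M21] eq[rule_format, of x M23] eq[rule_format, of x M31] by (simp_all add: psi0_def)
  obtain \<kappa> where \<kappa>: "pd (n - 1) \<kappa>" "\<And>x. V x G22 = x G13 * \<kappa> x" "\<And>x. - V x G23 = x G12 * \<kappa> x"
    using koszul2[OF Vj[of G22] pd_uminus[OF Vj[of G23]] _ e12] by blast
  have e13': "x G13 * V x G33 = x G12 * (x G12 * \<kappa> x)" for x using e13[of x] \<kappa>(3)[of x] by simp
  have "pd n (\<lambda>x. x G12 * \<kappa> x)" by (intro pd_var \<kappa>)
  then obtain \<nu> where \<nu>: "pd (n - 1) \<nu>" "\<And>x. V x G33 = x G12 * \<nu> x" "\<And>x. x G12 * \<kappa> x = x G13 * \<nu> x"
    using koszul2[OF Vj[of G33] _ _ e13'] by blast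
  obtain \<mu> where \<mu>: "pd (n - 1 - 1) \<mu>" "\<And>x. \<kappa> x = x G13 * \<mu> x" "\<And>x. \<nu> x = x G12 * \<mu> x"
    using koszul2[OF \<kappa>(1) \<nu>(1) _ \<nu>(3)] by blast
  have Z22: "V x G22 = x G13 * (x G13 * \<mu> x)" and Z33: "V x G33 = x G12 * (x G12 * \<mu> x)" for x
    by (simp_all add: \<kappa> \<nu> \<mu>)
  have Z23: "V x G23 = - (x G12 * (x G13 * \<mu> x))" for x using \<kappa>(3)[of x] \<mu>(2)[of x] by (metis minus_minus)
  note pm = pd_pol[OF \<mu>(1)]
  have "x G12 * (V x G13 + x G12 * (x G23 * \<mu> x)) = 0" for x
    using e23[of x] by (simp add: Z33 algebra_simps)
  then have "V x G13 + x G12 * (x G23 * \<mu> x) = 0" for x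
    by (rule pol_cancel_var[rotated]) (intro pol_add pol_mult pol_var Vp pm)
  then have Z13: "V x G13 = - (x G12 * (x G23 * \<mu> x))" for x by (simp add: eq_neg_iff_add_eq_0)
  have "x G12 * (V x G11 - x G23 * (x G23 * \<mu> x)) = 0" for x
    using e21[of x] by (simp add: Z13 algebra_simps)
  then have "V x G11 - x G23 * (x G23 * \<mu> x) = 0" for x
    by (rule pol_cancel_var[rotated]) (intro pol_diff pol_mult pol_var Vp pm)
  then have Z11: "V x G11 = x G23 * (x G23 * \<mu> x)" for x by simp
  have "x G23 * (V x G12 + x G13 * (x G23 * \<mu> x)) = 0" for x
    using e31[of x] by (simp add: Z11 algebra_simps)
  then have "V x G12 + x G13 * (x G23 * \<mu> x) = 0" for x
    by (rule pol_cancel_var[rotated]) (intro pol_add pol_mult pol_var Vp pm)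
  then have Z12: "V x G12 = - (x G13 * (x G23 * \<mu> x))" for x by (simp add: eq_neg_iff_add_eq_0)
  \<comment> \<open>For zero diagonal the entry (2,2) of the adjugate is
    \<open>- G13\<^sup>2\<close>, hence the sign.\<close>
  have "pd (n - 2) (\<lambda>x. - \<mu> x)" using pd_uminus[OF \<mu>(1)] by (simp add: numeral_2_eq_2)
  moreover have "V x = phi0 (res D0 x) (\<lambda>_. - \<mu> x)" for x
    by (rule ext, rename_tac m, case_tac m) (simp_all add: phi0_def Z11 Z12 Z13 Z22 Z23 Z33)
  ultimately show "\<exists>U. (\<forall>k. pd (n - 2) (\<lambda>x. U x k)) \<and> (\<forall>x. V x = phi0 (res D0 x) (U x))"
    by (intro exI[of _ "\<lambda>x _. - \<mu> x"]) blast
qed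

lemma gram_scalar:
  assumes "\<And>j. pol (\<lambda>x :: gi \<Rightarrow> 'a::field_char_0. V x j)" and "\<And>x k. psi0 x (V x) k = 0"
  obtains U where "\<And>k. pol (\<lambda>x. U x k)" and "\<And>x. V x = phi0 x (U x)"
proof -
  have "cx0.exact TYPE('a) (UNIV :: gi set)"
    unfolding insert_D0[symmetric] by (intro cx0.exact_insert cx0_base) simp_all
  then show ?thesis by (rule cx0.exact_UNIV[OF _ assms finite_gi]) (rule that)
qed

subsection \<open>Coprimality of the principal minors \<open>G11 G22 - G12\<^sup>2\<close> and \<open>G22 G33 - G23\<^sup>2\<close>\<close>

text \<open>The Koszul complex of the two minors: a cycle is a pair with
  \<open>minor12 * p = minor23 * q\<close>, and exactness is the coprimality of the minors.
  \<open>True\<close> marks the first member of the pair.\<close>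

definition phiC :: "(gi \<Rightarrow> 'a::comm_ring_1) \<Rightarrow> (unit \<Rightarrow> 'a) \<Rightarrow> bool \<Rightarrow> 'a" where
  "phiC g q b = (if b then g G22 * (g G33 * q ()) - g G23 * (g G23 * q ())
                 else g G11 * (g G22 * q ()) - g G12 * (g G12 * q ()))"

definition psiC :: "(gi \<Rightarrow> 'a::comm_ring_1) \<Rightarrow> (bool \<Rightarrow> 'a) \<Rightarrow> unit \<Rightarrow> 'a" where
  "psiC g v _ = (g G11 * g G22 - g G12 * g G12) * v True - (g G22 * g G33 - g G23 * g G23) * v False"

interpretation cxC: graded_complex "phiC :: (gi \<Rightarrow> 'a::field_char_0) \<Rightarrow> _" psiC "\<lambda>_. 2"
proof
  show "pd n (\<lambda>x. phiC (res D x) (U x) j)" if "\<And>k. pd (n - 2) (\<lambda>x. U x k)" for D n j and U :: "(gi \<Rightarrow> 'a) \<Rightarrow> _"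
    unfolding phiC_def by (cases j; simp only: if_True if_False; intro pd_diff pd_res_mult2 that)
  show "pol (\<lambda>x. psiC (res D x) (V x) k)" if "\<And>j. pol (\<lambda>x. V x j)" for D k and V :: "(gi \<Rightarrow> 'a) \<Rightarrow> _"
    unfolding psiC_def by (intro pol_add pol_diff pol_mult pol_const pol_res_var that)
qed (rule ext; simp add: phiC_def psiC_def algebra_simps)+

text \<open>Here it is enough to set \<open>G22\<close> to zero: the minors become the negatives of
  \<open>G12\<^sup>2\<close> and \<open>G23\<^sup>2\<close>, and coprimality of these squares takes
  four divisions by variables.\<close>

lemma cxC_base: "cxC.exact TYPE('a::field_char_0) (- {G22})"
  unfolding cxC.exact_def
proof (intro allI impI, elim conjE)
  fix n and V :: "(gi \<Rightarrow> 'a) \<Rightarrow> bool \<Rightarrow> 'a"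
  assume V: "\<forall>j. pd n (\<lambda>x. V x j)" and eq: "\<forall>x k. psiC (res (- {G22}) x) (V x) k = 0"
  note Vj = V[THEN spec]
  have r: "res (- {G22}) x G22 = 0" "i \<noteq> G22 \<Longrightarrow> res (- {G22}) x i = x i" for x :: "gi \<Rightarrow> 'a" and i
    by (simp_all add: res_def)
  have e: "x G12 * (x G12 * V x True) = x G23 * (x G23 * V x False)" for x
    using eq[rule_format, of x "()"] by (simp add: psiC_def r algebra_simps)
  have d: "pd (Suc n) (\<lambda>x. x i * V x j)" for i j by (intro pd.var Vj)
  obtain h where h: "pd (Suc n - 1) h" "\<And>x. x G12 * V x True = x G23 * h x" "\<And>x. x G23 * V x False = x G12 * h x"
    using koszul2[OF d d _ e] by blast
  have h1: "pd n h" using h(1) by simp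
  obtain h' where h': "pd (n - 1) h'" "\<And>x. V x True = x G23 * h' x" "\<And>x. h x = x G12 * h' x"
    using koszul2[OF Vj[of True] h1 _ h(2)] by blast
  obtain k where k: "pd (n - 1) k" "\<And>x. V x False = x G12 * k x" "\<And>x. h x = x G23 * k x"
    using koszul2[OF Vj[of False] h1 _ h(3)] by blast
  have "x G12 * h' x = x G23 * k x" for x using h'(3)[of x] k(3)[of x] by simp
  then obtain l where l: "pd (n - 1 - 1) l" "\<And>x. h' x = x G23 * l x" "\<And>x. k x = x G12 * l x"
    using koszul2[OF h'(1) k(1)] by blast
  have "pd (n - 2) (\<lambda>x. - l x)" using pd_uminus[OF l(1)] by (simp add: numeral_2_eq_2)
  moreover have "V x = phiC (res (- {G22}) x) (\<lambda>_. - l x)" for x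
    by (rule ext, rename_tac m, case_tac m) (simp_all add: phiC_def r h' k l)
  ultimately show "\<exists>U. (\<forall>k. pd (n - 2) (\<lambda>x. U x k)) \<and> (\<forall>x. V x = phiC (res (- {G22}) x) (U x))"
    by (intro exI[of _ "\<lambda>x _. - l x"]) blast
qed

lemma minors_coprime:
  fixes p q :: "(gi \<Rightarrow> 'a::field_char_0) \<Rightarrow> 'a"
  assumes "pol p" "pol q"
    and "\<And>x. (x G11 * x G22 - x G12 * x G12) * p x = (x G22 * x G33 - x G23 * x G23) * q x"
  obtains k where "pol k" "\<And>x. q x = (x G11 * x G22 - x G12 * x G12) * k x"
proof -
  have "insert G22 (- {G22}) = UNIV" by auto
  then have ex: "cxC.exact TYPE('a) (UNIV :: gi set)"
    using cxC.exact_insert[OF cxC_base] by (metis ComplD singletonI)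
  show ?thesis
  proof (rule cxC.exact_UNIV[OF ex, of "\<lambda>x b. if b then p x else q x"])
    show "pol (\<lambda>x. if j then p x else q x)" for j using assms by (cases j) simp_all
    show "psiC x (\<lambda>b. if b then p x else q x) k = 0" for x k using assms(3)[of x] by (simp add: psiC_def)
  next
    fix U :: "(gi \<Rightarrow> 'a) \<Rightarrow> unit \<Rightarrow> 'a"
    assume U: "\<And>k. pol (\<lambda>x. U x k)" "\<And>x. (\<lambda>b. if b then p x else q x) = phiC x (U x)"
    have "q x = (x G11 * x G22 - x G12 * x G12) * U x ()" for x
      using fun_cong[OF U(2)[of x], of False] by (simp add: phiC_def algebra_simps)
    then show ?thesis by (rule that[OF U(1)])
  qed simp
qed

section \<open>Polynomial functions on triples of vectors\<close>

lemma is_poly_pol: "is_poly f \<Longrightarrow> pol (\<lambda>x. f (\<chi> k m. x (k, m)))"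
proof (induction rule: is_poly.induct)
  case (coord k m)
  show ?case by simp
qed (auto intro: pol_add pol_mult)

lemma is_poly_uminus: "is_poly f \<Longrightarrow> is_poly (\<lambda>c. - f c)"
  using is_poly.mult[OF is_poly.const[of "-1"], of f] by simp

lemma is_poly_diff: "is_poly f \<Longrightarrow> is_poly g \<Longrightarrow> is_poly (\<lambda>c. f c - g c)"
  using is_poly.add[OF _ is_poly_uminus, of f g] by simp

lemma is_poly_power: "is_poly f \<Longrightarrow> is_poly (\<lambda>c. f c ^ n)"
  by (induction n) (simp_all add: is_poly.const is_poly.mult)

lemmas is_poly_intros = is_poly.add is_poly.mult is_poly_diff is_poly_uminus is_poly.coord is_poly.const

lemma is_poly_domain:
  fixes f g :: "'a::field_char_0 pt \<Rightarrow> 'a"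
  assumes "is_poly f" "is_poly g" "\<And>c. f c * g c = 0" "f c0 \<noteq> 0"
  shows "g c = 0"
proof -
  let ?mk = "\<lambda>x :: 3 \<times> 3 \<Rightarrow> 'a. (\<chi> k m. x (k, m)) :: 'a pt"
  have mk: "?mk (\<lambda>(k, m). c $ k $ m) = c" for c by (simp add: vec_eq_iff)
  have "g (?mk (\<lambda>(k, m). c $ k $ m)) = 0"
    by (rule pol_domain[OF is_poly_pol[OF assms(1)] is_poly_pol[OF assms(2)],
          where z = "\<lambda>(k, m). c0 $ k $ m"]) (simp_all only: assms(3) mk assms(4) not_False_eq_True)
  then show ?thesis unfolding mk .
qed

lemma is_poly_curve:
  fixes f :: "'a::field_char_0 pt \<Rightarrow> 'a"
  assumes "is_poly f"
  shows "\<exists>q. \<forall>t. f (\<chi> k m. if k = i \<and> m = j then t else c $ k $ m) = poly q t"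
  using assms
proof (induction rule: is_poly.induct)
  case (const a)
  then show ?case by (intro exI[of _ "[:a:]"]) simp
next
  case (coord k m)
  then show ?case
    by (cases "k = i \<and> m = j") (auto intro: exI[of _ "[:0, 1:]"] exI[of _ "[:c $ k $ m:]"])
next
  case (add f g)
  then obtain p q where "\<forall>t. f (\<chi> k m. if k = i \<and> m = j then t else c $ k $ m) = poly p t"
     "\<forall>t. g (\<chi> k m. if k = i \<and> m = j then t else c $ k $ m) = poly q t" by blast
  then show ?case by (intro exI[of _ "p + q"]) simp
next
  case (mult f g)
  then obtain p q where "\<forall>t. f (\<chi> k m. if k = i \<and> m = j then t else c $ k $ m) = poly p t"
     "\<forall>t. g (\<chi> k m. if k = i \<and> m = j then t else c $ k $ m) = poly q t" by blast
  then show ?case by (intro exI[of _ "p * q"]) simp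
qed

section \<open>The action of the rotation group\<close>

definition rot :: "'a::comm_ring_1^3^3 \<Rightarrow> 'a pt \<Rightarrow> 'a pt" where
  "rot h c = c ** transpose h"

lemma rot_nth: "rot h c $ k $ m = h $ m $ 1 * c $ k $ 1 + h $ m $ 2 * c $ k $ 2 + h $ m $ 3 * c $ k $ 3"
  by (simp add: rot_def matrix_matrix_mult_def transpose_def sum_3 mult.commute)

text \<open>The coordinates of \<open>skew v\<close> are those of its axis, up to order and signs; \<open>conj3 g\<close> is the
  rotation \<open>g\<close> of the axis written in these coordinates.\<close>

definition conj3 :: "'a::comm_ring_1^3^3 \<Rightarrow> 'a^3^3" where
  "conj3 g = vector [vector [g$3$3, - g$3$2, g$3$1], vector [- g$2$3, g$2$2, - g$2$1],
     vector [g$1$3, - g$1$2, g$1$1]]"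

lemma conj3_conj3 [simp]: "conj3 (conj3 g) = g"
  by (simp add: conj3_def vec_eq_iff forall_3)

lemma conj3_SO3:
  assumes "g \<in> SO3"
  shows "conj3 g \<in> SO3"
proof -
  \<comment> \<open>\<open>J\<close> carries the axis \<open>(a1, a2, a3)\<close> to the coordinates
    \<open>(- a3, a2, - a1)\<close> of its cross product matrix.\<close>
  define J :: "'a^3^3" where "J = vector [vector [0, 0, -1], vector [0, 1, 0], vector [-1, 0, 0]]"
  have J: "conj3 g = J ** g ** J" "J ** J = mat 1" "transpose J = J"
    by (simp_all add: J_def conj3_def vec_eq_iff forall_3 matrix_matrix_mult_def sum_3 transpose_def mat_def)
  have JJ: "X ** J ** J = X" for X :: "'a^3^3"
    by (metis J(2) matrix_mul_assoc matrix_mul_rid)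
  have "transpose (J ** g ** J) ** (J ** g ** J) = J ** (transpose g ** g) ** J"
    by (simp only: matrix_transpose_mul J matrix_mul_assoc JJ)
  also have "\<dots> = mat 1" using assms by (simp add: SO3_def J)
  finally have "transpose (conj3 g) ** conj3 g = mat 1" unfolding J .
  moreover have "det (conj3 g) = det g * det (J ** J)" unfolding J(1) by (simp add: det_mul mult_ac)
  ultimately show ?thesis using assms by (simp add: SO3_def J)
qed

lemma SO3_right: "g \<in> SO3 \<Longrightarrow> g ** transpose g = mat 1" for g :: "'a::field^3^3"
  unfolding SO3_def using matrix_left_right_inverse by blast

text \<open>The adjugate \<open>A\<close> satisfies \<open>A g = det g = 1\<close>, and multiplying
  by the transpose on the right gives \<open>A = g\<^sup>T\<close>: every entry of a rotation is its
  own cofactor.\<close>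

lemma SO3_cofactor:
  fixes g :: "'a::field^3^3"
  assumes "g \<in> SO3"
  shows "g$2$2 * g$3$3 - g$2$3 * g$3$2 = g$1$1" "g$2$3 * g$3$1 - g$2$1 * g$3$3 = g$1$2"
    "g$2$1 * g$3$2 - g$2$2 * g$3$1 = g$1$3" "g$1$3 * g$3$2 - g$1$2 * g$3$3 = g$2$1"
    "g$1$1 * g$3$3 - g$1$3 * g$3$1 = g$2$2" "g$1$2 * g$3$1 - g$1$1 * g$3$2 = g$2$3"
    "g$1$2 * g$2$3 - g$1$3 * g$2$2 = g$3$1" "g$1$3 * g$2$1 - g$1$1 * g$2$3 = g$3$2"
    "g$1$1 * g$2$2 - g$1$2 * g$2$1 = g$3$3"
proof -
  define A :: "'a^3^3" where "A = vector [
    vector [g$2$2 * g$3$3 - g$2$3 * g$3$2, g$1$3 * g$3$2 - g$1$2 * g$3$3, g$1$2 * g$2$3 - g$1$3 * g$2$2],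
    vector [g$2$3 * g$3$1 - g$2$1 * g$3$3, g$1$1 * g$3$3 - g$1$3 * g$3$1, g$1$3 * g$2$1 - g$1$1 * g$2$3],
    vector [g$2$1 * g$3$2 - g$2$2 * g$3$1, g$1$2 * g$3$1 - g$1$1 * g$3$2, g$1$1 * g$2$2 - g$1$2 * g$2$1]]"
  have "A ** g = mat (det g)"
    by (simp add: A_def vec_eq_iff forall_3 matrix_matrix_mult_def sum_3 mat_def det_3 algebra_simps)
  then have "A ** g = mat 1" using assms by (simp add: SO3_def)
  then have "A = transpose g"
    by (metis SO3_right[OF assms] matrix_mul_assoc matrix_mul_lid matrix_mul_rid)
  then have "A $ i $ j = g $ j $ i" for i j by (simp add: transpose_def)
  note this[of 1 1] this[of 1 2] this[of 1 3] this[of 2 1] this[of 2 2] this[of 2 3] this[of 3 1] this[of 3 2] this[of 3 3]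
  then show "g$2$2 * g$3$3 - g$2$3 * g$3$2 = g$1$1" "g$2$3 * g$3$1 - g$2$1 * g$3$3 = g$1$2"
    "g$2$1 * g$3$2 - g$2$2 * g$3$1 = g$1$3" "g$1$3 * g$3$2 - g$1$2 * g$3$3 = g$2$1"
    "g$1$1 * g$3$3 - g$1$3 * g$3$1 = g$2$2" "g$1$2 * g$3$1 - g$1$1 * g$3$2 = g$2$3"
    "g$1$2 * g$2$3 - g$1$3 * g$2$2 = g$3$1" "g$1$3 * g$2$1 - g$1$1 * g$2$3 = g$3$2"
    "g$1$1 * g$2$2 - g$1$2 * g$2$1 = g$3$3"
    by (simp_all add: A_def)
qed

text \<open>Conjugating a skew-symmetric matrix acts on its coordinates through the 2x2 minors of
  \<open>g\<close>, which for a rotation are entries of \<open>g\<close> again.\<close>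

lemma so_act_eq_rot:
  fixes g :: "'a::field^3^3"
  assumes "g \<in> SO3"
  shows "so_act g c = rot (conj3 g) c"
proof -
  have "so_act g c $ k $ m = rot (conj3 g) c $ k $ m" for k m
  proof -
    have "so_act g c $ k $ 1 = (g$1$1 * g$2$2 - g$1$2 * g$2$1) * c$k$1 - (g$1$3 * g$2$1 - g$1$1 * g$2$3) * c$k$2
        + (g$1$2 * g$2$3 - g$1$3 * g$2$2) * c$k$3"
      by (simp add: so_act_def unskew_def skew_def matrix_matrix_mult_def transpose_def sum_3 algebra_simps)
    moreover have "so_act g c $ k $ 2 = - (g$1$2 * g$3$1 - g$1$1 * g$3$2) * c$k$1 + (g$1$1 * g$3$3 - g$1$3 * g$3$1) * c$k$2
        - (g$1$3 * g$3$2 - g$1$2 * g$3$3) * c$k$3"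
      by (simp add: so_act_def unskew_def skew_def matrix_matrix_mult_def transpose_def sum_3 algebra_simps)
    moreover have "so_act g c $ k $ 3 = (g$2$1 * g$3$2 - g$2$2 * g$3$1) * c$k$1 - (g$2$3 * g$3$1 - g$2$1 * g$3$3) * c$k$2
        + (g$2$2 * g$3$3 - g$2$3 * g$3$2) * c$k$3"
      by (simp add: so_act_def unskew_def skew_def matrix_matrix_mult_def transpose_def sum_3 algebra_simps)
    ultimately show ?thesis
      using exhaust_3[of m] unfolding SO3_cofactor[OF assms] by (auto simp: rot_nth conj3_def)
  qed
  then show ?thesis by (simp add: vec_eq_iff)
qed

lemma Inv3_rot:
  fixes f :: "'a::field pt \<Rightarrow> 'a"
  assumes "f \<in> Inv3" "h \<in> SO3"
  shows "f (rot h c) = f c"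
proof -
  have "f (so_act (conj3 h) c) = f c" using assms conj3_SO3 unfolding Inv3_def by blast
  then show ?thesis by (simp add: so_act_eq_rot[OF conj3_SO3[OF assms(2)]])
qed

lemma Inv3_iff:
  fixes f :: "'a::field pt \<Rightarrow> 'a"
  shows "f \<in> Inv3 \<longleftrightarrow> is_poly f \<and> (\<forall>h\<in>SO3. \<forall>c. f (rot h c) = f c)"
  using Inv3_rot[of f] conj3_SO3 by (fastforce simp: Inv3_def so_act_eq_rot)

section \<open>Gram matrices\<close>

definition gp :: "3 \<Rightarrow> 3 \<Rightarrow> 'a::comm_ring_1 pt \<Rightarrow> 'a" where
  "gp i j c = c$i$1 * c$j$1 + c$i$2 * c$j$2 + c$i$3 * c$j$3"

lemma gp_eq: "gp i j c = (c ** transpose c) $ i $ j"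
  by (simp add: gp_def matrix_matrix_mult_def transpose_def sum_3)

lemma gp_commute: "gp i j = gp j i"
  by (auto simp: gp_def)

lemma gp_rot: "h \<in> SO3 \<Longrightarrow> gp i j (rot h c) = gp i j c"
proof -
  assume "h \<in> SO3"
  then have "(c ** transpose h) ** transpose (c ** transpose h) = c ** transpose c"
    unfolding SO3_def by (simp add: matrix_transpose_mul transpose_transpose)
      (metis matrix_mul_assoc matrix_mul_lid)
  then show ?thesis by (simp add: gp_eq rot_def)
qed

lemma det_rot: "h \<in> SO3 \<Longrightarrow> det (rot h c) = det c"
  by (simp add: rot_def det_mul SO3_def det_transpose)

definition gam :: "'a::comm_ring_1 pt \<Rightarrow> gi \<Rightarrow> 'a" where
  "gam c i = (case i of G11 \<Rightarrow> gp 1 1 c | G12 \<Rightarrow> gp 1 2 c | G13 \<Rightarrow> gp 1 3 c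
     | G22 \<Rightarrow> gp 2 2 c | G23 \<Rightarrow> gp 2 3 c | G33 \<Rightarrow> gp 3 3 c)"

lemma gam_simps [simp]: "gam c G11 = gp 1 1 c" "gam c G12 = gp 1 2 c" "gam c G13 = gp 1 3 c"
  "gam c G22 = gp 2 2 c" "gam c G23 = gp 2 3 c" "gam c G33 = gp 3 3 c"
  by (simp_all add: gam_def)

lemma gam_rot: "h \<in> SO3 \<Longrightarrow> gam (rot h c) = gam c"
  by (rule ext, rename_tac i, case_tac i) (simp_all add: gp_rot)

lemma is_poly_gp: "is_poly (gp i j)"
  unfolding gp_def by (intro is_poly_intros)

lemma is_poly_gam: "pol p \<Longrightarrow> is_poly (\<lambda>c. p (gam c))"
proof (induction rule: pol_induct)
  case (var f i)
  have "is_poly (\<lambda>c. gam c i)" by (cases i) (simp_all add: is_poly_gp)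
  then show ?case using var by (intro is_poly.mult)
qed (auto intro: is_poly.intros)

lemma is_poly_det: "is_poly det"
proof -
  have "is_poly (\<lambda>c. det c)" unfolding det_3 by (intro is_poly_intros)
  then show ?thesis by simp
qed

lemma trP_eq: "trP i j c = - 2 * gp i j c"
  by (simp add: trP_def tv_def trace_def skew_def matrix_matrix_mult_def sum_3 gp_def algebra_simps)

lemma trace3_eq: "trace (tv 1 c ** tv 2 c ** tv 3 c) = det c"
  by (simp add: tv_def trace_def skew_def matrix_matrix_mult_def sum_3 det_3 algebra_simps)

lemma gp_Palg: "gp i j \<in> (Palg :: ('a::field_char_0 pt \<Rightarrow> 'a) set)"
proof -
  have t: "trP i j \<in> (Palg :: ('a pt \<Rightarrow> 'a) set)"
  proof -
    have "trP i j = (trP j i :: 'a pt \<Rightarrow> 'a)" by (auto simp: trP_eq gp_commute[of i j])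
    moreover have "trP k l \<in> (Palg :: ('a pt \<Rightarrow> 'a) set)"
      if "(k, l) \<in> {(1,1),(2,2),(3,3),(1,2),(1,3),(2,3)}" for k l
      using that by (auto intro: Palg.gen)
    ultimately show ?thesis using exhaust_3[of i] exhaust_3[of j] by (metis insertCI)
  qed
  have "gp i j = (\<lambda>c :: 'a pt. - (1/2) * trP i j c)" by (auto simp: trP_eq)
  then show ?thesis using Palg.mult[OF Palg.const t] by metis
qed

lemma Palg_iff: "f \<in> Palg \<longleftrightarrow> (\<exists>p. pol p \<and> f = (\<lambda>c :: 'a::field_char_0 pt. p (gam c)))"
proof
  show "\<exists>p. pol p \<and> f = (\<lambda>c. p (gam c))" if "f \<in> Palg"
    using that
  proof (induction rule: Palg.induct)
    case (const a)
    then show ?case by (intro exI[of _ "\<lambda>x. a"]) simp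
  next
    case (gen f)
    have "\<exists>p. pol p \<and> trP k l = (\<lambda>c :: 'a pt. p (gam c))" if "\<And>c :: 'a pt. gp k l c = gam c i" for k l i
      using that by (intro exI[of _ "\<lambda>x. - 2 * x i"]) (auto simp: trP_eq)
    from this[of 1 1 G11] this[of 1 2 G12] this[of 1 3 G13] this[of 2 2 G22] this[of 2 3 G23] this[of 3 3 G33]
    show ?case using gen by auto
  next
    case (add f g)
    then obtain p q where "pol p" "pol q" "f = (\<lambda>c. p (gam c))" "g = (\<lambda>c. q (gam c))" by blast
    then show ?case by (intro exI[of _ "\<lambda>x. p x + q x"]) auto
  next
    case (mult f g)
    then obtain p q where "pol p" "pol q" "f = (\<lambda>c. p (gam c))" "g = (\<lambda>c. q (gam c))" by blast
    then show ?case by (intro exI[of _ "\<lambda>x. p x * q x"]) auto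
  qed
  have "(\<lambda>c :: 'a pt. p (gam c)) \<in> Palg" if "pol p" for p
    using that
  proof (induction rule: pol_induct)
    case (var f i)
    have "(\<lambda>c :: 'a pt. gam c i) \<in> Palg" by (cases i) (simp_all add: gp_Palg)
    then show ?case using var.IH by (rule Palg.mult)
  qed (auto intro: Palg.intros)
  then show "f \<in> Palg" if "\<exists>p. pol p \<and> f = (\<lambda>c. p (gam c))" using that by blast
qed

lemma pol_zero_if_squares:
  fixes p :: "('i \<Rightarrow> 'a::field_char_0) \<Rightarrow> 'a"
  assumes "pol p" and "\<And>y. y \<noteq> 0 \<Longrightarrow> p (x(i := b + y\<^sup>2)) = 0"
  shows "p x = 0"
proof -
  obtain q where q: "\<And>t. p (x(i := t)) = poly q t" using pol_upd[OF assms(1), of x i] by blast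
  have "q = 0"
    by (rule poly_eq_0_if_infinite[OF infinite_squares[of b]]) (use assms(2) q in auto)
  then show ?thesis using q[of "x i"] by simp
qed

text \<open>A triangular triple can realise arbitrary off-diagonal Gram entries once its first two
  diagonal entries are nonzero, while the diagonal of the Gram matrix runs through translates of
  squares. One diagonal variable at a time, these values suffice to kill \<open>p\<close>.\<close>

lemma gam_algebraically_independent:
  fixes p :: "(gi \<Rightarrow> 'a::field_char_0) \<Rightarrow> 'a"
  assumes p: "pol p" and z: "\<And>c. p (gam c) = 0"
  shows "p x = 0"
proof (rule pol_zero_if_squares[OF p, of _ G11 0])
  fix u :: 'a assume u: "u \<noteq> 0"
  define x1 where "x1 = x(G11 := 0 + u\<^sup>2)"
  define s where "s = x G12 / u"
  show "p x1 = 0"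
  proof (rule pol_zero_if_squares[OF p, of _ G22 "s\<^sup>2"])
    fix v :: 'a assume v: "v \<noteq> 0"
    define x2 where "x2 = x1(G22 := s\<^sup>2 + v\<^sup>2)"
    define t where "t = x G13 / u"
    \<comment> \<open>Solves \<open>s * t + v * w = x G23\<close>, the inner product of the second
      and third rows.\<close>
    define w where "w = (x G23 - s * t) / v"
    show "p x2 = 0"
    proof (rule pol_zero_if_squares[OF p, of _ G33 "t\<^sup>2 + w\<^sup>2"])
      fix y :: 'a
      define c :: "'a pt" where "c = vector [vector [u, 0, 0], vector [s, v, 0], vector [t, w, y]]"
      have "gam c = x2(G33 := t\<^sup>2 + w\<^sup>2 + y\<^sup>2)"
        by (rule ext, rename_tac i, case_tac i)
          (use u v in \<open>simp_all add: c_def gp_def x2_def x1_def s_def t_def w_def power2_eq_square\<close>)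
      then show "p (x2(G33 := t\<^sup>2 + w\<^sup>2 + y\<^sup>2)) = 0" using z[of c] by simp
    qed
  qed
qed

section \<open>Vanishing on lower triangular triples\<close>

definition tri :: "'a::zero pt \<Rightarrow> bool" where
  "tri c \<longleftrightarrow> c$1$2 = 0 \<and> c$1$3 = 0 \<and> c$2$3 = 0"

definition giv12 :: "'a::comm_ring_1 \<Rightarrow> 'a \<Rightarrow> 'a^3^3" where
  "giv12 a b = vector [vector [a, b, 0], vector [- b, a, 0], vector [0, 0, 1]]"

definition giv23 :: "'a::comm_ring_1 \<Rightarrow> 'a \<Rightarrow> 'a^3^3" where
  "giv23 a b = vector [vector [1, 0, 0], vector [0, a, b], vector [0, - b, a]]"

lemma giv_SO3: "a * a + b * b = 1 \<Longrightarrow> giv12 a b \<in> SO3" "a * a + b * b = 1 \<Longrightarrow> giv23 a b \<in> SO3"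
  by (simp_all add: SO3_def giv12_def giv23_def vec_eq_iff forall_3 matrix_matrix_mult_def sum_3
      transpose_def mat_def det_3 add.commute mult.commute)

definition upd :: "'a pt \<Rightarrow> 3 \<Rightarrow> 3 \<Rightarrow> 'a \<Rightarrow> 'a pt" where
  "upd c i j t = (\<chi> k m. if k = i \<and> m = j then t else c $ k $ m)"

text \<open>A rotation over the field itself in the plane of the \<open>i\<close>-th and \<open>j\<close>-th coordinates that kills
  the second of the coordinates \<open>u, r\<close> of a vector exists if \<open>u\<^sup>2 + r\<^sup>2\<close> is a nonzero square. For
  given \<open>r \<noteq> 0\<close> this is so for infinitely many \<open>u\<close>, which suffices for polynomials.\<close>

lemma givens_vanish:
  fixes H :: "'a::field_char_0 pt \<Rightarrow> 'a"
  assumes H: "is_poly H" and inv: "\<And>h c. h \<in> SO3 \<Longrightarrow> H (rot h c) = H c"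
    and giv: "(i = 1 \<and> j = 2 \<and> giv = giv12) \<or> (i = 2 \<and> j = 3 \<and> giv = giv23)"
    and P: "\<And>c t. P c \<Longrightarrow> P (upd c k i t)" "\<And>c a b. P c \<Longrightarrow> P (rot (giv a b) c)"
    and van: "\<And>c. P c \<Longrightarrow> c $ k $ j = 0 \<Longrightarrow> H c = 0"
    and c: "P c"
  shows "H c = 0"
proof (cases "c $ k $ j = 0")
  case True
  then show ?thesis using van c by blast
next
  case False
  define r where "r = c $ k $ j"
  have r: "r \<noteq> 0" using False by (simp add: r_def)
  \<comment> \<open>Only the entry \<open>i\<close> of row \<open>k\<close> varies, so the entry
    \<open>r\<close> that is to be rotated away stays fixed.\<close>
  have "\<exists>q. \<forall>t. H (upd c k i t) = poly q t" unfolding upd_def by (rule is_poly_curve[OF H])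
  then obtain q where "\<forall>t. H (upd c k i t) = poly q t" by (rule exE)
  then have q: "H (upd c k i t) = poly q t" for t by (rule spec)
  have "poly q u = 0" if "u \<in> {(r\<^sup>2 / t - t) / 2 | t. t \<noteq> 0 \<and> r\<^sup>2 / t + t \<noteq> 0}" for u
  proof -
    from that obtain t where "u = (r\<^sup>2 / t - t) / 2 \<and> t \<noteq> 0 \<and> r\<^sup>2 / t + t \<noteq> 0"
      unfolding mem_Collect_eq by (rule exE)
    then have t: "t \<noteq> 0" "r\<^sup>2 / t + t \<noteq> 0" "u = (r\<^sup>2 / t - t) / 2" by simp_all
    define w where "w = (r\<^sup>2 / t + t) / 2"
    have w: "w \<noteq> 0" using t(2) unfolding w_def by (metis divide_eq_0_iff zero_neq_numeral)
    \<comment> \<open>For \<open>A = r\<^sup>2 / t\<close> the product \<open>A * t\<close> is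
      \<open>r\<^sup>2\<close>, which gives a rational square root \<open>w\<close> of
      \<open>u\<^sup>2 + r\<^sup>2\<close>.\<close>
    have "(A + t) / 2 * ((A + t) / 2) = (A - t) / 2 * ((A - t) / 2) + A * t" for A
      by (simp add: field_simps)
    from this[of "r\<^sup>2 / t"] have ww: "w * w = u * u + r * r"
      using t(1) by (simp add: w_def t(3) power2_eq_square)
    have "(u / w) * (u / w) + (r / w) * (r / w) = (u * u + r * r) / (w * w)"
      by (simp add: add_divide_distrib)
    then have 1: "(u / w) * (u / w) + (r / w) * (r / w) = 1"
      unfolding ww[symmetric] using w by simp
    have ij: "i \<noteq> j" using giv by auto
    have d: "upd c k i u $ k $ i = u" "upd c k i u $ k $ j = r" using ij by (auto simp: upd_def r_def)
    \<comment> \<open>The rotation with cosine \<open>u / w\<close> and sine \<open>r / w\<close>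
      carries \<open>(u, r)\<close> to \<open>(w, 0)\<close>.\<close>
    have "rot (giv (u / w) (r / w)) (upd c k i u) $ k $ j = 0"
      using giv
    proof (elim disjE conjE)
      assume "i = 1" "j = 2" "giv = giv12"
      then show ?thesis using d by (simp add: rot_nth giv12_def)
    next
      assume "i = 2" "j = 3" "giv = giv23"
      then show ?thesis using d by (simp add: rot_nth giv23_def)
    qed
    moreover have "P (rot (giv (u / w) (r / w)) (upd c k i u))" using P c by blast
    ultimately have "H (rot (giv (u / w) (r / w)) (upd c k i u)) = 0" using van by blast
    moreover have "giv (u / w) (r / w) \<in> SO3" using giv giv_SO3[OF 1] by auto
    ultimately show ?thesis using inv q by metis
  qed
  then have "q = 0" by (rule poly_eq_0_if_infinite[OF infinite_pythagorean[OF r]])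
  moreover have "upd c k i (c $ k $ i) = c" by (auto simp: upd_def vec_eq_iff)
  ultimately show ?thesis using q[of "c $ k $ i"] by simp
qed

text \<open>Rotations kill the entries (1,3), (1,2) and (2,3) in this order, and none of them spoils
  a zero obtained before: the last one moves only coordinates in which the first row already
  vanishes. The three facts are therefore proved in the reverse order.\<close>

lemma vanish_if_vanish_on_tri:
  fixes H :: "'a::field_char_0 pt \<Rightarrow> 'a"
  assumes H: "is_poly H" and inv: "\<And>h c. h \<in> SO3 \<Longrightarrow> H (rot h c) = H c"
    and tri: "\<And>c. tri c \<Longrightarrow> H c = 0"
  shows "H c = 0"
proof -
  note giv = givens_vanish[OF H inv]
  have 3: "H c = 0" if "c$1$2 = 0 \<and> c$1$3 = 0" for c
    by (rule giv[of 2 3 giv23 "\<lambda>c. c$1$2 = 0 \<and> c$1$3 = 0" 2])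
      (use that tri in \<open>auto simp: tri_def upd_def rot_nth giv23_def\<close>)
  have 2: "H c = 0" if "c$1$3 = 0" for c
    by (rule giv[of 1 2 giv12 "\<lambda>c. c$1$3 = 0" 1])
      (use that 3 in \<open>auto simp: upd_def rot_nth giv12_def\<close>)
  show ?thesis
    by (rule giv[of 2 3 giv23 "\<lambda>c. True" 1]) (use 2 in auto)
qed

section \<open>Invariants on lower triangular triples\<close>

definition minor12 :: "'a::comm_ring_1 pt \<Rightarrow> 'a" where
  "minor12 c = gp 1 1 c * gp 2 2 c - gp 1 2 c * gp 1 2 c"

text \<open>On triangular triples this is \<open>x^4 y^2\<close> for the first two diagonal entries
  \<open>x\<close>, \<open>y\<close>, which are exactly the divisors met when solving for the
  coordinates by Gram-Schmidt.\<close>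

definition cden :: "'a::comm_ring_1 pt \<Rightarrow> 'a" where
  "cden c = gp 1 1 c * minor12 c"

text \<open>Up to powers of \<open>cden\<close> the squares of the three diagonal entries are
  polynomials in the Gram entries, so the eight squarefree monomials in the diagonal entries span.
  The Booleans say which diagonal entries occur in the monomial.\<close>

definition tri_comb :: "(bool \<Rightarrow> bool \<Rightarrow> bool \<Rightarrow> (gi \<Rightarrow> 'a) \<Rightarrow> 'a::comm_ring_1) \<Rightarrow> 'a pt \<Rightarrow> 'a" where
  "tri_comb r c = r False False False (gam c) + c$1$1 * r True False False (gam c)
     + c$2$2 * (r False True False (gam c) + c$1$1 * r True True False (gam c))
     + c$3$3 * (r False False True (gam c) + c$1$1 * r True False True (gam c)
       + c$2$2 * (r False True True (gam c) + c$1$1 * r True True True (gam c)))"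

definition tri_rep :: "('a::comm_ring_1 pt \<Rightarrow> 'a) \<Rightarrow> bool" where
  "tri_rep f \<longleftrightarrow> (\<exists>N r. (\<forall>a b e. pol (r a b e)) \<and> (\<forall>c. tri c \<longrightarrow> cden c ^ N * f c = tri_comb r c))"

lemma tri_gram:
  assumes "tri c"
  shows "gp 1 1 c = c$1$1 * c$1$1" "gp 1 2 c = c$1$1 * c$2$1" "gp 1 3 c = c$1$1 * c$3$1"
    "gp 2 2 c = c$2$1 * c$2$1 + c$2$2 * c$2$2" "gp 2 3 c = c$2$1 * c$3$1 + c$2$2 * c$3$2"
    "gp 3 3 c = c$3$1 * c$3$1 + c$3$2 * c$3$2 + c$3$3 * c$3$3"
    "minor12 c = c$1$1 * c$1$1 * c$2$2 * c$2$2" "det c = c$1$1 * c$2$2 * c$3$3"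
    "cden c = c$1$1 * c$1$1 * c$1$1 * c$1$1 * c$2$2 * c$2$2"
  using assms by (simp_all add: tri_def gp_def minor12_def cden_def det_3 algebra_simps)

definition minor12_pol :: "(gi \<Rightarrow> 'a::comm_ring_1) \<Rightarrow> 'a" where
  "minor12_pol x = x G11 * x G22 - x G12 * x G12"

definition cden_pol :: "(gi \<Rightarrow> 'a::comm_ring_1) \<Rightarrow> 'a" where
  "cden_pol x = x G11 * minor12_pol x"

lemma pol_minor12: "pol minor12_pol"
proof -
  have "pol (\<lambda>x :: gi \<Rightarrow> 'a. minor12_pol x)"
    unfolding minor12_pol_def by (intro pol_mult pol_diff pol_var)
  then show "pol (minor12_pol :: (gi \<Rightarrow> 'a) \<Rightarrow> _)" by simp
qed

lemma pol_cden: "pol cden_pol"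
proof -
  have "pol (\<lambda>x :: gi \<Rightarrow> 'a. cden_pol x)"
    unfolding cden_pol_def by (intro pol_mult pol_minor12 pol_var)
  then show "pol (cden_pol :: (gi \<Rightarrow> 'a) \<Rightarrow> _)" by simp
qed

lemma minor12_gam: "minor12_pol (gam c) = minor12 c" and cden_gam: "cden_pol (gam c) = cden c"
  by (simp_all add: minor12_pol_def cden_pol_def minor12_def cden_def)

lemma tri_repI:
  "(\<And>c. tri c \<Longrightarrow> cden c ^ N * f c = tri_comb r c) \<Longrightarrow> (\<And>a b e. pol (r a b e)) \<Longrightarrow> tri_rep f"
  unfolding tri_rep_def by blast

lemma tri_rep_cong: "tri_rep f \<Longrightarrow> (\<And>c. tri c \<Longrightarrow> f c = g c) \<Longrightarrow> tri_rep g"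
  unfolding tri_rep_def by metis

lemma tri_rep_const: "tri_rep (\<lambda>c. a)"
  unfolding tri_rep_def
  by (intro exI[of _ 0] exI[of _ "\<lambda>i j k x. if i \<or> j \<or> k then 0 else a"] conjI allI impI)
    (simp_all add: tri_comb_def)

lemma tri_rep_mult_pol:
  assumes "tri_rep f" "pol p"
  shows "tri_rep (\<lambda>c. p (gam c) * f c)"
proof -
  obtain N r where r: "\<And>a b e. pol (r a b e)" "\<And>c. tri c \<Longrightarrow> cden c ^ N * f c = tri_comb r c"
    using assms(1) unfolding tri_rep_def by blast
  have "cden c ^ N * (p (gam c) * f c) = tri_comb (\<lambda>a b e x. p x * r a b e x) c" if "tri c" for c
  proof -
    have "cden c ^ N * (p (gam c) * f c) = p (gam c) * tri_comb r c" by (subst r(2)[OF that, symmetric]) (simp add: mult_ac)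
    then show ?thesis by (simp add: tri_comb_def algebra_simps)
  qed
  moreover have "pol (\<lambda>x. p x * r a b e x)" for a b e by (intro pol_mult assms(2) r(1))
  ultimately show ?thesis by (rule tri_repI)
qed

lemma tri_rep_add:
  assumes "tri_rep f" "tri_rep g"
  shows "tri_rep (\<lambda>c. f c + g c)"
proof -
  obtain N r where r: "\<And>a b e. pol (r a b e)" "\<And>c. tri c \<Longrightarrow> cden c ^ N * f c = tri_comb r c"
    using assms(1) unfolding tri_rep_def by blast
  obtain M s where s: "\<And>a b e. pol (s a b e)" "\<And>c. tri c \<Longrightarrow> cden c ^ M * g c = tri_comb s c"
    using assms(2) unfolding tri_rep_def by blast
  let ?t = "\<lambda>a b e x. cden_pol x ^ M * r a b e x + cden_pol x ^ N * s a b e x"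
  have "cden c ^ (N + M) * (f c + g c) = tri_comb ?t c" if "tri c" for c
  proof -
    have "cden c ^ (N + M) * (f c + g c) = cden c ^ M * tri_comb r c + cden c ^ N * tri_comb s c"
      by (subst r(2)[OF that, symmetric], subst s(2)[OF that, symmetric]) (simp add: power_add distrib_left mult_ac)
    then show ?thesis by (simp add: tri_comb_def cden_gam algebra_simps)
  qed
  moreover have "pol (?t a b e)" for a b e
    by (intro pol_add pol_mult pol_power pol_cden r s)
  ultimately show ?thesis by (rule tri_repI)
qed

lemma tri_rep_cancel:
  assumes "tri_rep (\<lambda>c. cden c * f c)"
  shows "tri_rep f"
proof -
  obtain N r where r: "\<And>a b e. pol (r a b e)" "\<And>c. tri c \<Longrightarrow> cden c ^ N * (cden c * f c) = tri_comb r c"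
    using assms(1) unfolding tri_rep_def by blast
  then have "cden c ^ Suc N * f c = tri_comb r c" if "tri c" for c
    using r(2)[OF that] by (simp add: mult_ac)
  from this r(1) show ?thesis by (rule tri_repI)
qed

lemma tri_rep_x:
  assumes "tri_rep f"
  shows "tri_rep (\<lambda>c. c$1$1 * f c)"
proof -
  obtain N r where r: "\<And>a b e. pol (r a b e)" "\<And>c. tri c \<Longrightarrow> cden c ^ N * f c = tri_comb r c"
    using assms(1) unfolding tri_rep_def by blast
  let ?t = "\<lambda>a b e x. if a then r False b e x else x G11 * r True b e x"
  have "cden c ^ N * (c$1$1 * f c) = tri_comb ?t c" if "tri c" for c
  proof -
    have "cden c ^ N * (c$1$1 * f c) = c$1$1 * tri_comb r c" by (subst r(2)[OF that, symmetric]) (simp add: mult_ac)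
    then show ?thesis by (simp add: tri_comb_def tri_gram(1)[OF that] algebra_simps)
  qed
  moreover have "pol (?t a b e)" for a b e using r(1) by (cases a) auto
  ultimately show ?thesis by (rule tri_repI)
qed

text \<open>The square of the second diagonal entry times \<open>cden\<close> is
  \<open>minor12\<^sup>2\<close>, so each multiplication costs one power of
  \<open>cden\<close>.\<close>

lemma tri_rep_y:
  fixes f :: "'a::comm_ring_1 pt \<Rightarrow> 'a"
  assumes "tri_rep f"
  shows "tri_rep (\<lambda>c. c$2$2 * f c)"
proof -
  obtain N r where r: "\<And>a b e. pol (r a b e)" "\<And>c. tri c \<Longrightarrow> cden c ^ N * f c = tri_comb r c"
    using assms(1) unfolding tri_rep_def by blast
  let ?t = "\<lambda>a b e x. if b then cden_pol x * r a False e x else minor12_pol x * minor12_pol x * r a True e x"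
  have "cden c ^ Suc N * (c$2$2 * f c) = tri_comb ?t c" if "tri c" for c
  proof -
    have "cden c ^ Suc N * (c$2$2 * f c) = cden c * c$2$2 * tri_comb r c" by (subst r(2)[OF that, symmetric]) (simp add: mult_ac)
    moreover have "cden c * c$2$2 * c$2$2 = minor12 c * minor12 c" by (simp add: tri_gram[OF that] mult_ac)
    moreover have "k * y * (A + y * B + z * (C + y * D)) = k * y * A + (k * y * y) * B + z * (k * y * C + (k * y * y) * D)"
      for k y z A B C D :: 'a by (simp add: algebra_simps)
    ultimately have "cden c ^ Suc N * (c$2$2 * f c) = cden c * c$2$2 * (r False False False (gam c) + c$1$1 * r True False False (gam c))
      + minor12 c * minor12 c * (r False True False (gam c) + c$1$1 * r True True False (gam c))
      + c$3$3 * (cden c * c$2$2 * (r False False True (gam c) + c$1$1 * r True False True (gam c))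
      + minor12 c * minor12 c * (r False True True (gam c) + c$1$1 * r True True True (gam c)))"
      unfolding tri_comb_def by simp
    then show ?thesis
      by (simp add: tri_comb_def minor12_gam cden_gam algebra_simps)
  qed
  moreover have "pol (?t a b e)" for a b e using r(1) pol_cden pol_minor12 by (cases b) auto
  ultimately show ?thesis by (rule tri_repI)
qed

definition det_pol :: "(gi \<Rightarrow> 'a::comm_ring_1) \<Rightarrow> 'a" where
  "det_pol x = x G11 * (x G22 * x G33) + 2 * (x G12 * (x G13 * x G23)) - x G11 * (x G23 * x G23)
     - x G22 * (x G13 * x G13) - x G33 * (x G12 * x G12)"

lemma pol_det: "pol det_pol"
proof -
  have "pol (\<lambda>x :: gi \<Rightarrow> 'a. det_pol x)"
    unfolding det_pol_def by (intro pol_mult pol_diff pol_add pol_var pol_const)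
  then show "pol (det_pol :: (gi \<Rightarrow> 'a) \<Rightarrow> _)" by simp
qed

lemma det_gam: "det_pol (gam c) = det c * det c"
proof -
  have "det_pol (gam c) = det (c ** transpose c)"
    unfolding det_3 gp_eq[symmetric] by (simp add: det_pol_def gp_commute[of 2 1] gp_commute[of 3 1] gp_commute[of 3 2] algebra_simps)
  then show ?thesis by (simp add: det_mul det_transpose)
qed

text \<open>The square of the third diagonal entry is \<open>det G\<close> divided by the minor;
  multiplied by \<open>cden\<close> it becomes \<open>G11 * det G\<close>.\<close>

lemma tri_rep_z:
  fixes f :: "'a::comm_ring_1 pt \<Rightarrow> 'a"
  assumes "tri_rep f"
  shows "tri_rep (\<lambda>c. c$3$3 * f c)"
proof -
  obtain N r where r: "\<And>a b e. pol (r a b e)" "\<And>c. tri c \<Longrightarrow> cden c ^ N * f c = tri_comb r c"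
    using assms(1) unfolding tri_rep_def by blast
  let ?t = "\<lambda>a b e x. if e then cden_pol x * r a b False x else x G11 * det_pol x * r a b True x"
  have "cden c ^ Suc N * (c$3$3 * f c) = tri_comb ?t c" if "tri c" for c
  proof -
    have "cden c ^ Suc N * (c$3$3 * f c) = cden c * c$3$3 * tri_comb r c" by (subst r(2)[OF that, symmetric]) (simp add: mult_ac)
    moreover have "cden c * c$3$3 * c$3$3 = gp 1 1 c * det_pol (gam c)"
      unfolding det_gam by (simp add: tri_gram[OF that] mult_ac)
    moreover have "k * z * (A + z * B) = k * z * A + (k * z * z) * B" for k z A B :: 'a
      by (simp add: algebra_simps)
    ultimately have "cden c ^ Suc N * (c$3$3 * f c) = cden c * c$3$3 *
        (r False False False (gam c) + c$1$1 * r True False False (gam c)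
         + c$2$2 * (r False True False (gam c) + c$1$1 * r True True False (gam c)))
      + gp 1 1 c * det_pol (gam c) * (r False False True (gam c) + c$1$1 * r True False True (gam c)
         + c$2$2 * (r False True True (gam c) + c$1$1 * r True True True (gam c)))"
      unfolding tri_comb_def by simp
    then show ?thesis
      by (simp add: tri_comb_def cden_gam algebra_simps)
  qed
  moreover have "pol (?t a b e)" for a b e using r(1) pol_cden pol_det by (cases e) auto
  ultimately show ?thesis by (rule tri_repI)
qed

text \<open>Gram-Schmidt solved for the coordinates: the first column is
  \<open>G\<^sub>1\<^sub>k\<close> divided by the first diagonal entry, and the entry (3,2) comes
  from \<open>G11 G23 - G12 G13\<close>, in which the first column cancels. Multiplication by
  \<open>cden\<close> clears these denominators.\<close>

lemma tri_rep_coord: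
  fixes f :: "'a::comm_ring_1 pt \<Rightarrow> 'a"
  assumes f: "tri_rep f"
  shows "tri_rep (\<lambda>c. c $ k $ m * f c)"
proof -
  have z: "tri_rep (\<lambda>c. c $ k $ m * f c)" if "\<And>c :: 'a pt. tri c \<Longrightarrow> c $ k $ m = 0"
    by (rule tri_rep_cong[OF tri_rep_const[of 0]]) (simp add: that)
  have 1: "tri_rep (\<lambda>c. c $ k $ 1 * f c)" if ki: "\<And>c :: 'a pt. gam c i = gp 1 k c" for k i
  proof (rule tri_rep_cancel, rule tri_rep_cong)
    show "tri_rep (\<lambda>c. (\<lambda>x. minor12_pol x * x i) (gam c) * (c$1$1 * f c))"
      by (intro tri_rep_mult_pol tri_rep_x f pol_mult pol_minor12 pol_var)
    fix c :: "'a pt" assume t: "tri c"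
    have "gp 1 k c = c$1$1 * c$k$1" using t by (simp add: gp_def tri_def)
    then show "(\<lambda>x. minor12_pol x * x i) (gam c) * (c$1$1 * f c) = cden c * (c $ k $ 1 * f c)"
      unfolding minor12_gam ki cden_def by (simp add: tri_gram(1)[OF t] mult_ac)
  qed
  have 2: "tri_rep (\<lambda>c. c$3$2 * f c)"
  proof (rule tri_rep_cancel, rule tri_rep_cong)
    show "tri_rep (\<lambda>c. (\<lambda>x. x G11 * (x G11 * x G23 - x G12 * x G13)) (gam c) * (c$2$2 * f c))"
      by (intro tri_rep_mult_pol tri_rep_y f pol_mult pol_diff pol_var)
    show "(\<lambda>x. x G11 * (x G11 * x G23 - x G12 * x G13)) (gam c) * (c$2$2 * f c) = cden c * (c$3$2 * f c)"
      if "tri c" for c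
      by (simp add: tri_gram[OF that] algebra_simps)
  qed
  consider "k = 1 \<and> m = 1" | "k = 2 \<and> m = 1" | "k = 3 \<and> m = 1" | "k = 2 \<and> m = 2" | "k = 3 \<and> m = 2" | "k = 3 \<and> m = 3"
    | "\<And>c :: 'a pt. tri c \<Longrightarrow> c $ k $ m = 0"
    using exhaust_3[of k] exhaust_3[of m] by (auto simp: tri_def)
  then show ?thesis
  proof cases
    case 5 then show ?thesis using 2 by simp
  next
    case 2 then show ?thesis using 1[of G12 2] by simp
  next
    case 3 then show ?thesis using 1[of G13 3] by simp
  qed (use tri_rep_x[OF f] tri_rep_y[OF f] tri_rep_z[OF f] z in simp_all)
qed

lemma tri_rep_is_poly:
  fixes f :: "'a::comm_ring_1 pt \<Rightarrow> 'a"
  assumes "is_poly f"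
  shows "tri_rep f"
proof -
  have "tri_rep (\<lambda>c. F (\<lambda>(k, m). c $ k $ m))" if "pol F" for F :: "(3 \<times> 3 \<Rightarrow> 'a) \<Rightarrow> 'a"
    using that
  proof (induction rule: pol_induct)
    case (var F i)
    show ?case using tri_rep_coord[OF var.IH, of "fst i" "snd i"] by (cases i) simp
  qed (auto intro: tri_rep_const tri_rep_add)
  from this[OF is_poly_pol[OF assms]] have "tri_rep (\<lambda>c. f (\<chi> k m. c $ k $ m))" by simp
  moreover have "(\<chi> k m. c $ k $ m) = c" for c :: "'a pt" by (simp add: vec_eq_iff)
  ultimately show ?thesis by simp
qed

section \<open>Parity of invariants and sign changes of the coordinates\<close>

definition flip :: "3 \<Rightarrow> 'a::comm_ring_1 pt \<Rightarrow> 'a pt" where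
  "flip k c = (\<chi> i m. if m = k then - c$i$m else c$i$m)"

lemma flip_nth: "flip k c $ i $ m = (if m = k then - c$i$m else c$i$m)"
  by (simp add: flip_def)

lemma tri_flip: "tri c \<Longrightarrow> tri (flip k c)"
  by (simp add: tri_def flip_nth)

lemma gp_flip: "gp i j (flip k c) = gp i j c"
  using exhaust_3[of k] by (auto simp: gp_def flip_nth)

lemma gam_flip: "gam (flip k c) = gam c"
  by (rule ext, rename_tac i, case_tac i) (simp_all add: gp_flip)

lemma cden_flip: "cden (flip k c) = cden c"
  by (simp add: cden_def minor12_def gp_flip)

lemma is_even_part: "a = p + q \<Longrightarrow> a = p - q \<Longrightarrow> a = p" for a :: "'a::field_char_0"
proof -
  assume a: "a = p + q" "a = p - q"
  then have "2 * (a - p) = 0" by simp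
  then have "a - p = 0" by (metis mult_eq_0_iff zero_neq_numeral)
  then show ?thesis by simp
qed

lemma is_odd_part: "a = p + q \<Longrightarrow> - a = p - q \<Longrightarrow> a = q" for a :: "'a::field_char_0"
proof (rule is_even_part)
  assume a: "a = p + q" "- a = p - q"
  show "a = q + p" using a(1) by simp
  have "a = - (p - q)" using a(2) by (metis minus_minus)
  then show "a = q - p" by simp
qed

text \<open>A sign change of the \<open>k\<close>-th column fixes all Gram entries and negates the
  \<open>k\<close>-th diagonal entry only. Comparing both values removes the monomials containing
  that entry, and after three comparisons only the monomial 1 is left.\<close>

lemma tri_even:
  fixes f :: "'a::field_char_0 pt \<Rightarrow> 'a"
  assumes "is_poly f" and flip: "\<And>k c. f (flip k c) = f c"
  obtains N p where "pol p" "\<And>c. tri c \<Longrightarrow> cden c ^ N * f c = p (gam c)"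
proof -
  obtain N r where r: "\<And>a b e. pol (r a b e)" "\<And>c. tri c \<Longrightarrow> cden c ^ N * f c = tri_comb r c"
    using tri_rep_is_poly[OF assms(1)] unfolding tri_rep_def by blast
  define L where "L c = cden c ^ N * f c" for c
  have Lf: "L (flip k c) = L c" for k c by (simp add: L_def flip cden_flip)
  have 1: "L c = r False False False (gam c) + c$2$2 * r False True False (gam c)
      + c$3$3 * (r False False True (gam c) + c$2$2 * r False True True (gam c))" (is "_ = ?X c") if "tri c" for c
  proof (rule is_even_part)
    let ?q = "c$1$1 * (r True False False (gam c) + c$2$2 * r True True False (gam c)
      + c$3$3 * (r True False True (gam c) + c$2$2 * r True True True (gam c)))"
    show "L c = ?X c + ?q" using r(2)[OF that] by (simp add: L_def tri_comb_def algebra_simps)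
    have "L c = tri_comb r (flip 1 c)" using r(2)[OF tri_flip[OF that], of 1] Lf[of 1 c] by (simp add: L_def)
    then show "L c = ?X c - ?q" by (simp add: tri_comb_def gam_flip flip_nth algebra_simps)
  qed
  have 2: "L c = r False False False (gam c) + c$3$3 * r False False True (gam c)" (is "_ = ?X c") if "tri c" for c
  proof (rule is_even_part)
    let ?q = "c$2$2 * (r False True False (gam c) + c$3$3 * r False True True (gam c))"
    show "L c = ?X c + ?q" unfolding 1[OF that] by (simp add: algebra_simps)
    show "L c = ?X c - ?q" unfolding Lf[of 2 c, symmetric] 1[OF tri_flip[OF that], of 2]
      by (simp add: gam_flip flip_nth algebra_simps)
  qed
  have "L c = r False False False (gam c)" if "tri c" for c
  proof (rule is_even_part)
    let ?q = "c$3$3 * r False False True (gam c)"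
    show "L c = r False False False (gam c) + ?q" unfolding 2[OF that] by simp
    show "L c = r False False False (gam c) - ?q" unfolding Lf[of 3 c, symmetric] 2[OF tri_flip[OF that], of 3]
      by (simp add: gam_flip flip_nth)
  qed
  then show ?thesis using that[OF r(1)[of False False False], of N] unfolding L_def by blast
qed

text \<open>The same comparison now keeps only monomials containing the \<open>k\<close>-th diagonal
  entry; what survives is the product of all three, which is \<open>det C\<close>.\<close>

lemma tri_odd:
  fixes f :: "'a::field_char_0 pt \<Rightarrow> 'a"
  assumes "is_poly f" and flip: "\<And>k c. f (flip k c) = - f c"
  obtains N p where "pol p" "\<And>c. tri c \<Longrightarrow> cden c ^ N * f c = det c * p (gam c)"
proof -
  obtain N r where r: "\<And>a b e. pol (r a b e)" "\<And>c. tri c \<Longrightarrow> cden c ^ N * f c = tri_comb r c"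
    using tri_rep_is_poly[OF assms(1)] unfolding tri_rep_def by blast
  define L where "L c = cden c ^ N * f c" for c
  have Lf: "L (flip k c) = - L c" for k c by (simp add: L_def flip cden_flip)
  have 1: "L c = c$1$1 * (r True False False (gam c) + c$2$2 * r True True False (gam c)
      + c$3$3 * (r True False True (gam c) + c$2$2 * r True True True (gam c)))" (is "_ = ?q c") if "tri c" for c
  proof (rule is_odd_part)
    let ?X = "r False False False (gam c) + c$2$2 * r False True False (gam c)
      + c$3$3 * (r False False True (gam c) + c$2$2 * r False True True (gam c))"
    show "L c = ?X + ?q c" using r(2)[OF that] by (simp add: L_def tri_comb_def algebra_simps)
    have "- L c = tri_comb r (flip 1 c)" using r(2)[OF tri_flip[OF that], of 1] Lf[of 1 c] by (simp add: L_def)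
    then show "- L c = ?X - ?q c" by (simp add: tri_comb_def gam_flip flip_nth algebra_simps)
  qed
  have 2: "L c = c$1$1 * (c$2$2 * (r True True False (gam c) + c$3$3 * r True True True (gam c)))" (is "_ = ?q c") if "tri c" for c
  proof (rule is_odd_part)
    let ?X = "c$1$1 * (r True False False (gam c) + c$3$3 * r True False True (gam c))"
    show "L c = ?X + ?q c" unfolding 1[OF that] by (simp add: algebra_simps)
    show "- L c = ?X - ?q c" unfolding Lf[of 2 c, symmetric] 1[OF tri_flip[OF that], of 2]
      by (simp add: gam_flip flip_nth algebra_simps)
  qed
  have "L c = c$1$1 * (c$2$2 * (c$3$3 * r True True True (gam c)))" (is "_ = ?q c") if "tri c" for c
  proof (rule is_odd_part)
    let ?X = "c$1$1 * (c$2$2 * r True True False (gam c))"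
    show "L c = ?X + ?q c" unfolding 2[OF that] by (simp add: algebra_simps)
    show "- L c = ?X - ?q c" unfolding Lf[of 3 c, symmetric] 2[OF tri_flip[OF that], of 3]
      by (simp add: gam_flip flip_nth algebra_simps)
  qed
  then have "cden c ^ N * f c = det c * r True True True (gam c)" if "tri c" for c
    using that by (simp add: L_def tri_gram(8)[OF that] mult.assoc)
  then show ?thesis by (rule that[OF r(1)])
qed

section \<open>Invariants up to denominators\<close>

lemma is_poly_cden: "is_poly cden"
  using is_poly_gam[OF pol_cden] by (simp add: cden_gam)

lemma cden_rot: "h \<in> SO3 \<Longrightarrow> cden (rot h c) = cden c"
  unfolding cden_gam[symmetric] by (simp add: gam_rot)

text \<open>The reflection negating the \<open>k\<close>-th coordinate is \<open>-1\<close> followed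
  by the half turn about the \<open>k\<close>-th axis, and the half turn is a rotation.\<close>

lemma Inv3_flip:
  fixes f :: "'a::field_char_0 pt \<Rightarrow> 'a"
  assumes "f \<in> Inv3"
  shows "f (flip k c) = f (- c)"
proof -
  define h :: "'a^3^3" where "h = (\<chi> i j. if i = j then (if i = k then 1 else -1) else 0)"
  have "h \<in> SO3"
    using exhaust_3[of k] unfolding SO3_def h_def
    by (auto simp: vec_eq_iff forall_3 matrix_matrix_mult_def sum_3 transpose_def mat_def det_3)
  moreover have "rot h (- c) = flip k c"
    using exhaust_3[of k] by (auto simp: vec_eq_iff rot_nth h_def flip_nth forall_3)
  ultimately show ?thesis using Inv3_rot[OF assms, of h "- c"] by simp
qed

lemma even_invariant_frac:
  fixes f :: "'a::field_char_0 pt \<Rightarrow> 'a"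
  assumes f: "f \<in> Inv3" and even: "\<And>c. f (- c) = f c"
  obtains N p where "pol p" "\<And>c. cden c ^ N * f c = p (gam c)"
proof -
  have pf: "is_poly f" using f by (simp add: Inv3_def)
  have fl: "f (flip k c) = f c" for k c using Inv3_flip[OF f] even by simp
  obtain N p where p: "pol p" "\<And>c. tri c \<Longrightarrow> cden c ^ N * f c = p (gam c)"
  proof (rule tri_even[OF pf fl])
    fix p N assume "pol p" "\<And>c. tri c \<Longrightarrow> cden c ^ N * f c = p (gam c)"
    then show thesis by (rule that)
  qed
  have "is_poly (\<lambda>c. cden c ^ N * f c - p (gam c))"
    by (rule is_poly_diff[OF is_poly.mult[OF is_poly_power[OF is_poly_cden] pf] is_poly_gam[OF p(1)]])
  then have "cden c ^ N * f c - p (gam c) = 0" for c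
    by (rule vanish_if_vanish_on_tri) (simp_all add: p(2) Inv3_rot[OF f] cden_rot gam_rot)
  then have "cden c ^ N * f c = p (gam c)" for c by simp
  then show ?thesis by (rule that[OF p(1)])
qed

lemma odd_invariant_frac:
  fixes f :: "'a::field_char_0 pt \<Rightarrow> 'a"
  assumes f: "f \<in> Inv3" and odd: "\<And>c. f (- c) = - f c"
  obtains N p where "pol p" "\<And>c. cden c ^ N * f c = det c * p (gam c)"
proof -
  have pf: "is_poly f" using f by (simp add: Inv3_def)
  have fl: "f (flip k c) = - f c" for k c using Inv3_flip[OF f] odd by simp
  obtain N p where p: "pol p" "\<And>c. tri c \<Longrightarrow> cden c ^ N * f c = det c * p (gam c)"
  proof (rule tri_odd[OF pf fl])
    fix p N assume "pol p" "\<And>c. tri c \<Longrightarrow> cden c ^ N * f c = det c * p (gam c)"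
    then show thesis by (rule that)
  qed
  have "is_poly (\<lambda>c. cden c ^ N * f c - det c * p (gam c))"
    by (rule is_poly_diff[OF is_poly.mult[OF is_poly_power[OF is_poly_cden] pf]
          is_poly.mult[OF is_poly_det is_poly_gam[OF p(1)]]])
  then have "cden c ^ N * f c - det c * p (gam c) = 0" for c
    by (rule vanish_if_vanish_on_tri) (simp_all add: p(2) Inv3_rot[OF f] cden_rot gam_rot det_rot)
  then have "cden c ^ N * f c = det c * p (gam c)" for c by simp
  then show ?thesis by (rule that[OF p(1)])
qed

section \<open>Coprimality of the denominators\<close>

text \<open>Coprimality expressed by divisibility alone, as in a factorial ring: if \<open>h\<close>
  divides \<open>s * q\<close>, then it divides \<open>q\<close>.\<close>

definition cop :: "(('i \<Rightarrow> 'a::field_char_0) \<Rightarrow> 'a) \<Rightarrow> (('i \<Rightarrow> 'a) \<Rightarrow> 'a) \<Rightarrow> bool" where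
  "cop h s \<longleftrightarrow> (\<forall>p q. pol p \<longrightarrow> pol q \<longrightarrow> (\<forall>x. h x * p x = s x * q x) \<longrightarrow> (\<exists>k. pol k \<and> (\<forall>x. q x = h x * k x)))"

lemma copD:
  assumes "cop h s" "pol p" "pol q" "\<And>x. h x * p x = s x * q x"
  shows "\<exists>k. pol k \<and> (\<forall>x. q x = h x * k x)"
  using assms unfolding cop_def by simp

lemma cop_mult_right:
  assumes "cop h s" "cop h s'" "pol s'"
  shows "cop h (\<lambda>x. s x * s' x)"
  unfolding cop_def
proof (intro allI impI)
  fix p q assume pq: "pol p" "pol q" and eq: "\<forall>x. h x * p x = s x * s' x * q x"
  have e: "h x * p x = s x * (s' x * q x)" for x using eq by (simp add: mult.assoc)
  from copD[OF assms(1) pq(1) pol_mult[OF assms(3) pq(2)] e]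
  obtain k where "pol k \<and> (\<forall>x. s' x * q x = h x * k x)" by (rule exE)
  then have k: "pol k" "\<And>x. s' x * q x = h x * k x" by blast+
  then have "h x * k x = s' x * q x" for x by simp
  from copD[OF assms(2) k(1) pq(2) this] show "\<exists>k. pol k \<and> (\<forall>x. q x = h x * k x)" .
qed

lemma cop_mult_left:
  assumes "cop h s" "cop h' s" "pol h" "pol h'" "pol s" and "h z \<noteq> 0"
  shows "cop (\<lambda>x. h x * h' x) s"
  unfolding cop_def
proof (intro allI impI)
  fix p q assume pq: "pol p" "pol q" and eq: "\<forall>x. h x * h' x * p x = s x * q x"
  have e: "h x * (h' x * p x) = s x * q x" for x using eq by (simp add: mult.assoc)
  from copD[OF assms(1) pol_mult[OF assms(4) pq(1)] pq(2) e]
  obtain k where "pol k \<and> (\<forall>x. q x = h x * k x)" by (rule exE)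
  then have k: "pol k" "\<And>x. q x = h x * k x" by blast+
  have "h x * (h' x * p x - s x * k x) = 0" for x
    using eq[rule_format, of x] unfolding k(2) by (simp add: algebra_simps)
  then have "h' x * p x - s x * k x = 0" for x
    by (rule pol_domain[OF assms(3) _ _ assms(6), rotated]) (intro pol_diff pol_mult assms pq k)
  then have "h' x * p x = s x * k x" for x by simp
  from copD[OF assms(2) pq(1) k(1) this]
  obtain l where "pol l \<and> (\<forall>x. k x = h' x * l x)" by (rule exE)
  then have l: "pol l" "\<And>x. k x = h' x * l x" by blast+
  have "q x = h x * h' x * l x" for x unfolding k(2) l(2) by (simp only: mult.assoc)
  then show "\<exists>k. pol k \<and> (\<forall>x. q x = h x * h' x * k x)" using l(1) by blast
qed

lemma cop_1: "cop h (\<lambda>x. 1)" and cop_1': "cop (\<lambda>x. 1) h"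
  unfolding cop_def by auto

lemma cop_power_right: "cop h s \<Longrightarrow> pol s \<Longrightarrow> cop h (\<lambda>x. s x ^ n)"
  by (induction n) (simp_all add: cop_1 cop_mult_right pol_power)

lemma cop_power_left: "cop h s \<Longrightarrow> pol h \<Longrightarrow> pol s \<Longrightarrow> h z \<noteq> 0 \<Longrightarrow> cop (\<lambda>x. h x ^ n) s"
  by (induction n) (simp_all add: cop_1' cop_mult_left pol_power)

text \<open>Restricting to \<open>x i = 0\<close> leaves \<open>s\<close> unchanged, hence nonzero,
  so the restriction of \<open>q\<close> vanishes and \<open>x i\<close> divides
  \<open>q\<close>.\<close>

lemma zero_if_mult_zero:
  fixes s q :: "('i \<Rightarrow> 'a::field_char_0) \<Rightarrow> 'a"
  assumes s: "pol s" "s z \<noteq> 0" "\<And>x. s (x(i := 0)) = s x" and q: "pol q"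
    and 0: "\<And>x. x i = 0 \<Longrightarrow> s x * q x = 0"
  obtains k where "pol k" "\<And>x. q x = x i * k x"
proof -
  obtain n where n: "pd n q" using q unfolding pol_def by blast
  have "pol (\<lambda>x. q (x(i := 0)))" using pd_split[OF n, of i] unfolding pol_def by blast
  moreover have "s x * q (x(i := 0)) = 0" for x using 0[of "x(i := 0)"] s(3)[of x] by simp
  ultimately have q0: "q (x(i := 0)) = 0" for x
    using pol_domain[OF s(1) _ _ s(2), of "\<lambda>x. q (x(i := 0))"] by blast
  have "q x = 0" if "x i = 0" for x
    using q0[of x] fun_upd_triv[of x i] that by simp
  then obtain k where "pd (n - 1) k" "\<And>x. q x = x i * k x" using pd_div[OF n] by blast
  then show ?thesis using that unfolding pol_def by blast
qed

lemma cop_var: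
  fixes s :: "('i \<Rightarrow> 'a::field_char_0) \<Rightarrow> 'a"
  assumes s: "pol s" "s z \<noteq> 0" "\<And>x. s (x(i := 0)) = s x"
  shows "cop (\<lambda>x. x i) s" "cop s (\<lambda>x. x i)"
  unfolding cop_def
proof (safe)
  fix p q :: "('i \<Rightarrow> 'a) \<Rightarrow> 'a" assume pq: "pol p" "pol q" and eq: "\<forall>x. x i * p x = s x * q x"
  show "\<exists>k. pol k \<and> (\<forall>x. q x = x i * k x)"
  proof (rule zero_if_mult_zero[OF s pq(2)])
    show "s x * q x = 0" if "x i = 0" for x using eq[rule_format, of x] that by simp
  qed blast
next
  fix p q :: "('i \<Rightarrow> 'a) \<Rightarrow> 'a" assume pq: "pol p" "pol q" and eq: "\<forall>x. s x * p x = x i * q x"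
  have "s x * p x = 0" if "x i = 0" for x using eq[rule_format, of x] that by simp
  then obtain k where k: "pol k" "\<And>x. p x = x i * k x"
    using zero_if_mult_zero[OF s pq(1)] by blast
  have "x i * q x = x i * (s x * k x)" for x
    using eq[rule_format, of x] unfolding k(2) by (metis mult.left_commute)
  then have "x i * (q x - s x * k x) = 0" for x by (simp add: right_diff_distrib)
  then have "q x - s x * k x = 0" for x
    by (rule pol_cancel_var[rotated]) (intro pol_diff pol_mult pq s k)
  then have "q x = s x * k x" for x by simp
  then show "\<exists>k. pol k \<and> (\<forall>x. q x = s x * k x)" using k(1) by blast
qed

text \<open>The permutation of the Gram entries caused by exchanging the first and the third
  vector.\<close>

definition sigma :: "gi \<Rightarrow> gi" where
  "sigma i = (case i of G11 \<Rightarrow> G33 | G12 \<Rightarrow> G23 | G13 \<Rightarrow> G13 | G22 \<Rightarrow> G22 | G23 \<Rightarrow> G12 | G33 \<Rightarrow> G11)"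

definition minor23_pol :: "(gi \<Rightarrow> 'a::comm_ring_1) \<Rightarrow> 'a" where
  "minor23_pol x = x G22 * x G33 - x G23 * x G23"

lemma pol_minor23: "pol minor23_pol"
proof -
  have "pol (\<lambda>x :: gi \<Rightarrow> 'a. minor23_pol x)"
    unfolding minor23_pol_def by (intro pol_mult pol_diff pol_var)
  then show "pol (minor23_pol :: (gi \<Rightarrow> 'a) \<Rightarrow> _)" by simp
qed

lemma pol_rename: "pol p \<Longrightarrow> pol (\<lambda>x. p (\<lambda>i. x (\<sigma> i)))"
  by (induction rule: pol_induct) (auto intro: pol_add pol_mult)

lemma pol_cden_sigma: "pol (\<lambda>x. cden_pol (\<lambda>i. x (sigma i)))"
  by (rule pol_rename[OF pol_cden])

text \<open>Checked on the factors: \<open>G11\<close> or the first minor against \<open>G33\<close>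
  or the second minor. In three of the four pairs a variable meets a polynomial that does not
  involve it; the pair of minors is \<open>minors_coprime\<close>.\<close>

lemma cop_dens: "cop (\<lambda>x. cden_pol x ^ N) (\<lambda>x. (cden_pol (\<lambda>i. x (sigma i)) ^ M :: 'a::field_char_0))"
proof -
  let ?z = "\<lambda>i. if i = G12 \<or> i = G23 then 0 else 1 :: 'a"
  have s: "cden_pol (\<lambda>i. x (sigma i)) = x G33 * minor23_pol x" for x :: "gi \<Rightarrow> 'a"
    by (simp add: cden_pol_def minor12_pol_def minor23_pol_def sigma_def mult.commute)
  have nz: "minor12_pol ?z \<noteq> 0" "minor23_pol ?z \<noteq> 0" "cden_pol ?z \<noteq> 0"
    by (simp_all add: cden_pol_def minor12_pol_def minor23_pol_def)
  have a: "cop (\<lambda>x :: gi \<Rightarrow> 'a. x G11) (\<lambda>x. x G33)"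
    by (rule cop_var(1)[of _ ?z]) simp_all
  have b: "cop (\<lambda>x :: gi \<Rightarrow> 'a. x G11) (\<lambda>x. minor23_pol x)"
    by (rule cop_var(1)[of _ ?z]) (simp_all only: pol_minor23 nz not_False_eq_True, simp add: minor23_pol_def)
  have c: "cop (\<lambda>x :: gi \<Rightarrow> 'a. minor12_pol x) (\<lambda>x. x G33)"
    by (rule cop_var(2)[of _ ?z]) (simp_all only: pol_minor12 nz not_False_eq_True, simp add: minor12_pol_def)
  have d: "cop (\<lambda>x :: gi \<Rightarrow> 'a. minor12_pol x) (\<lambda>x. minor23_pol x)"
    unfolding cop_def minor12_pol_def minor23_pol_def
  proof (intro allI impI)
    fix p q :: "(gi \<Rightarrow> 'a) \<Rightarrow> 'a"
    assume "pol p" "pol q"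
      and "\<forall>x. (x G11 * x G22 - x G12 * x G12) * p x = (x G22 * x G33 - x G23 * x G23) * q x"
    from minors_coprime[OF this(1,2) this(3)[THEN spec]]
    show "\<exists>k. pol k \<and> (\<forall>x. q x = (x G11 * x G22 - x G12 * x G12) * k x)" by blast
  qed
  have e: "cop (\<lambda>x :: gi \<Rightarrow> 'a. cden_pol x) (\<lambda>x. x G33 * minor23_pol x)"
    unfolding cden_pol_def
    by (intro cop_mult_left[of _ _ _ ?z] cop_mult_right a b c d pol_mult pol_var pol_minor12 pol_minor23) simp
  have "pol (\<lambda>x :: gi \<Rightarrow> 'a. cden_pol x)" using pol_cden by simp
  then show ?thesis
    unfolding s by (intro cop_power_left[of _ _ ?z] cop_power_right e nz pol_power pol_mult pol_var pol_minor23)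
qed

section \<open>The invariants\<close>

definition sw :: "'a::zero pt \<Rightarrow> 'a pt" where
  "sw c = vector [c $ 3, c $ 2, c $ 1]"

lemma sw_nth [simp]: "sw c $ 1 = c $ 3" "sw c $ 2 = c $ 2" "sw c $ 3 = c $ 1"
  by (simp_all add: sw_def)

lemma sw_sw [simp]: "sw (sw c) = c"
  by (simp add: vec_eq_iff[of _ c] forall_3)

lemma gam_sw: "gam (sw c) = (\<lambda>i. gam c (sigma i))"
  by (rule ext, rename_tac i, case_tac i) (simp_all add: sigma_def gp_def mult.commute)

lemma det_sw: "det (sw c) = - det c"
  by (simp add: det_3 algebra_simps)

lemma is_poly_sw: "is_poly f \<Longrightarrow> is_poly (\<lambda>c. f (sw c))"
proof (induction rule: is_poly.induct)
  case (coord k m)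
  show ?case using exhaust_3[of k] by (elim disjE) (simp_all add: is_poly.coord)
qed (simp_all add: is_poly.add is_poly.mult is_poly.const)

lemma Inv3_sw:
  fixes f :: "'a::field_char_0 pt \<Rightarrow> 'a"
  assumes "f \<in> Inv3"
  shows "(\<lambda>c. f (sw c)) \<in> Inv3"
proof -
  have "sw (rot h c) = rot h (sw c)" for h and c :: "'a pt"
    by (simp add: vec_eq_iff rot_nth forall_3)
  then show ?thesis using assms is_poly_sw by (auto simp: Inv3_iff)
qed

lemma gam_eq_imp_eq:
  fixes p q :: "(gi \<Rightarrow> 'a::field_char_0) \<Rightarrow> 'a"
  assumes "pol p" "pol q" "\<And>c. p (gam c) = q (gam c)"
  shows "p x = q x"
  using gam_algebraically_independent[OF pol_diff[OF assms(1,2)], of x] assms(3) by simp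

lemma cden_one: "cden (mat 1 :: 'a::field_char_0 pt) \<noteq> 0"
  by (simp add: cden_def minor12_def gp_def mat_def)

theorem even_invariant:
  fixes f :: "'a::field_char_0 pt \<Rightarrow> 'a"
  assumes f: "f \<in> Inv3" and even: "\<And>c. f (- c) = f c"
  shows "f \<in> Palg"
proof -
  obtain N p where p: "pol p" "\<And>c. cden c ^ N * f c = p (gam c)"
  proof (rule even_invariant_frac[OF f even])
    fix p N assume "pol p" "\<And>c. cden c ^ N * f c = p (gam c)"
    then show thesis by (rule that)
  qed
  have "sw (- c) = - sw c" for c :: "'a pt" by (simp add: vec_eq_iff forall_3)
  then have swn: "f (sw (- c)) = f (sw c)" for c using even by simp
  obtain M q where q: "pol q" "\<And>c. cden c ^ M * f (sw c) = q (gam c)"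
  proof (rule even_invariant_frac[OF Inv3_sw[OF f] swn])
    fix q M assume "pol q" "\<And>c. cden c ^ M * f (sw c) = q (gam c)"
    then show thesis by (rule that)
  qed
  define q' where "q' x = q (\<lambda>i. x (sigma i))" for x
  have q': "pol q'" unfolding q'_def by (rule pol_rename[OF q(1)])
  have qf: "cden_pol (\<lambda>i. gam c (sigma i)) ^ M * f c = q' (gam c)" for c
    using q(2)[of "sw c"] unfolding q'_def gam_sw[symmetric] cden_gam by simp
  \<comment> \<open>Both products represent \<open>f\<close> times the two denominators on Gram
    matrices; algebraic independence promotes this to an identity in six free variables.\<close>
  have 1: "cden_pol x ^ N * q' x = cden_pol (\<lambda>i. x (sigma i)) ^ M * p x" for x
  proof (rule gam_eq_imp_eq[of "\<lambda>x. cden_pol x ^ N * q' x" "\<lambda>x. cden_pol (\<lambda>i. x (sigma i)) ^ M * p x"])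
    show "cden_pol (gam c) ^ N * q' (gam c) = cden_pol (\<lambda>i. gam c (sigma i)) ^ M * p (gam c)" for c
      unfolding p(2)[symmetric] qf[symmetric] cden_gam[symmetric] by (simp add: mult_ac)
  qed (intro pol_mult pol_power pol_cden pol_cden_sigma p q')+
  from copD[OF cop_dens q' p(1) 1]
  obtain k where "pol k \<and> (\<forall>x. p x = cden_pol x ^ N * k x)" by (rule exE)
  then have k: "pol k" "\<And>x. p x = cden_pol x ^ N * k x" by blast+
  have z: "cden c ^ N * (f c - k (gam c)) = 0" for c
    using p(2)[of c] k(2)[of "gam c"] by (simp add: cden_gam algebra_simps)
  have pp: "is_poly (\<lambda>c :: 'a pt. cden c ^ N)" "is_poly (\<lambda>c. f c - k (gam c))"
    using f by (simp_all add: is_poly_power is_poly_cden is_poly_diff is_poly_gam k(1) Inv3_def)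
  have "f c - k (gam c) = 0" for c
    by (rule is_poly_domain[OF pp z, of "mat 1"]) (simp add: cden_one)
  then have "f = (\<lambda>c. k (gam c))" by (simp add: fun_eq_iff)
  then show ?thesis using k(1) Palg_iff by blast
qed

theorem odd_invariant:
  fixes f :: "'a::field_char_0 pt \<Rightarrow> 'a"
  assumes f: "f \<in> Inv3" and odd: "\<And>c. f (- c) = - f c"
  obtains k where "k \<in> Palg" "\<And>c. f c = det c * k c"
proof -
  obtain N p where p: "pol p" "\<And>c. cden c ^ N * f c = det c * p (gam c)"
  proof (rule odd_invariant_frac[OF f odd])
    fix p N assume "pol p" "\<And>c. cden c ^ N * f c = det c * p (gam c)"
    then show thesis by (rule that)
  qed
  have "sw (- c) = - sw c" for c :: "'a pt" by (simp add: vec_eq_iff forall_3)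
  then have swn: "f (sw (- c)) = - f (sw c)" for c using odd by simp
  obtain M q where q: "pol q" "\<And>c. cden c ^ M * f (sw c) = det c * q (gam c)"
  proof (rule odd_invariant_frac[OF Inv3_sw[OF f] swn])
    fix q M assume "pol q" "\<And>c. cden c ^ M * f (sw c) = det c * q (gam c)"
    then show thesis by (rule that)
  qed
  \<comment> \<open>Exchanging two vectors negates \<open>det C\<close>; the sign is absorbed
    here.\<close>
  define q' where "q' x = - q (\<lambda>i. x (sigma i))" for x
  have q': "pol q'" unfolding q'_def by (rule pol_uminus[OF pol_rename[OF q(1)]])
  have qf: "cden_pol (\<lambda>i. gam c (sigma i)) ^ M * f c = det c * q' (gam c)" for c
    using q(2)[of "sw c"] unfolding q'_def gam_sw[symmetric] cden_gam by (simp add: det_sw)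
  have 1: "cden_pol x ^ N * q' x = cden_pol (\<lambda>i. x (sigma i)) ^ M * p x" for x
  proof (rule gam_eq_imp_eq[of "\<lambda>x. cden_pol x ^ N * q' x" "\<lambda>x. cden_pol (\<lambda>i. x (sigma i)) ^ M * p x"])
    let ?D = "\<lambda>x. cden_pol x ^ N * q' x - cden_pol (\<lambda>i. x (sigma i)) ^ M * p x"
    have "det c * ?D (gam c) = 0" for c
    proof -
      have "det c * ?D (gam c) = cden_pol (gam c) ^ N * (det c * q' (gam c)) - cden_pol (\<lambda>i. gam c (sigma i)) ^ M * (det c * p (gam c))"
        by (simp add: algebra_simps)
      then show ?thesis unfolding p(2)[symmetric] qf[symmetric] cden_gam by (simp add: mult_ac)
    qed
    moreover have "pol ?D" by (intro pol_diff pol_mult pol_power pol_cden pol_cden_sigma p q')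
    ultimately have "?D (gam c) = 0" for c
      using is_poly_domain[OF is_poly_det is_poly_gam[of ?D], of "mat 1" c] by simp
    then show "cden_pol (gam c) ^ N * q' (gam c) = cden_pol (\<lambda>i. gam c (sigma i)) ^ M * p (gam c)" for c
      by simp
  qed (intro pol_mult pol_power pol_cden pol_cden_sigma p q')+
  from copD[OF cop_dens q' p(1) 1]
  obtain k where "pol k \<and> (\<forall>x. p x = cden_pol x ^ N * k x)" by (rule exE)
  then have k: "pol k" "\<And>x. p x = cden_pol x ^ N * k x" by blast+
  have z: "cden c ^ N * (f c - det c * k (gam c)) = 0" for c
    using p(2)[of c] k(2)[of "gam c"] by (simp add: cden_gam algebra_simps)
  have pp: "is_poly (\<lambda>c :: 'a pt. cden c ^ N)" "is_poly (\<lambda>c. f c - det c * k (gam c))"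
    using f by (simp_all add: is_poly_power is_poly_cden is_poly_diff is_poly_gam is_poly_det is_poly.mult k(1) Inv3_def)
  have "f c - det c * k (gam c) = 0" for c
    by (rule is_poly_domain[OF pp z, of "mat 1"]) (simp add: cden_one)
  then have "f c = det c * k (gam c)" for c by simp
  moreover have "(\<lambda>c. k (gam c)) \<in> Palg" using k(1) Palg_iff by blast
  ultimately show ?thesis using that by blast
qed

section \<open>Adjugates and polynomial matrices\<close>

definition adj3 :: "'a::comm_ring_1^3^3 \<Rightarrow> 'a^3^3" where
  "adj3 M = vector [
    vector [M$2$2 * M$3$3 - M$2$3 * M$3$2, M$1$3 * M$3$2 - M$1$2 * M$3$3, M$1$2 * M$2$3 - M$1$3 * M$2$2],
    vector [M$2$3 * M$3$1 - M$2$1 * M$3$3, M$1$1 * M$3$3 - M$1$3 * M$3$1, M$1$3 * M$2$1 - M$1$1 * M$2$3],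
    vector [M$2$1 * M$3$2 - M$2$2 * M$3$1, M$1$2 * M$3$1 - M$1$1 * M$3$2, M$1$1 * M$2$2 - M$1$2 * M$2$1]]"

lemmas mat3_simps = vec_eq_iff forall_3 matrix_matrix_mult_def sum_3 mat_def transpose_def

lemma adj3_left: "adj3 M ** M = mat (det M)" and adj3_right: "M ** adj3 M = mat (det M)"
  by (simp_all add: adj3_def mat3_simps det_3 algebra_simps)

lemma adj3_mult: "adj3 (A ** B) = adj3 B ** adj3 A"
  by (simp add: adj3_def mat3_simps algebra_simps)

lemma adj3_transpose: "adj3 (transpose A) = transpose (adj3 A)"
  by (simp add: adj3_def mat3_simps)

lemma adj3_SO3: "h \<in> SO3 \<Longrightarrow> adj3 h = transpose h" for h :: "'a::field^3^3"
  by (simp add: adj3_def mat3_simps SO3_cofactor)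

lemma adj3_rot: "h \<in> SO3 \<Longrightarrow> adj3 (rot h c) = h ** adj3 c" for h :: "'a::field^3^3"
  by (simp add: rot_def adj3_mult adj3_transpose adj3_SO3 transpose_transpose)

lemma mat_mult_nth [simp]: "(mat x ** M) $ i $ j = x * M $ i $ j" for M :: "'a::comm_ring_1^3^3"
  using exhaust_3[of i] by (auto simp: matrix_matrix_mult_def mat_def sum_3)

lemma mult_mat: "M ** mat x = mat x ** M" for M :: "'a::comm_ring_1^3^3"
  by (simp add: mat3_simps mult.commute)

lemma matrix_add_rdistrib3: "(A + B) ** C = A ** C + B ** C" for A :: "'a::comm_ring_1^3^3"
  by (simp add: mat3_simps algebra_simps)

lemma mat_mult_mat: "mat x ** mat y = (mat (x * y) :: 'a::comm_ring_1^3^3)"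
  by (simp add: mat3_simps)

lemma transpose_add: "transpose (A + B) = transpose A + transpose B"
  by (simp add: transpose_def vec_eq_iff)

lemma transpose_mat_mult: "transpose (mat x ** M) = mat x ** transpose M" for M :: "'a::comm_ring_1^3^3"
  by (simp add: vec_eq_iff transpose_def[of M] transpose_def[of "mat x ** M"])

lemma mult_mat_left: "A ** (mat x ** B) = mat x ** (A ** B)" for A :: "'a::comm_ring_1^3^3"
  unfolding matrix_mul_assoc mult_mat[of A] ..

definition mpoly :: "'a::comm_ring_1 mmap \<Rightarrow> bool" where
  "mpoly F \<longleftrightarrow> (\<forall>i j. is_poly (\<lambda>c. F c $ i $ j))"

lemma mpoly_nth: "mpoly F \<Longrightarrow> is_poly (\<lambda>c. F c $ i $ j)"
  by (simp add: mpoly_def)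

lemma mpoly_mult: "mpoly F \<Longrightarrow> mpoly H \<Longrightarrow> mpoly (\<lambda>c. F c ** H c)"
  by (simp add: mpoly_def matrix_matrix_mult_def sum_3 is_poly.add is_poly.mult)

lemma mpoly_add: "mpoly F \<Longrightarrow> mpoly H \<Longrightarrow> mpoly (\<lambda>c. F c + H c)"
  by (simp add: mpoly_def is_poly.add)

lemma mpoly_transpose: "mpoly F \<Longrightarrow> mpoly (\<lambda>c. transpose (F c))"
  by (simp add: mpoly_def transpose_def)

lemma mpoly_mat: "is_poly f \<Longrightarrow> mpoly (\<lambda>c. mat (f c))"
  unfolding mpoly_def mat_def
  by (intro allI, rename_tac i j, case_tac "i = j") (simp_all add: is_poly.const)

lemma mpoly_id: "mpoly (\<lambda>c. c)"
  by (simp add: mpoly_def is_poly.coord)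

lemma mpoly_const: "mpoly (\<lambda>c. A)"
  by (simp add: mpoly_def is_poly.const)

lemma mpoly_adj3: "mpoly (\<lambda>c. adj3 (F c))" if "mpoly F"
proof -
  have "is_poly (\<lambda>c. adj3 (F c) $ i $ j)" for i j
    using exhaust_3[of i] exhaust_3[of j] that
    by (elim disjE) (simp_all add: adj3_def mpoly_def is_poly_diff is_poly.mult)
  then show ?thesis by (simp add: mpoly_def)
qed

lemma is_poly_cancel_det:
  fixes f g :: "'a::field_char_0 pt \<Rightarrow> 'a"
  assumes "is_poly f" "is_poly g" "\<And>c. det c * f c = det c * g c"
  shows "f c = g c"
proof -
  have "f c - g c = 0"
    by (rule is_poly_domain[OF is_poly_det is_poly_diff[OF assms(1,2)], of "mat 1"])
      (simp_all add: assms(3) right_diff_distrib)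
  then show ?thesis by simp
qed

lemma mpoly_cancel_det:
  fixes F H :: "'a::field_char_0 mmap"
  assumes "mpoly F" "mpoly H" "\<And>c. mat (det c) ** F c = mat (det c) ** H c"
  shows "F c = H c"
proof -
  have "F c $ i $ j = H c $ i $ j" for i j
  proof (rule is_poly_cancel_det[OF mpoly_nth[OF assms(1)] mpoly_nth[OF assms(2)]])
    show "det c * F c $ i $ j = det c * H c $ i $ j" for c
      using arg_cong[OF assms(3)[of c], of "\<lambda>M. M $ i $ j"] by simp
  qed
  then show ?thesis by (simp add: vec_eq_iff)
qed

lemma Palg_is_poly: "f \<in> Palg \<Longrightarrow> is_poly f" for f :: "'a::field_char_0 pt \<Rightarrow> 'a"
proof -
  assume "f \<in> Palg"
  then have "\<exists>p. pol p \<and> f = (\<lambda>c. p (gam c))" by (simp only: Palg_iff)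
  then obtain p where "pol p \<and> f = (\<lambda>c. p (gam c))" by (rule exE)
  then show ?thesis by (simp add: is_poly_gam)
qed

lemma Inv3_trans: "is_poly f \<Longrightarrow> (\<And>h c. h \<in> SO3 \<Longrightarrow> f (rot h c) = f c) \<Longrightarrow> f \<in> Inv3" for f :: "'a::field pt \<Rightarrow> 'a"
  by (simp add: Inv3_iff)

section \<open>The complexes in matrix notation\<close>

definition symm :: "(gi \<Rightarrow> 'a) \<Rightarrow> 'a::zero^3^3" where
  "symm z = vector [vector [z G11, z G12, z G13], vector [z G12, z G22, z G23], vector [z G13, z G23, z G33]]"

definition matm :: "(mi \<Rightarrow> 'a) \<Rightarrow> 'a::zero^3^3" where
  "matm x = vector [vector [x M11, x M12, x M13], vector [x M21, x M22, x M23], vector [x M31, x M32, x M33]]"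

lemma symm_gam: "symm (gam c) = c ** transpose c"
  by (simp add: symm_def mat3_simps gp_def mult.commute)

lemma symm_phi2: "symm (phi2 g x) = symm g ** matm x + transpose (matm x) ** symm g"
  by (simp add: symm_def matm_def phi2_def mat3_simps algebra_simps)

lemma symm_phi0: "symm (phi0 g q) = mat (q ()) ** adj3 (symm g)"
  by (simp add: symm_def phi0_def mat3_simps adj3_def algebra_simps)

lemma matm_phi1: "matm (phi1 g u) = mat (u None) + symm g ** symm (\<lambda>i. u (Some i))"
  by (simp add: symm_def matm_def phi1_def mat3_simps algebra_simps)

lemma psi1_zero:
  assumes "transpose (matm y ** symm g) = matm y ** symm g"
  shows "psi1 g y k = 0"
proof -
  have "(matm y ** symm g) $ j $ i = (matm y ** symm g) $ i $ j" for i j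
    using arg_cong[OF assms, of "\<lambda>M. M $ i $ j"] by (simp add: transpose_def)
  from this[of 2 1] this[of 3 1] this[of 3 2] show ?thesis
    by (cases k) (simp_all add: psi1_def matm_def symm_def matrix_matrix_mult_def sum_3)
qed

lemma psi0_zero:
  assumes "symm g ** symm z = mat s"
  shows "psi0 g z k = 0"
proof -
  have "(symm g ** symm z) $ i $ j = mat s $ i $ j" for i j
    using arg_cong[OF assms, of "\<lambda>M. M $ i $ j"] by simp
  from this[of 1 2] this[of 1 3] this[of 2 1] this[of 2 3] this[of 3 1] this[of 3 2] show ?thesis
    by (cases k) (simp_all add: psi0_def symm_def matrix_matrix_mult_def sum_3 mat_def)
qed

lemma psi2_trace: "psi2 g b k = trace (adj3 (symm g) ** symm b)"
  by (simp add: psi2_def trace_def adj3_def symm_def matrix_matrix_mult_def sum_3 algebra_simps)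

lemma psi2_self: "psi2 g g k = 3 * det_pol g"
  by (simp add: psi2_def det_pol_def algebra_simps)

lemma trace_mat_mult: "trace (mat x ** M) = x * trace M" for M :: "'a::comm_ring_1^3^3"
  by (simp add: trace_def sum_3 distrib_left)

section \<open>Equivariant vectors and symmetric matrices\<close>

lemma rot_neg: "rot h (- c) = - rot h c"
  by (simp add: vec_eq_iff rot_nth forall_3)

lemma adj3_neg: "adj3 (- c) = adj3 c"
  by (simp add: adj3_def vec_eq_iff forall_3)

lemma det_neg: "det (- c) = - det c" for c :: "'a::comm_ring_1^3^3"
  by (simp add: det_3)

text \<open>The entries of \<open>(adj C)\<^sup>T u\<close> are odd invariants, hence
  \<open>det C\<close> times elements of \<open>P\<close>. Multiplying by \<open>C\<^sup>T\<close>
  restores \<open>det C * u\<close>, and the common factor cancels.\<close>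

lemma odd_equivariant_vector:
  fixes u :: "'a::field_char_0 pt \<Rightarrow> 'a^3"
  assumes u: "\<And>i. is_poly (\<lambda>c. u c $ i)" and eq: "\<And>h c. h \<in> SO3 \<Longrightarrow> u (rot h c) = h *v u c"
    and odd: "\<And>c. u (- c) = - u c"
  obtains b where "\<And>k. b k \<in> Palg" "\<And>c. u c = transpose c *v (\<chi> k. b k c)"
proof -
  define w where "w c = transpose (adj3 c) *v u c" for c
  have ad: "is_poly (\<lambda>c :: 'a pt. adj3 c $ i $ j)" for i j
    using mpoly_nth[OF mpoly_adj3[OF mpoly_id]] .
  have wn: "w c $ k = adj3 c $ 1 $ k * u c $ 1 + adj3 c $ 2 $ k * u c $ 2 + adj3 c $ 3 $ k * u c $ 3" for c k
    by (simp add: w_def matrix_vector_mult_def sum_3 transpose_def)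
  have "(\<lambda>c. w c $ k) \<in> Inv3" for k
  proof (rule Inv3_trans)
    show "is_poly (\<lambda>c. w c $ k)" unfolding wn by (intro is_poly.add is_poly.mult ad u)
    fix h :: "'a^3^3" and c assume h: "h \<in> SO3"
    have "w (rot h c) = transpose (adj3 c) *v ((transpose h ** h) *v u c)"
      by (simp only: w_def adj3_rot[OF h] eq[OF h] matrix_transpose_mul matrix_vector_mul_assoc matrix_mul_assoc)
    then show "w (rot h c) $ k = w c $ k" using h by (simp add: w_def SO3_def)
  qed
  moreover have "w (- c) $ k = - (w c $ k)" for c k
    unfolding wn adj3_neg odd by simp
  ultimately have "\<exists>b. b \<in> Palg \<and> (\<forall>c. w c $ k = det c * b c)" for k
    by (rule odd_invariant[of "\<lambda>c. w c $ k"]) blast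
  then have "\<forall>k. \<exists>b. b \<in> Palg \<and> (\<forall>c. w c $ k = det c * b c)" by (rule allI)
  from choice[OF this] obtain b where "\<forall>k. b k \<in> Palg \<and> (\<forall>c. w c $ k = det c * b k c)" by (rule exE)
  then have b: "b k \<in> Palg" "w c $ k = det c * b k c" for k c by blast+
  have "u c = transpose c *v (\<chi> k. b k c)" for c
  proof -
    have e: "(transpose c *v (\<chi> k. b k c)) $ i = c$1$i * b 1 c + c$2$i * b 2 c + c$3$i * b 3 c" for c i
      by (simp add: matrix_vector_mult_def sum_3 transpose_def)
    have "u c $ i = (transpose c *v (\<chi> k. b k c)) $ i" for i
      unfolding e
    proof (rule is_poly_cancel_det[OF u])
      show "is_poly (\<lambda>c. c$1$i * b 1 c + c$2$i * b 2 c + c$3$i * b 3 c)"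
        by (intro is_poly.add is_poly.mult is_poly.coord Palg_is_poly b)
      fix c :: "'a pt"
      have "transpose c *v w c = transpose (adj3 c ** c) *v u c"
        by (simp only: w_def matrix_transpose_mul matrix_vector_mul_assoc)
      then have "(transpose c *v w c) $ i = det c * u c $ i"
        unfolding adj3_left using exhaust_3[of i] by (auto simp: matrix_vector_mult_def sum_3 transpose_def mat_def)
      moreover have "(transpose c *v w c) $ i = det c * (c$1$i * b 1 c + c$2$i * b 2 c + c$3$i * b 3 c)"
        by (simp add: matrix_vector_mult_def sum_3 transpose_def b algebra_simps)
      ultimately show "det c * u c $ i = det c * (c$1$i * b 1 c + c$2$i * b 2 c + c$3$i * b 3 c)" by simp
    qed
    then show ?thesis by (simp add: vec_eq_iff)
  qed
  then show ?thesis by (rule that[OF b(1)])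
qed

text \<open>Here \<open>C u\<close> is the odd contraction, and \<open>adj C\<close> is what inverts
  \<open>C\<close> up to \<open>det C\<close>.\<close>

lemma even_equivariant_vector:
  fixes u :: "'a::field_char_0 pt \<Rightarrow> 'a^3"
  assumes u: "\<And>i. is_poly (\<lambda>c. u c $ i)" and eq: "\<And>h c. h \<in> SO3 \<Longrightarrow> u (rot h c) = h *v u c"
    and even: "\<And>c. u (- c) = u c"
  obtains b where "\<And>k. b k \<in> Palg" "\<And>c. u c = adj3 c *v (\<chi> k. b k c)"
proof -
  define w where "w c = c *v u c" for c
  have ad: "is_poly (\<lambda>c :: 'a pt. adj3 c $ i $ j)" for i j
    using mpoly_nth[OF mpoly_adj3[OF mpoly_id]] .
  have wn: "w c $ k = c $ k $ 1 * u c $ 1 + c $ k $ 2 * u c $ 2 + c $ k $ 3 * u c $ 3" for c k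
    by (simp add: w_def matrix_vector_mult_def sum_3)
  have "(\<lambda>c. w c $ k) \<in> Inv3" for k
  proof (rule Inv3_trans)
    show "is_poly (\<lambda>c. w c $ k)" unfolding wn by (intro is_poly.add is_poly.mult is_poly.coord u)
    fix h :: "'a^3^3" and c assume h: "h \<in> SO3"
    have "w (rot h c) = c *v ((transpose h ** h) *v u c)"
      by (simp only: w_def eq[OF h]) (simp only: rot_def matrix_vector_mul_assoc matrix_mul_assoc)
    then show "w (rot h c) $ k = w c $ k" using h by (simp add: w_def SO3_def)
  qed
  moreover have "w (- c) $ k = - (w c $ k)" for c k
    unfolding wn even by simp
  ultimately have "\<exists>b. b \<in> Palg \<and> (\<forall>c. w c $ k = det c * b c)" for k
    by (rule odd_invariant[of "\<lambda>c. w c $ k"]) blast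
  then have "\<forall>k. \<exists>b. b \<in> Palg \<and> (\<forall>c. w c $ k = det c * b c)" by (rule allI)
  from choice[OF this] obtain b where "\<forall>k. b k \<in> Palg \<and> (\<forall>c. w c $ k = det c * b k c)" by (rule exE)
  then have b: "b k \<in> Palg" "w c $ k = det c * b k c" for k c by blast+
  have "u c = adj3 c *v (\<chi> k. b k c)" for c
  proof -
    have e: "(adj3 c *v (\<chi> k. b k c)) $ i = adj3 c$i$1 * b 1 c + adj3 c$i$2 * b 2 c + adj3 c$i$3 * b 3 c" for c i
      by (simp add: matrix_vector_mult_def sum_3)
    have "u c $ i = (adj3 c *v (\<chi> k. b k c)) $ i" for i
      unfolding e
    proof (rule is_poly_cancel_det[OF u])
      show "is_poly (\<lambda>c. adj3 c$i$1 * b 1 c + adj3 c$i$2 * b 2 c + adj3 c$i$3 * b 3 c)"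
        by (intro is_poly.add is_poly.mult ad Palg_is_poly b)
      fix c :: "'a pt"
      have "adj3 c *v w c = (adj3 c ** c) *v u c"
        by (simp add: w_def matrix_vector_mul_assoc)
      then have e1: "(adj3 c *v w c) $ i = det c * u c $ i"
        unfolding adj3_left using exhaust_3[of i] by (auto simp: matrix_vector_mult_def sum_3 mat_def)
      have e2: "(adj3 c *v w c) $ i = det c * (adj3 c$i$1 * b 1 c + adj3 c$i$2 * b 2 c + adj3 c$i$3 * b 3 c)"
        by (simp add: matrix_vector_mult_def sum_3 b algebra_simps)
      show "det c * u c $ i = det c * (adj3 c$i$1 * b 1 c + adj3 c$i$2 * b 2 c + adj3 c$i$3 * b 3 c)"
        by (rule trans[OF e1[symmetric] e2])
    qed
    then show ?thesis by (simp add: vec_eq_iff)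
  qed
  then show ?thesis by (rule that[OF b(1)])
qed

lemma choice2:
  assumes "\<And>i j. \<exists>y. P i j y"
  shows "\<exists>f. \<forall>i j. P i j (f i j)"
  by (rule exI[of _ "\<lambda>i j. SOME y. P i j y"]) (use someI_ex[OF assms] in blast)

text \<open>Equivariance is formulated with \<open>rot\<close>, where vectors and matrices are
  transformed by the same rotation \<open>h\<close>.\<close>

definition eqv :: "'a::comm_ring_1 mmap \<Rightarrow> bool" where
  "eqv S \<longleftrightarrow> mpoly S \<and> (\<forall>h\<in>SO3. \<forall>c. S (rot h c) = h ** S c ** transpose h) \<and> (\<forall>c. transpose (S c) = S c)"

lemma Palg_gam_choice:
  fixes f :: "'k \<Rightarrow> 'a::field_char_0 pt \<Rightarrow> 'a"
  assumes "\<And>k. f k \<in> Palg"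
  obtains V where "\<And>k. pol (\<lambda>x. V x k)" "\<And>k c. f k c = V (gam c) k"
proof -
  have "\<forall>k. \<exists>p. pol p \<and> f k = (\<lambda>c. p (gam c))" using assms Palg_iff by blast
  from choice[OF this] obtain p where p: "\<forall>k. pol (p k) \<and> f k = (\<lambda>c. p k (gam c))" by blast
  show ?thesis
  proof (rule that[of "\<lambda>x k. p k x"])
    show "pol (\<lambda>x. p k x)" for k using p by simp
    show "f k c = p k (gam c)" for k c using p by (metis (no_types))
  qed
qed

lemma even_equivariant_symmetric:
  fixes S :: "'a::field_char_0 mmap"
  assumes S: "eqv S" and even: "\<And>c. S (- c) = S c"
  obtains p Z where "p \<in> Palg" "\<And>i. Z i \<in> Palg" "\<And>c. S c = mat (p c) + transpose c ** symm (\<lambda>i. Z i c) ** c"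
proof -
  have Sp: "mpoly S" and Se: "\<And>h c. h \<in> SO3 \<Longrightarrow> S (rot h c) = h ** S c ** transpose h"
    and St: "\<And>c. transpose (S c) = S c" using S by (auto simp: eqv_def)
  \<comment> \<open>\<open>S\<close> and \<open>adj3\<close> are even and \<open>c\<close> is odd,
    so the entries of \<open>W\<close> are odd and \<open>det C\<close> can be split off.\<close>
  define W where "W c = c ** S c ** adj3 c" for c
  have Wp: "mpoly W" unfolding W_def by (intro mpoly_mult mpoly_id Sp mpoly_adj3)
  have "\<exists>y. y \<in> Palg \<and> (\<forall>c. W c $ i $ j = det c * y c)" for i j
  proof (rule odd_invariant[of "\<lambda>c. W c $ i $ j"])
    show "(\<lambda>c. W c $ i $ j) \<in> Inv3"
    proof (rule Inv3_trans[OF mpoly_nth[OF Wp]])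
      fix h :: "'a^3^3" and c assume h: "h \<in> SO3"
      have "W (rot h c) = c ** (transpose h ** h) ** S c ** (transpose h ** h) ** adj3 c"
        by (simp only: W_def Se[OF h] adj3_rot[OF h]) (simp only: rot_def matrix_mul_assoc)
      then show "W (rot h c) $ i $ j = W c $ i $ j" using h by (simp add: W_def SO3_def)
    qed
    have "(- c) ** M = - (c ** M)" for M :: "'a^3^3" and c :: "'a^3^3" by (simp add: mat3_simps)
    moreover have "(- M) ** A = - (M ** A)" for M A :: "'a^3^3" by (simp add: mat3_simps)
    ultimately show "W (- c) $ i $ j = - (W c $ i $ j)" for c
      unfolding W_def even adj3_neg by simp
  qed blast
  from choice2[OF this] obtain y where "\<forall>i j. y i j \<in> Palg \<and> (\<forall>c. W c $ i $ j = det c * y i j c)" by (rule exE)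
  then have y: "y i j \<in> Palg" "W c $ i $ j = det c * y i j c" for i j c by blast+
  define Y where "Y m = (case m of M11 \<Rightarrow> y 1 1 | M12 \<Rightarrow> y 1 2 | M13 \<Rightarrow> y 1 3 | M21 \<Rightarrow> y 2 1 | M22 \<Rightarrow> y 2 2
     | M23 \<Rightarrow> y 2 3 | M31 \<Rightarrow> y 3 1 | M32 \<Rightarrow> y 3 2 | M33 \<Rightarrow> y 3 3)" for m
  have YP: "Y m \<in> Palg" for m by (cases m) (simp_all add: Y_def y)
  define N where "N c = matm (\<lambda>m. Y m c)" for c
  have Nn: "N c $ i $ j = y i j c" for c i j
    using exhaust_3[of i] exhaust_3[of j] by (auto simp: N_def matm_def Y_def)
  have Np: "mpoly N" unfolding mpoly_def Nn using y(1) Palg_is_poly by blast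
  have WN: "W c = mat (det c) ** N c" for c by (simp add: vec_eq_iff y Nn)
  have NG: "N c ** (c ** transpose c) = c ** S c ** transpose c" for c
  proof (rule mpoly_cancel_det[of "\<lambda>c. N c ** (c ** transpose c)" "\<lambda>c. c ** S c ** transpose c"])
    show "mpoly (\<lambda>c. N c ** (c ** transpose c))" "mpoly (\<lambda>c. c ** S c ** transpose c)"
      by (intro mpoly_mult mpoly_id mpoly_transpose Sp Np)+
    show "mat (det c) ** (N c ** (c ** transpose c)) = mat (det c) ** (c ** S c ** transpose c)" for c
    proof -
      have "mat (det c) ** (N c ** (c ** transpose c)) = c ** S c ** (adj3 c ** c) ** transpose c"
        unfolding matrix_mul_assoc WN[symmetric] W_def ..
      then show ?thesis unfolding adj3_left mult_mat[of "c ** S c"] by (simp only: matrix_mul_assoc)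
    qed
  qed
  obtain V where V: "\<And>m. pol (\<lambda>x. V x m)" "\<And>m c. Y m c = V (gam c) m"
  proof (rule Palg_gam_choice[OF YP])
    fix V assume "\<And>m. pol (\<lambda>x. V x m)" "\<And>m c. Y m c = V (gam c) m"
    then show thesis by (rule that)
  qed
  have NV: "N c = matm (V (gam c))" for c by (simp add: N_def V)
  have psi: "psi1 x (V x) k = 0" for x k
  proof (rule gam_algebraically_independent[of "\<lambda>x. psi1 x (V x) k"])
    show "pol (\<lambda>x. psi1 x (V x) k)" using cx1.psi_pol[of V UNIV k] V(1) by simp
    show "psi1 (gam c) (V (gam c)) k = 0" for c
    proof (rule psi1_zero)
      have "transpose (c ** S c ** transpose c) = c ** S c ** transpose c"
        by (simp add: matrix_transpose_mul St transpose_transpose matrix_mul_assoc)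
      then show "transpose (matm (V (gam c)) ** symm (gam c)) = matm (V (gam c)) ** symm (gam c)"
        unfolding symm_gam NV[symmetric] NG .
    qed
  qed
  obtain U where U: "\<And>k. pol (\<lambda>x. U x k)" "\<And>x. V x = phi1 x (U x)"
  proof (rule gram_symmetric[OF V(1) psi])
    fix U assume "\<And>k. pol (\<lambda>x. U x k)" "\<And>x. V x = phi1 x (U x)"
    then show thesis by (rule that)
  qed
  define p where "p c = U (gam c) None" for c :: "'a pt"
  define Z where "Z i c = U (gam c) (Some i)" for i and c :: "'a pt"
  have pZ: "p \<in> Palg" "\<And>i. Z i \<in> Palg"
    unfolding p_def Z_def Palg_iff using U(1) by blast+
  have N2: "N c = mat (p c) + c ** transpose c ** symm (\<lambda>i. Z i c)" for c
    unfolding NV U(2) matm_phi1 symm_gam p_def Z_def ..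
  have Zp: "mpoly (\<lambda>c. symm (\<lambda>i. Z i c))"
  proof -
    have "is_poly (\<lambda>c. symm (\<lambda>i. Z i c) $ i $ j)" for i j
      using exhaust_3[of i] exhaust_3[of j] pZ(2)[THEN Palg_is_poly] by (elim disjE) (simp_all add: symm_def)
    then show ?thesis by (simp add: mpoly_def)
  qed
  have "S c = mat (p c) + transpose c ** symm (\<lambda>i. Z i c) ** c" for c
  proof (rule mpoly_cancel_det[OF Sp])
    show "mpoly (\<lambda>c. mat (p c) + transpose c ** symm (\<lambda>i. Z i c) ** c)"
      by (intro mpoly_add mpoly_mult mpoly_transpose mpoly_id mpoly_mat Zp Palg_is_poly pZ)
    show "mat (det c) ** S c = mat (det c) ** (mat (p c) + transpose c ** symm (\<lambda>i. Z i c) ** c)" for c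
    \<comment> \<open>Both sides carry the factor \<open>det c\<close>: the equation is trivial
      where it vanishes, and elsewhere a second factor may be multiplied in, so that
      \<open>adj3 c ** c\<close> becomes available on both sides of \<open>S\<close>.\<close>
    proof (cases "det c = 0")
      case True
      then show ?thesis by (simp add: vec_eq_iff)
    next
      case False
      have "mat (det c) ** (mat (det c) ** S c) = adj3 c ** W c ** c"
      proof -
        have "adj3 c ** W c ** c = (adj3 c ** c) ** S c ** (adj3 c ** c)" by (simp only: W_def matrix_mul_assoc)
        then show ?thesis unfolding adj3_left mult_mat[of "mat (det c) ** S c"] by simp
      qed
      also have "\<dots> = mat (det c) ** (adj3 c ** N c ** c)"
        unfolding WN mult_mat_left by (simp only: matrix_mul_assoc)
      also have "adj3 c ** N c ** c = mat (p c) ** (adj3 c ** c) + (adj3 c ** c) ** transpose c ** symm (\<lambda>i. Z i c) ** c"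
        unfolding N2 matrix_add_ldistrib matrix_add_rdistrib3 mult_mat[of "adj3 c"]
        by (simp only: matrix_mul_assoc)
      also have "\<dots> = mat (det c) ** (mat (p c) + transpose c ** symm (\<lambda>i. Z i c) ** c)"
        unfolding adj3_left by (simp only: matrix_add_ldistrib matrix_mul_assoc mat_mult_mat mult.commute)
      finally have "mat (det c) ** (mat (det c) ** S c)
          = mat (det c) ** (mat (det c) ** (mat (p c) + transpose c ** symm (\<lambda>i. Z i c) ** c))" .
      then show ?thesis using False by (simp add: vec_eq_iff)
    qed
  qed
  then show ?thesis by (rule that[OF pZ])
qed

lemma odd_equivariant_symmetric:
  fixes S :: "'a::field_char_0 mmap"
  assumes S: "eqv S" and odd: "\<And>c. S (- c) = - S c"
  obtains t X where "t \<in> Palg" "\<And>m. X m \<in> Palg"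
    "\<And>c. S c = mat (det c * t c) + (transpose c ** matm (traceless (\<lambda>m. X m c)) ** transpose (adj3 c)
       + transpose (transpose c ** matm (traceless (\<lambda>m. X m c)) ** transpose (adj3 c)))"
proof -
  have Sp: "mpoly S" and Se: "\<And>h c. h \<in> SO3 \<Longrightarrow> S (rot h c) = h ** S c ** transpose h"
    and St: "\<And>c. transpose (S c) = S c" using S by (auto simp: eqv_def)
  define W where "W c = c ** S c ** transpose c" for c
  have Wp: "mpoly W" unfolding W_def by (intro mpoly_mult mpoly_id Sp mpoly_transpose)
  have WT: "W c $ j $ i = W c $ i $ j" for c i j
  proof -
    have "transpose (W c) = W c" by (simp add: W_def matrix_transpose_mul St transpose_transpose matrix_mul_assoc)
    then have "transpose (W c) $ i $ j = W c $ i $ j" by simp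
    then show ?thesis by (simp add: transpose_def)
  qed
  have "\<exists>y. y \<in> Palg \<and> (\<forall>c. W c $ i $ j = det c * y c)" for i j
  proof (rule odd_invariant[of "\<lambda>c. W c $ i $ j"])
    show "(\<lambda>c. W c $ i $ j) \<in> Inv3"
    proof (rule Inv3_trans[OF mpoly_nth[OF Wp]])
      fix h :: "'a^3^3" and c assume h: "h \<in> SO3"
      have "W (rot h c) = c ** (transpose h ** h) ** S c ** (transpose h ** h) ** transpose c"
        by (simp only: W_def Se[OF h]) (simp only: rot_def matrix_transpose_mul transpose_transpose matrix_mul_assoc)
      then show "W (rot h c) $ i $ j = W c $ i $ j" using h by (simp add: W_def SO3_def)
    qed
    have "(- c) ** (- M) ** transpose (- c) = - (c ** M ** transpose c)" for M :: "'a^3^3" and c :: "'a^3^3"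
      by (simp add: mat3_simps algebra_simps)
    then show "W (- c) $ i $ j = - (W c $ i $ j)" for c
      unfolding W_def odd by simp
  qed blast
  from choice2[OF this] obtain y where "\<forall>i j. y i j \<in> Palg \<and> (\<forall>c. W c $ i $ j = det c * y i j c)" by (rule exE)
  then have y: "y i j \<in> Palg" "W c $ i $ j = det c * y i j c" for i j c by blast+
  define B where "B m = (case m of G11 \<Rightarrow> y 1 1 | G12 \<Rightarrow> y 1 2 | G13 \<Rightarrow> y 1 3 | G22 \<Rightarrow> y 2 2
     | G23 \<Rightarrow> y 2 3 | G33 \<Rightarrow> y 3 3)" for m
  have BP: "B m \<in> Palg" for m by (cases m) (simp_all add: B_def y)
  have WB: "W c = mat (det c) ** symm (\<lambda>m. B m c)" for c
    by (simp add: vec_eq_iff forall_3 symm_def B_def y(2)[symmetric] WT[of c 1 2] WT[of c 1 3] WT[of c 2 3])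
  have "\<exists>t. t \<in> Palg \<and> (\<forall>c. trace (S c) = det c * t c)"
  proof (rule odd_invariant[of "\<lambda>c. trace (S c)"])
    show "(\<lambda>c. trace (S c)) \<in> Inv3"
    proof (rule Inv3_trans)
      show "is_poly (\<lambda>c. trace (S c))"
        unfolding trace_def sum_3 by (intro is_poly.add mpoly_nth[OF Sp])
      fix h :: "'a^3^3" and c assume h: "h \<in> SO3"
      have "trace (S (rot h c)) = trace (transpose h ** h ** S c)"
        unfolding Se[OF h] by (subst trace_mul_sym) (simp only: matrix_mul_assoc)
      then show "trace (S (rot h c)) = trace (S c)" using h by (simp add: SO3_def)
    qed
    show "trace (S (- c)) = - trace (S c)" for c unfolding odd by (simp add: trace_def sum_3)
  qed blast
  then obtain t where "t \<in> Palg \<and> (\<forall>c. trace (S c) = det c * t c)" by (rule exE)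
  then have t: "t \<in> Palg" "trace (S c) = det c * t c" for c by blast+
  \<comment> \<open>As \<open>adj G = (adj C)\<^sup>T adj C\<close>, the trace of
    \<open>adj G\<close> times \<open>C S C\<^sup>T\<close> collapses to
    \<open>det(C)\<^sup>2 tr S\<close>.\<close>
  have psiB: "psi2 (gam c) (\<lambda>m. B m c) k = det_pol (gam c) * t c" for c k
  proof (rule is_poly_cancel_det[of "\<lambda>c. psi2 (gam c) (\<lambda>m. B m c) k" "\<lambda>c. det_pol (gam c) * t c"])
    show "is_poly (\<lambda>c. psi2 (gam c) (\<lambda>m. B m c) k)"
      unfolding psi2_def gam_simps
      by (intro is_poly.add is_poly.mult is_poly_diff is_poly_gp is_poly.const Palg_is_poly BP)
    show "is_poly (\<lambda>c. det_pol (gam c) * t c)"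
      by (intro is_poly.mult is_poly_gam[OF pol_det] Palg_is_poly t)
    show "det c * psi2 (gam c) (\<lambda>m. B m c) k = det c * (det_pol (gam c) * t c)" for c
    proof -
      have "det c * psi2 (gam c) (\<lambda>m. B m c) k = trace (adj3 (c ** transpose c) ** (mat (det c) ** symm (\<lambda>m. B m c)))"
        unfolding psi2_trace symm_gam mult_mat_left trace_mat_mult ..
      also have "\<dots> = trace (transpose (adj3 c) ** (adj3 c ** c) ** S c ** transpose c)"
        unfolding WB[symmetric] W_def adj3_mult adj3_transpose by (simp only: matrix_mul_assoc)
      also have "\<dots> = det c * trace (transpose (adj3 c) ** (S c ** transpose c))"
        unfolding adj3_left mult_mat[of "transpose (adj3 c)"] by (simp only: trace_mat_mult flip: matrix_mul_assoc)
      also have "trace (transpose (adj3 c) ** (S c ** transpose c)) = trace (S c ** transpose (adj3 c ** c))"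
        by (subst trace_mul_sym) (simp only: matrix_transpose_mul matrix_mul_assoc)
      also have "\<dots> = det c * trace (S c)"
        unfolding adj3_left transpose_mat mult_mat[of "S c"] trace_mat_mult ..
      finally show ?thesis unfolding det_gam t(2) by (simp only: mult_ac)
    qed
  qed
  \<comment> \<open>\<open>tr (adj G G) = 3 det G\<close>, so subtracting \<open>t G / 3\<close>
    cancels the value found in \<open>psiB\<close>; for \<open>S\<close> this removes the scalar
    part \<open>tr S / 3\<close>.\<close>
  define B' where "B' m c = B m c - 1/3 * t c * gam c m" for m c
  have B'P: "B' m \<in> Palg" for m
  proof -
    have "(\<lambda>c :: 'a pt. gam c m) \<in> Palg" by (cases m) (simp_all add: gp_Palg)
    from Palg.add[OF BP[of m] Palg.mult[OF Palg.mult[OF Palg.const[of "-1/3"] t(1)] this]]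
    have "(\<lambda>c. B m c + - 1 / 3 * t c * gam c m) \<in> Palg" .
    moreover have "(\<lambda>c. B m c + - 1 / 3 * t c * gam c m) = B' m" by (auto simp: B'_def)
    ultimately show ?thesis by simp
  qed
  obtain V where V: "\<And>m. pol (\<lambda>x. V x m)" "\<And>m c. B' m c = V (gam c) m"
  proof (rule Palg_gam_choice[OF B'P])
    fix V assume "\<And>m. pol (\<lambda>x. V x m)" "\<And>m c. B' m c = V (gam c) m"
    then show thesis by (rule that)
  qed
  have psi: "psi2 x (V x) k = 0" for x k
  proof (rule gam_algebraically_independent[of "\<lambda>x. psi2 x (V x) k"])
    show "pol (\<lambda>x. psi2 x (V x) k)" using cx2.psi_pol[of V UNIV k] V(1) by simp
    show "psi2 (gam c) (V (gam c)) k = 0" for c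
    proof -
      have "psi2 (gam c) (V (gam c)) k = psi2 (gam c) (\<lambda>m. B m c - 1/3 * t c * gam c m) k"
      proof -
        have "V (gam c) = (\<lambda>m. B m c - 1/3 * t c * gam c m)" by (rule ext) (simp add: V(2)[symmetric] B'_def)
        then show ?thesis by (rule arg_cong)
      qed
      then show ?thesis unfolding cx2.psi_lin psiB psi2_self by simp
    qed
  qed
  obtain U where U: "\<And>k. pol (\<lambda>x. U x k)" "\<And>x. V x = phi2 x (traceless (U x))"
  proof (rule gram_adj_trace[OF V(1) psi])
    fix U assume "\<And>k. pol (\<lambda>x. U x k)" "\<And>x. V x = phi2 x (traceless (U x))"
    then show thesis by (rule that)
  qed
  define X where "X m c = U (gam c) m" for m and c :: "'a pt"
  have XP: "X m \<in> Palg" for m unfolding X_def Palg_iff using U(1) by blast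
  define x where "x c = matm (traceless (\<lambda>m. X m c))" for c
  have xp: "mpoly x"
  proof -
    have "is_poly (\<lambda>c. x c $ i $ j)" for i j
      using exhaust_3[of i] exhaust_3[of j] XP[THEN Palg_is_poly]
      by (elim disjE) (simp_all add: x_def matm_def traceless_def is_poly_diff is_poly_uminus)
    then show ?thesis by (simp add: mpoly_def)
  qed
  have BX: "symm (\<lambda>m. B m c) = mat (1/3 * t c) ** (c ** transpose c) + (c ** transpose c ** x c + transpose (x c) ** (c ** transpose c))" for c
  proof -
    have "symm (\<lambda>m. B m c) = mat (1/3 * t c) ** symm (gam c) + symm (\<lambda>m. B' m c)"
      by (simp add: vec_eq_iff forall_3 symm_def B'_def)
    also have "symm (\<lambda>m. B' m c) = symm (gam c) ** x c + transpose (x c) ** symm (gam c)"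
      unfolding V(2) x_def X_def by (simp add: U(2) symm_phi2)
    finally show ?thesis unfolding symm_gam .
  qed
  have SS: "S c = mat (det c * (1/3 * t c)) + (transpose c ** x c ** transpose (adj3 c) + transpose (transpose c ** x c ** transpose (adj3 c)))"
    (is "_ = ?R c") for c
  proof (rule mpoly_cancel_det[OF Sp])
    show "mpoly ?R"
      by (intro mpoly_add mpoly_mult mpoly_transpose mpoly_adj3 mpoly_id mpoly_mat xp is_poly.mult is_poly.const is_poly_det Palg_is_poly t)
    show "mat (det c) ** S c = mat (det c) ** ?R c" for c
    proof (cases "det c = 0")
      case True
      then show ?thesis by (simp add: vec_eq_iff)
    next
      case False
      let ?a = "adj3 c" and ?d = "mat (det c) :: 'a^3^3"
      have ca: "transpose c ** transpose ?a = ?d" by (simp only: matrix_transpose_mul[symmetric] adj3_left transpose_mat)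
      have "?d ** (?d ** S c) = ?a ** W c ** transpose ?a"
      proof -
        have "?a ** W c ** transpose ?a = (?a ** c) ** S c ** (transpose c ** transpose ?a)"
          by (simp only: W_def matrix_mul_assoc)
        then show ?thesis unfolding adj3_left ca mult_mat[of "?d ** S c"] by simp
      qed
      also have "\<dots> = ?d ** (?a ** symm (\<lambda>m. B m c) ** transpose ?a)"
        unfolding WB mult_mat_left by (simp only: matrix_mul_assoc)
      also have "?a ** symm (\<lambda>m. B m c) ** transpose ?a
        = mat (1/3 * t c) ** ((?a ** c) ** (transpose c ** transpose ?a))
          + ((?a ** c) ** (transpose c ** x c ** transpose ?a) + ?a ** transpose (x c) ** c ** (transpose c ** transpose ?a))"
        unfolding BX matrix_add_ldistrib matrix_add_rdistrib3 mult_mat_left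
        by (simp only: matrix_mul_assoc)
      also have "\<dots> = ?d ** ?R c"
        unfolding adj3_left ca mult_mat[of "?a ** transpose (x c) ** c"]
        by (simp only: matrix_add_ldistrib matrix_transpose_mul transpose_transpose mat_mult_mat matrix_mul_assoc mult_ac)
      finally have "?d ** (?d ** S c) = ?d ** (?d ** ?R c)" .
      then show ?thesis using False by (simp add: vec_eq_iff)
    qed
  qed
  have tP: "(\<lambda>c. 1/3 * t c) \<in> Palg" using Palg.mult[OF Palg.const t(1)] .
  show ?thesis by (rule that[OF tP XP SS[unfolded x_def]])
qed

section \<open>Spans over rings of functions\<close>

lemma mat_zero [simp]: "(mat 0 :: 'a::comm_ring_1^3^3) = 0"
  by (simp add: vec_eq_iff mat_def)

lemma zero_mult [simp]: "(0 :: 'a::comm_ring_1^3^3) ** M = 0" "M ** (0 :: 'a::comm_ring_1^3^3) = 0"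
  by (simp_all add: vec_eq_iff matrix_matrix_mult_def)

lemma lincomb_Nil [simp]: "lincomb ps [] = (\<lambda>c. 0)"
  by (simp add: lincomb_def)

lemma lincomb_Cons [simp]: "lincomb (p # ps) (F # Fs) = (\<lambda>c. mat (p c) ** F c + lincomb ps Fs c)"
  by (simp add: lincomb_def sum.lessThan_Suc_shift del: sum.lessThan_Suc)

text \<open>\<open>Pspan\<close> and \<open>Kspan\<close> differ only in the ring of coefficients,
  so both are treated at once.\<close>

definition spanR :: "('a::comm_ring_1 pt \<Rightarrow> 'a) set \<Rightarrow> 'a mmap set \<Rightarrow> 'a mmap set" where
  "spanR R S = {lincomb ps Fs | ps Fs. length ps = length Fs \<and> set Fs \<subseteq> S \<and> set ps \<subseteq> R}"

lemma Pspan_eq: "Pspan = spanR Palg" and Kspan_eq: "Kspan = spanR (range (\<lambda>a c. a))"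
  by (auto simp: fun_eq_iff Pspan_def Kspan_def spanR_def)

definition subring :: "('a::comm_ring_1 pt \<Rightarrow> 'a) set \<Rightarrow> bool" where
  "subring R \<longleftrightarrow> (\<forall>a. (\<lambda>c. a) \<in> R) \<and> (\<forall>p\<in>R. \<forall>q\<in>R. (\<lambda>c. p c + q c) \<in> R \<and> (\<lambda>c. p c * q c) \<in> R)"

lemma subring_Palg: "subring Palg"
  unfolding subring_def using Palg.const Palg.add Palg.mult by blast

lemma subring_const: "subring (range (\<lambda>a c. a))"
  unfolding subring_def by auto

lemma spanR_zero: "(\<lambda>c. 0) \<in> spanR R S"
  unfolding spanR_def by (intro CollectI exI[of _ "[]"]) simp

lemma spanR_cons:
  assumes "p \<in> R" "G \<in> S" "H \<in> spanR R S"
  shows "(\<lambda>c. mat (p c) ** G c + H c) \<in> spanR R S"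
proof -
  obtain ps Fs where "H = lincomb ps Fs" "length ps = length Fs" "set Fs \<subseteq> S" "set ps \<subseteq> R"
    using assms(3) unfolding spanR_def by blast
  then show ?thesis using assms(1,2) unfolding spanR_def
    by (intro CollectI exI[of _ "p # ps"] exI[of _ "G # Fs"]) simp
qed

lemma spanR_induct [consumes 1, case_names zero cons]:
  assumes "F \<in> spanR R S" and zero: "Q (\<lambda>c. 0)"
    and cons: "\<And>p G H. p \<in> R \<Longrightarrow> G \<in> S \<Longrightarrow> H \<in> spanR R S \<Longrightarrow> Q H \<Longrightarrow> Q (\<lambda>c. mat (p c) ** G c + H c)"
  shows "Q F"
proof -
  have "Q (lincomb ps Fs)" if "length ps = length Fs" "set Fs \<subseteq> S" "set ps \<subseteq> R" for ps Fs
    using that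
  proof (induction ps Fs rule: list_induct2)
    case Nil
    then show ?case using zero by simp
  next
    case (Cons p ps G Fs)
    have "lincomb ps Fs \<in> spanR R S" using Cons unfolding spanR_def by auto
    then show ?case using Cons cons by simp
  qed
  then show ?thesis using assms(1) unfolding spanR_def by blast
qed

lemma spanR_base:
  assumes "subring R" "G \<in> S"
  shows "G \<in> spanR R S"
proof -
  have "(\<lambda>c. mat ((\<lambda>c. 1) c) ** G c + (\<lambda>c. 0) c) \<in> spanR R S"
    using assms by (intro spanR_cons spanR_zero) (auto simp: subring_def)
  then show ?thesis by simp
qed

lemma spanR_add: "F \<in> spanR R S \<Longrightarrow> H \<in> spanR R S \<Longrightarrow> (\<lambda>c. F c + H c) \<in> spanR R S"
proof (induction rule: spanR_induct)
  case (cons p G F)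
  then show ?case using spanR_cons[of p R G S "\<lambda>c. F c + H c"] by (simp add: add.assoc)
qed simp

lemma spanR_scale:
  assumes R: "subring R" and q: "q \<in> R" and F: "F \<in> spanR R S"
  shows "(\<lambda>c. mat (q c) ** F c) \<in> spanR R S"
  using F
proof (induction rule: spanR_induct)
  case zero
  then show ?case using spanR_zero by simp
next
  case (cons p G F)
  have "(\<lambda>c. mat (q c * p c) ** G c + mat (q c) ** F c) \<in> spanR R S"
    using spanR_cons[of "\<lambda>c. q c * p c"] cons q R by (simp add: subring_def)
  moreover have "mat (q c) ** (mat (p c) ** G c + F c) = mat (q c * p c) ** G c + mat (q c) ** F c" for c
    by (simp add: matrix_add_ldistrib matrix_mul_assoc mat_mult_mat)
  ultimately show ?case by simp
qed

lemma spanR_subset: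
  assumes R: "subring R" and "S \<subseteq> spanR R T"
  shows "spanR R S \<subseteq> spanR R T"
proof
  fix F assume "F \<in> spanR R S"
  then show "F \<in> spanR R T"
  proof (induction rule: spanR_induct)
    case (cons p G H)
    then show ?case using assms by (intro spanR_add spanR_scale) auto
  qed (rule spanR_zero)
qed

lemma spanR_mono_ring: "R \<subseteq> R' \<Longrightarrow> spanR R S \<subseteq> spanR R' S"
  unfolding spanR_def by blast

text \<open>A combination may use members of the list repeatedly and in any order; each further term
  is absorbed into the coefficient at one index where its member occurs.\<close>

lemma spanR_list:
  assumes R: "subring R"
  shows "spanR R (set Fs) = {lincomb ps Fs | ps. length ps = length Fs \<and> set ps \<subseteq> R}"
proof
  show "{lincomb ps Fs | ps. length ps = length Fs \<and> set ps \<subseteq> R} \<subseteq> spanR R (set Fs)"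
    unfolding spanR_def by blast
  have "\<exists>ps. F = lincomb ps Fs \<and> length ps = length Fs \<and> set ps \<subseteq> R" if "F \<in> spanR R (set Fs)" for F
    using that
  proof (induction rule: spanR_induct)
    case zero
    have "lincomb (replicate (length Fs) (\<lambda>c. 0)) Fs = (\<lambda>c. 0)"
      by (induction Fs) simp_all
    then show ?case using R by (intro exI[of _ "replicate (length Fs) (\<lambda>c. 0)"]) (auto simp: subring_def)
  next
    case (cons p G H)
    then obtain ps where ps: "H = lincomb ps Fs" "length ps = length Fs" "set ps \<subseteq> R" by blast
    obtain i where i: "i < length Fs" "G = Fs ! i" using cons(2) by (metis in_set_conv_nth)
    define ps' where "ps' = ps[i := (\<lambda>c. p c + (ps ! i) c)]"
    have "lincomb ps' Fs c = mat (p c) ** G c + H c" for c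
    proof -
      have "lincomb ps' Fs c = (\<Sum>j<length Fs. (if j = i then mat (p c) ** G c else 0) + mat ((ps ! j) c) ** (Fs ! j) c)"
        unfolding lincomb_def
      proof (rule sum.cong)
        fix j assume "j \<in> {..<length Fs}"
        then show "mat ((ps' ! j) c) ** (Fs ! j) c = (if j = i then mat (p c) ** G c else 0) + mat ((ps ! j) c) ** (Fs ! j) c"
          using i ps(2) by (cases "j = i") (simp_all add: ps'_def vec_eq_iff distrib_right)
      qed simp
      also have "\<dots> = mat (p c) ** G c + H c"
        using i(1) by (simp add: sum.distrib ps(1) lincomb_def)
      finally show ?thesis .
    qed
    moreover have "set ps' \<subseteq> R"
    proof -
      have "ps ! i \<in> R" using ps i by (metis nth_mem subsetD)
      then have "(\<lambda>c. p c + (ps ! i) c) \<in> R" using R cons(1) by (auto simp: subring_def)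
      then show ?thesis using set_update_subset_insert[of ps i] ps(3) unfolding ps'_def by blast
    qed
    ultimately show ?case using ps(2) by (intro exI[of _ ps']) (auto simp: ps'_def)
  qed
  then show "spanR R (set Fs) \<subseteq> {lincomb ps Fs | ps. length ps = length Fs \<and> set ps \<subseteq> R}" by blast
qed

lemma Pspan_Kspan: "Pspan (Kspan S) = Pspan S"
proof
  have "Kspan S \<subseteq> Pspan S"
    unfolding Pspan_eq Kspan_eq using Palg.const by (intro spanR_mono_ring) blast
  then show "Pspan (Kspan S) \<subseteq> Pspan S"
    unfolding Pspan_eq by (intro spanR_subset subring_Palg)
  have "S \<subseteq> Kspan S" unfolding Kspan_eq using spanR_base[OF subring_const] by blast
  then show "Pspan S \<subseteq> Pspan (Kspan S)"
    unfolding Pspan_eq by (intro spanR_subset subring_Palg) (auto intro: spanR_base[OF subring_Palg])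
qed

lemma Kspan_add: "F \<in> Kspan S \<Longrightarrow> H \<in> Kspan S \<Longrightarrow> (\<lambda>c. F c + H c) \<in> Kspan S"
  unfolding Kspan_eq by (rule spanR_add)

lemma Kspan_scale: "F \<in> Kspan S \<Longrightarrow> (\<lambda>c. mat a ** F c) \<in> Kspan S"
  unfolding Kspan_eq using spanR_scale[OF subring_const, of "\<lambda>c. a"] by blast

lemma Kspan_base: "F \<in> S \<Longrightarrow> F \<in> Kspan S"
  unfolding Kspan_eq by (rule spanR_base[OF subring_const])

lemma Kspan_zero: "(\<lambda>c. 0) \<in> Kspan S"
  unfolding Kspan_eq by (rule spanR_zero)

lemma Kspan_cong: "F \<in> Kspan S \<Longrightarrow> (\<And>c. F c = H c) \<Longrightarrow> H \<in> Kspan S"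
  by (metis ext)

section \<open>The \<open>GL\<^sub>3\<close>-modules generated by the covariants\<close>

definition tvl :: "'a::comm_ring_1^3^3 \<Rightarrow> 3 \<Rightarrow> 'a mmap" where
  "tvl g k c = mat (g$1$k) ** tv 1 c + mat (g$2$k) ** tv 2 c + mat (g$3$k) ** tv 3 c"

lemma tv_gl: "tv k (\<chi> k m. \<Sum>l\<in>UNIV. g $ l $ k * c $ l $ m) = tvl g k c"
  by (simp add: tv_def tvl_def skew_def vec_eq_iff forall_3 sum_3)

lemma gl_act_bilinear:
  "gl_act g (\<lambda>c. \<beta> (tv 1 c) (tv 2 c)) = (\<lambda>c. \<beta> (tvl g 1 c) (tvl g 2 c))"
  by (simp add: gl_act_def tv_gl)

text \<open>The columns are \<open>e\<^sub>i + s e\<^sub>j\<close>, \<open>e\<^sub>k\<close> and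
  \<open>e\<^sub>j\<close>, so for distinct indices the matrix is invertible and substitutes
  \<open>t\<^sub>i + s t\<^sub>j\<close> for \<open>t\<^sub>1\<close> and \<open>t\<^sub>k\<close>
  for \<open>t\<^sub>2\<close>. The case \<open>s = 0\<close> permutes the matrices, and
  \<open>s = 1\<close> serves for polarization.\<close>

definition shear :: "'a::comm_ring_1 \<Rightarrow> 3 \<Rightarrow> 3 \<Rightarrow> 3 \<Rightarrow> 'a^3^3" where
  "shear s i j k = (\<chi> l m. if m = 1 then (if l = i then 1 else if l = j then s else 0)
     else if m = 2 then (if l = k then 1 else 0) else (if l = j then 1 else 0))"

lemma invertible_shear:
  "distinct [i, j, k] \<Longrightarrow> invertible (shear s i j k :: 'a::field^3^3)"
  unfolding invertible_det_nz
  using exhaust_3[of i] exhaust_3[of j] exhaust_3[of k] by (auto simp: det_3 shear_def)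

lemma tvl_shear:
  "distinct [i, j, k] \<Longrightarrow> tvl (shear s i j k) 1 c = tv i c + mat s ** tv j c"
  "distinct [i, j, k] \<Longrightarrow> tvl (shear s i j k) 2 c = tv k c"
  using exhaust_3[of i] exhaust_3[of j] exhaust_3[of k]
  by (auto simp: tvl_def shear_def vec_eq_iff)

lemma GLmod_mem:
  fixes \<beta> :: "'a::field^3^3 \<Rightarrow> 'a^3^3 \<Rightarrow> 'a^3^3"
  assumes "distinct [i, j, k]"
  shows "(\<lambda>c. \<beta> (tv i c + mat s ** tv j c) (tv k c)) \<in> GLmod {\<lambda>c. \<beta> (tv 1 c) (tv 2 c)}"
proof -
  have "(\<lambda>c. \<beta> (tv i c + mat s ** tv j c) (tv k c)) = gl_act (shear s i j k) (\<lambda>c. \<beta> (tv 1 c) (tv 2 c))"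
    unfolding gl_act_bilinear tvl_shear[OF assms] ..
  then show ?thesis unfolding GLmod_def using invertible_shear[OF assms] by (intro Kspan_base) blast
qed

lemma GLmod_mem0:
  fixes \<beta> :: "'a::field^3^3 \<Rightarrow> 'a^3^3 \<Rightarrow> 'a^3^3"
  assumes "distinct [i, j, k]"
  shows "(\<lambda>c. \<beta> (tv i c) (tv k c)) \<in> GLmod {\<lambda>c. \<beta> (tv 1 c) (tv 2 c)}"
  using GLmod_mem[OF assms, of \<beta> 0] by simp

text \<open>Writing the generator as a function \<open>\<beta>\<close> of the first two matrices
  turns the action of \<open>g\<close> into insertion of \<open>tvl g 1\<close> and
  \<open>tvl g 2\<close>, so multilinear expansion applies.\<close>

lemma GLmod_eqI:
  fixes \<beta> :: "'a::field^3^3 \<Rightarrow> 'a^3^3 \<Rightarrow> 'a^3^3"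
  assumes "\<And>F. F \<in> set Fs \<Longrightarrow> F \<in> GLmod {\<lambda>c. \<beta> (tv 1 c) (tv 2 c)}"
    and "\<And>g. (\<lambda>c. \<beta> (tvl g 1 c) (tvl g 2 c)) \<in> Kspan (set Fs)"
  shows "GLmod {\<lambda>c. \<beta> (tv 1 c) (tv 2 c)} = Kspan (set Fs)"
proof
  show "GLmod {\<lambda>c. \<beta> (tv 1 c) (tv 2 c)} \<subseteq> Kspan (set Fs)"
    unfolding GLmod_def Kspan_eq
  proof (rule spanR_subset[OF subring_const], safe)
    show "gl_act g (\<lambda>c. \<beta> (tv 1 c) (tv 2 c)) \<in> spanR (range (\<lambda>a c. a)) (set Fs)" for g
      using assms(2)[of g] unfolding gl_act_bilinear Kspan_eq .
  qed
  have "set Fs \<subseteq> spanR (range (\<lambda>a c. a)) {gl_act g u |g u. invertible g \<and> u \<in> {\<lambda>c. \<beta> (tv 1 c) (tv 2 c)}}"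
    using assms(1) unfolding GLmod_def Kspan_eq by blast
  then show "Kspan (set Fs) \<subseteq> GLmod {\<lambda>c. \<beta> (tv 1 c) (tv 2 c)}"
    unfolding GLmod_def Kspan_eq by (rule spanR_subset[OF subring_const])
qed

definition linear_map :: "('a::comm_ring_1^3^3 \<Rightarrow> 'a^3^3) \<Rightarrow> bool" where
  "linear_map \<beta> \<longleftrightarrow> (\<forall>A B. \<beta> (A + B) = \<beta> A + \<beta> B) \<and> (\<forall>x A. \<beta> (mat x ** A) = mat x ** \<beta> A)"

lemma linear_tvl:
  "linear_map \<beta> \<Longrightarrow> \<beta> (tvl g k c) = mat (g$1$k) ** \<beta> (tv 1 c) + mat (g$2$k) ** \<beta> (tv 2 c) + mat (g$3$k) ** \<beta> (tv 3 c)"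
  by (simp add: linear_map_def tvl_def)

lemma matrix_diff_mat: "mat x ** (A - B) = mat x ** A - mat x ** B" for A :: "'a::comm_ring_1^3^3"
  by (simp add: vec_eq_iff right_diff_distrib)

lemma comm_linear: "linear_map (\<lambda>A. comm A B)" "linear_map (comm B)"
proof -
  have "comm (A + A') B = comm A B + comm A' B" "comm B (A + A') = comm B A + comm B A'" for A A'
    unfolding comm_def matrix_add_ldistrib matrix_add_rdistrib3 by simp_all
  moreover have "comm (mat x ** A) B = mat x ** comm A B" "comm B (mat x ** A) = mat x ** comm B A" for x A
    unfolding comm_def matrix_diff_mat mult_mat_left by (simp_all only: matrix_mul_assoc)
  ultimately show "linear_map (\<lambda>A. comm A B)" "linear_map (comm B)"
    unfolding linear_map_def by blast+
qed

definition anticomm :: "'a::comm_ring_1^3^3 \<Rightarrow> 'a^3^3 \<Rightarrow> 'a^3^3" where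
  "anticomm A B = A ** B + B ** A"

lemma anticomm_linear: "linear_map (\<lambda>A. anticomm A B)" "linear_map (anticomm B)"
proof -
  have "anticomm (A + A') B = anticomm A B + anticomm A' B" "anticomm B (A + A') = anticomm B A + anticomm B A'" for A A'
    unfolding anticomm_def matrix_add_ldistrib matrix_add_rdistrib3 by simp_all
  moreover have "anticomm (mat x ** A) B = mat x ** anticomm A B" "anticomm B (mat x ** A) = mat x ** anticomm B A" for x A
    unfolding anticomm_def matrix_add_ldistrib mult_mat_left by (simp_all only: matrix_mul_assoc)
  ultimately show "linear_map (\<lambda>A. anticomm A B)" "linear_map (anticomm B)"
    unfolding linear_map_def by blast+
qed

lemma anticomm_commute: "anticomm A B = anticomm B A"
  by (simp add: anticomm_def add.commute)

lemma linear_map_compose: "linear_map \<alpha> \<Longrightarrow> linear_map \<beta> \<Longrightarrow> linear_map (\<lambda>A. \<alpha> (\<beta> A))"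
  by (simp add: linear_map_def)

text \<open>The polarization of \<open>A\<^sup>2 - tr (A\<^sup>2) I / 3\<close>; its bilinearity is
  what expands the transforms of the generator.\<close>

definition symtf :: "'a::field_char_0^3^3 \<Rightarrow> 'a^3^3 \<Rightarrow> 'a^3^3" where
  "symtf A B = mat (1/2) ** anticomm A B - mat (1/3 * trace (A ** B))"

lemma symtf_commute: "symtf A B = symtf B A"
  unfolding symtf_def anticomm_commute[of A B] trace_mul_sym[of A B] ..

lemma symtf_linear: "linear_map (symtf B)"
proof -
  have a: "anticomm B (A + A') = anticomm B A + anticomm B A'" "anticomm B (mat x ** A) = mat x ** anticomm B A" for A A' x
    using anticomm_linear(2)[of B] unfolding linear_map_def by blast+
  have mat_add: "(mat (x + y) :: 'a^3^3) = mat x + mat y" for x y by (simp add: vec_eq_iff mat_def)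
  have "symtf B (A + A') = symtf B A + symtf B A'" for A A'
    unfolding symtf_def a matrix_add_ldistrib trace_add distrib_left mat_add by (rule add_diff_add)
  moreover have "symtf B (mat x ** A) = mat x ** symtf B A" for x A
    unfolding symtf_def a mult_mat_left[of B] trace_mat_mult
    by (simp only: matrix_diff_mat mat_mult_mat mult.left_commute[of "1/3" x] mult_mat_left[of "mat (1/2)" x])
  ultimately show ?thesis by (simp add: linear_map_def)
qed

definition L2 :: "'a::comm_ring_1 mmap list" where
  "L2 = [tv 1, tv 2, tv 3]"

definition L3 :: "'a::comm_ring_1 mmap list" where
  "L3 = [\<lambda>c. comm (tv 1 c) (tv 2 c), \<lambda>c. comm (tv 1 c) (tv 3 c), \<lambda>c. comm (tv 2 c) (tv 3 c)]"

lemma GLmod_tv: "GLmod {tv 1} = Kspan (set (L2 :: 'a::field mmap list))"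
proof (rule GLmod_eqI[where \<beta> = "\<lambda>A B. A"])
  fix F :: "'a mmap" assume "F \<in> set L2"
  then show "F \<in> GLmod {tv 1}"
    using GLmod_mem0[of 1 3 2 "\<lambda>A B. A"] GLmod_mem0[of 2 3 1 "\<lambda>A B. A"] GLmod_mem0[of 3 2 1 "\<lambda>A B. A"]
    by (auto simp: L2_def)
next
  fix g :: "'a^3^3"
  show "tvl g 1 \<in> Kspan (set L2)"
  proof (rule Kspan_cong)
    show "(\<lambda>c. mat (g$1$1) ** tv 1 c + mat (g$2$1) ** tv 2 c + mat (g$3$1) ** tv 3 c) \<in> Kspan (set L2)"
      by (intro Kspan_add Kspan_scale Kspan_base) (simp_all add: L2_def)
  qed (simp add: tvl_def)
qed

lemma GLmod_comm: "GLmod {\<lambda>c. comm (tv 1 c) (tv 2 c)} = Kspan (set (L3 :: 'a::field mmap list))"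
proof (rule GLmod_eqI)
  fix F :: "'a mmap" assume "F \<in> set L3"
  then show "F \<in> GLmod {\<lambda>c. comm (tv 1 c) (tv 2 c)}"
    using GLmod_mem0[of 1 3 2 comm] GLmod_mem0[of 1 2 3 comm] GLmod_mem0[of 2 1 3 comm]
    by (auto simp: L3_def)
next
  fix g :: "'a^3^3"
  have up: "(\<lambda>c. comm (tv i c) (tv j c)) \<in> Kspan (set (L3 :: 'a mmap list))"
    if "(i, j) \<in> {(1, 2), (1, 3), (2, 3)}" for i j
    by (rule Kspan_base) (use that in \<open>auto simp: L3_def\<close>)
  have down: "(\<lambda>c. comm (tv j c) (tv i c)) \<in> Kspan (set (L3 :: 'a mmap list))"
    if "(i, j) \<in> {(1, 2), (1, 3), (2, 3)}" for i j
    by (rule Kspan_cong[OF Kspan_scale[OF up[OF that], of "-1"]]) (simp add: vec_eq_iff comm_def)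
  have same: "(\<lambda>c. comm (tv i c) (tv i c)) \<in> Kspan (set (L3 :: 'a mmap list))" for i
    by (rule Kspan_cong[OF Kspan_zero]) (simp add: comm_def)
  have all: "(\<lambda>c. comm (tv i c) (tv j c)) \<in> Kspan (set (L3 :: 'a mmap list))" for i j
    using exhaust_3[of i] exhaust_3[of j] up[of i j] down[of j i] same[of i] by auto
  show "(\<lambda>c. comm (tvl g 1 c) (tvl g 2 c)) \<in> Kspan (set L3)"
    unfolding linear_tvl[OF comm_linear(1)] linear_tvl[OF comm_linear(2)]
    by (intro Kspan_add Kspan_scale all)
qed

lemma fsym_symtf: "fsym i j = (\<lambda>c. symtf (tv i c) (tv j c))"
  by (simp add: fsym_def symtf_def anticomm_def trP_def)

lemma g33_0_symtf: "g33_0 = (\<lambda>c. symtf (tv 1 c) (tv 1 c))"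
  by (rule ext) (simp add: g33_0_def symtf_def anticomm_def trP_def vec_eq_iff)

text \<open>Polarization yields the mixed covariants: half of the value at
  \<open>t\<^sub>i + t\<^sub>j\<close> minus the values at \<open>t\<^sub>i\<close> and
  \<open>t\<^sub>j\<close>. Conversely, bilinearity expands every transform in the six of
  them.\<close>

lemma GLmod_fsym: "GLmod {g33_0} = Kspan (set (F0 :: 'a::field_char_0 mmap list))"
  unfolding g33_0_symtf
proof (rule GLmod_eqI[where \<beta> = "\<lambda>A B. symtf A A"])
  let ?M = "GLmod {\<lambda>c :: 'a pt. symtf (tv 1 c) (tv 1 c)}"
  have dg: "(\<lambda>c. symtf (tv i c) (tv i c)) \<in> ?M" if "distinct [i, j, k]" for i j k
    using GLmod_mem0[OF that, of "\<lambda>A B. symtf A A"] .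
  have od: "(\<lambda>c. symtf (tv i c) (tv j c)) \<in> ?M" if d: "distinct [i, j, k]" for i j k
  proof -
    have s: "(\<lambda>c. symtf (tv i c + mat 1 ** tv j c) (tv i c + mat 1 ** tv j c)) \<in> ?M"
      using GLmod_mem[OF d, of "\<lambda>A B. symtf A A" 1] .
    have d': "distinct [j, i, k]" using d by auto
    show ?thesis
      unfolding GLmod_def
    proof (rule Kspan_cong)
      show "(\<lambda>c. mat (1/2) ** (symtf (tv i c + mat 1 ** tv j c) (tv i c + mat 1 ** tv j c)
          + (mat (-1) ** symtf (tv i c) (tv i c) + mat (-1) ** symtf (tv j c) (tv j c))))
        \<in> Kspan {gl_act g u |g u. invertible g \<and> u \<in> {\<lambda>c :: 'a pt. symtf (tv 1 c) (tv 1 c)}}"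
        unfolding GLmod_def[symmetric] using s dg[OF d] dg[OF d'] unfolding GLmod_def
        by (intro Kspan_scale Kspan_add)
      fix c :: "'a pt"
      have "symtf (A + B) (A + B) = symtf A A + symtf B B + mat 2 ** symtf A B" for A B :: "'a^3^3"
      proof -
        have "symtf (A + B) (A + B) = symtf (A + B) A + symtf (A + B) B"
          using symtf_linear[of "A + B"] by (simp add: linear_map_def)
        moreover have "symtf (A + B) C = symtf A C + symtf B C" for C
          using symtf_linear[of C] by (simp add: linear_map_def symtf_commute[of _ C])
        ultimately show ?thesis by (simp add: symtf_commute[of B A] vec_eq_iff)
      qed
      from this[of "tv i c" "tv j c"]
      show "mat (1/2) ** (symtf (tv i c + mat 1 ** tv j c) (tv i c + mat 1 ** tv j c)
          + (mat (-1) ** symtf (tv i c) (tv i c) + mat (-1) ** symtf (tv j c) (tv j c))) = symtf (tv i c) (tv j c)"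
        by (simp add: vec_eq_iff)
    qed
  qed
  show "F \<in> ?M" if "F \<in> set F0" for F
    using that dg[of 1 2 3] dg[of 2 1 3] dg[of 3 1 2] od[of 1 2 3] od[of 1 3 2] od[of 2 3 1]
    by (auto simp: F0_def fsym_symtf)
  fix g :: "'a^3^3"
  have up: "(\<lambda>c. symtf (tv i c) (tv j c)) \<in> Kspan (set (F0 :: 'a mmap list))"
    if "(i, j) \<in> {(1, 1), (2, 2), (3, 3), (1, 2), (1, 3), (2, 3)}" for i j
    by (rule Kspan_base) (use that in \<open>auto simp: F0_def fsym_symtf\<close>)
  have all: "(\<lambda>c. symtf (tv i c) (tv j c)) \<in> Kspan (set (F0 :: 'a mmap list))" for i j
  proof -
    have "(\<lambda>c. symtf (tv j c) (tv i c)) = (\<lambda>c :: 'a pt. symtf (tv i c) (tv j c))"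
      by (simp add: symtf_commute)
    then show ?thesis using exhaust_3[of i] exhaust_3[of j] up[of i j] up[of j i] by auto
  qed
  have lin1: "symtf (tvl g 1 c) B = mat (g$1$1) ** symtf (tv 1 c) B + mat (g$2$1) ** symtf (tv 2 c) B + mat (g$3$1) ** symtf (tv 3 c) B" for c B
    using linear_tvl[OF symtf_linear[of B], of g 1 c] unfolding symtf_commute[of B] .
  show "(\<lambda>c. symtf (tvl g 1 c) (tvl g 1 c)) \<in> Kspan (set F0)"
    unfolding lin1 unfolding linear_tvl[OF symtf_linear]
    by (intro Kspan_add Kspan_scale all)
qed

lemma anticomm_self: "anticomm A A = mat 2 ** (A ** A)"
  by (simp add: anticomm_def vec_eq_iff)

lemma fijk_anticomm: "fijk i j k = (\<lambda>c. comm (anticomm (tv i c) (tv j c)) (tv k c))"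
  by (simp add: fijk_def anticomm_def)

lemma fiij_anticomm: "fiij i k = (\<lambda>c. mat (1/2 :: 'a) ** comm (anticomm (tv i c) (tv i c)) (tv k (c :: 'a::field_char_0 pt)))"
proof (rule ext)
  fix c :: "'a pt"
  have "comm (mat 2 ** M) N = mat 2 ** comm M N" for M N :: "'a^3^3"
    using comm_linear(1)[of N] by (simp add: linear_map_def)
  then show "fiij i k c = mat (1/2 :: 'a) ** comm (anticomm (tv i c) (tv i c)) (tv k c)"
    by (simp add: fiij_def anticomm_self vec_eq_iff)
qed

text \<open>Polarization reaches the covariants with three distinct indices. Conversely, a transform
  expands trilinearly into the maps \<open>?h i j k\<close>, and coincidences of indices together
  with a cyclic identity bring these down to the eight listed ones.\<close>

lemma GLmod_fijk: "GLmod {g33_1} = Kspan (set (F1 :: 'a::field_char_0 mmap list))"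
  unfolding g33_1_def
proof (rule GLmod_eqI[where \<beta> = "\<lambda>A B. comm (A ** A) B"])
  let ?M = "GLmod {\<lambda>c :: 'a pt. comm (tv 1 c ** tv 1 c) (tv 2 c)}"
  have dg: "fiij i k \<in> ?M" if "distinct [i, j, k]" for i j k
    using GLmod_mem0[OF that, of "\<lambda>A B. comm (A ** A) B"] by (simp add: fiij_def)
  have od: "fijk i j k \<in> ?M" if d: "distinct [i, j, k]" for i j k
  proof -
    have s: "(\<lambda>c. comm ((tv i c + mat 1 ** tv j c) ** (tv i c + mat 1 ** tv j c)) (tv k c)) \<in> ?M"
      using GLmod_mem[OF d, of "\<lambda>A B. comm (A ** A) B" 1] .
    have d': "distinct [j, i, k]" using d by auto
    show ?thesis
      unfolding GLmod_def
    proof (rule Kspan_cong)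
      show "(\<lambda>c. comm ((tv i c + mat 1 ** tv j c) ** (tv i c + mat 1 ** tv j c)) (tv k c)
          + (mat (-1) ** fiij i k c + mat (-1) ** fiij j k c))
        \<in> Kspan {gl_act g u |g u. invertible g \<and> u \<in> {\<lambda>c :: 'a pt. comm (tv 1 c ** tv 1 c) (tv 2 c)}}"
        using s dg[OF d] dg[OF d'] unfolding GLmod_def by (intro Kspan_scale Kspan_add)
      fix c :: "'a pt"
      have "comm ((A + B) ** (A + B)) C + (mat (-1) ** comm (A ** A) C + mat (-1) ** comm (B ** B) C) = comm (A ** B + B ** A) C"
        for A B C :: "'a^3^3"
      proof -
        have e: "(A + B) ** (A + B) = A ** A + B ** B + (A ** B + B ** A)"
          by (simp add: matrix_add_ldistrib matrix_add_rdistrib3 add_ac)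
        have l: "comm (X + Y) C = comm X C + comm Y C" for X Y
          using comm_linear(1)[of C] by (simp add: linear_map_def)
        show ?thesis unfolding e by (simp only: l) (simp add: vec_eq_iff)
      qed
      from this[of "tv i c" "tv j c" "tv k c"]
      show "comm ((tv i c + mat 1 ** tv j c) ** (tv i c + mat 1 ** tv j c)) (tv k c)
          + (mat (-1) ** fiij i k c + mat (-1) ** fiij j k c) = fijk i j k c"
        by (simp add: fiij_def fijk_def)
    qed
  qed
  show "F \<in> ?M" if "F \<in> set F1" for F
    using that dg[of 1 3 2] dg[of 2 3 1] dg[of 1 2 3] dg[of 3 2 1] dg[of 2 1 3] dg[of 3 1 2] od[of 1 3 2] od[of 1 2 3]
    by (auto simp: F1_def)
  fix g :: "'a^3^3"
  let ?K = "Kspan (set (F1 :: 'a mmap list))"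
  let ?h = "\<lambda>i j k c :: 'a pt. comm (anticomm (tv i c) (tv j c)) (tv k c)"
  have iik: "?h i i k \<in> ?K" for i k
  proof (cases "i = k")
    case True
    show ?thesis by (rule Kspan_cong[OF Kspan_zero]) (simp only: True comm_def anticomm_def matrix_add_ldistrib matrix_add_rdistrib3 matrix_mul_assoc diff_self)
  next
    case False
    have "fiij i k \<in> ?K" using False exhaust_3[of i] exhaust_3[of k] by (intro Kspan_base) (auto simp: F1_def)
    from Kspan_scale[OF this, of 2] show ?thesis by (rule Kspan_cong) (simp add: fiij_anticomm vec_eq_iff)
  qed
  \<comment> \<open>\<open>[A B + B A, A] = - [A\<^sup>2, B]\<close>, and
    \<open>anticomm A A\<close> is \<open>2 A\<^sup>2\<close>, whence the factor -1/2.\<close>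
  have iji: "?h i j i \<in> ?K" for i j
    by (rule Kspan_cong[OF Kspan_scale[OF iik[of i j], of "-1/2"]])
      (simp only: comm_def anticomm_def matrix_add_ldistrib matrix_add_rdistrib3 matrix_mul_assoc
        vec_eq_iff vector_add_component vector_minus_component mat_mult_nth, simp add: diff_divide_distrib)
  have jii: "?h j i i \<in> ?K" for i j
    by (rule Kspan_cong[OF iji[of i j]]) (simp add: anticomm_commute)
  have h132: "?h 1 3 2 \<in> ?K" and h123: "?h 1 2 3 \<in> ?K"
    by (rule Kspan_base, simp add: F1_def fijk_anticomm)+
  \<comment> \<open>The commutators \<open>[A B + B A, C]\<close> summed over the cyclic
    permutations of \<open>A\<close>, \<open>B\<close>, \<open>C\<close> give zero.\<close>
  have h231: "?h 2 3 1 \<in> ?K"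
    by (rule Kspan_cong[OF Kspan_add[OF Kspan_scale[OF h132, of "-1"] Kspan_scale[OF h123, of "-1"]]])
      (simp only: comm_def anticomm_def matrix_add_ldistrib matrix_add_rdistrib3 matrix_mul_assoc
        vec_eq_iff vector_add_component vector_minus_component mat_mult_nth, simp)
  have all: "?h i j k \<in> ?K" for i j k
  proof -
    have c: "?h j i k = ?h i j k" by (simp add: anticomm_commute)
    consider "i = j" | "i = k" | "j = k" | "(i, j, k) \<in> {(1, 3, 2), (1, 2, 3), (2, 3, 1), (3, 1, 2), (2, 1, 3), (3, 2, 1)}"
      using exhaust_3[of i] exhaust_3[of j] exhaust_3[of k] by auto
    then show ?thesis
      by cases (use iik iji jii h132 h123 h231 c in auto)
  qed
  have l1: "comm (anticomm (tvl g 1 c) B) C = mat (g$1$1) ** comm (anticomm (tv 1 c) B) C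
      + mat (g$2$1) ** comm (anticomm (tv 2 c) B) C + mat (g$3$1) ** comm (anticomm (tv 3 c) B) C" for c B C
    using linear_tvl[OF linear_map_compose[OF comm_linear(1)[of C] anticomm_linear(1)[of B]]] .
  have l2: "comm (anticomm B (tvl g 1 c)) C = mat (g$1$1) ** comm (anticomm B (tv 1 c)) C
      + mat (g$2$1) ** comm (anticomm B (tv 2 c)) C + mat (g$3$1) ** comm (anticomm B (tv 3 c)) C" for c B C
    using linear_tvl[OF linear_map_compose[OF comm_linear(1)[of C] anticomm_linear(2)[of B]]] .
  have "(\<lambda>c. mat (1/2) ** comm (anticomm (tvl g 1 c) (tvl g 1 c)) (tvl g 2 c)) \<in> ?K"
    unfolding l1 unfolding l2 unfolding linear_tvl[OF comm_linear(2)]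
    by (intro Kspan_add Kspan_scale all)
  then show "(\<lambda>c. comm (tvl g 1 c ** tvl g 1 c) (tvl g 2 c)) \<in> ?K"
  proof (rule Kspan_cong)
    have "comm (mat 2 ** M) N = mat 2 ** comm M N" for M N :: "'a^3^3"
      using comm_linear(1)[of N] by (simp add: linear_map_def)
    then show "mat (1/2) ** comm (anticomm (tvl g 1 c) (tvl g 1 c)) (tvl g 2 c) = comm (tvl g 1 c ** tvl g 1 c) (tvl g 2 c)" for c
      by (simp add: anticomm_self vec_eq_iff)
  qed
qed

section \<open>The module of equivariant maps\<close>

lemma mmult_nth: "(A ** B) $ i $ j = A$i$1 * B$1$j + A$i$2 * B$2$j + A$i$3 * B$3$j" for A :: "'a::comm_ring_1^3^3"
  by (simp add: matrix_matrix_mult_def sum_3)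

lemma mat_nth: "(mat x :: 'a::comm_ring_1^3^3) $ i $ j = (if i = j then x else 0)"
  by (simp add: mat_def)

lemma transpose_nth: "transpose A $ i $ j = A $ j $ i"
  by (simp add: transpose_def)

lemma mat_minus1: "mat (-1) ** M = - M" for M :: "'a::comm_ring_1^3^3"
  by (simp add: vec_eq_iff)

lemma neg_mult: "(- A) ** B = - (A ** B)" "A ** (- B) = - (A ** B)" for A :: "'a::comm_ring_1^3^3"
  by (simp_all add: vec_eq_iff mmult_nth algebra_simps)

lemma transpose_diff: "transpose (A - B) = transpose A - transpose B" for A :: "'a::comm_ring_1^3^3"
  by (simp add: vec_eq_iff transpose_nth)

lemma trace_mat: "trace (mat x :: 'a::comm_ring_1^3^3) = 3 * x"
  by (simp add: trace_def sum_3 mat_nth)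

lemma so_act_neg: "so_act g (- c) = - so_act g c" for g :: "'a::comm_ring_1^3^3"
  by (simp add: so_act_def unskew_def skew_def vec_eq_iff forall_3 mmult_nth transpose_nth algebra_simps)

lemma E3_iff: "F \<in> E3 \<longleftrightarrow> mpoly F \<and> (\<forall>g\<in>SO3. \<forall>c. F (so_act g c) = g ** F c ** transpose g)"
  by (simp add: E3_def mpoly_def)

lemma E3_add: "F \<in> E3 \<Longrightarrow> H \<in> E3 \<Longrightarrow> (\<lambda>c. F c + H c) \<in> E3"
  by (simp add: E3_iff mpoly_add matrix_add_ldistrib matrix_add_rdistrib3)

lemma E3_mult: "F \<in> E3 \<Longrightarrow> H \<in> E3 \<Longrightarrow> (\<lambda>c. F c ** H c) \<in> E3"
proof -
  assume F: "F \<in> E3" and H: "H \<in> E3"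
  have "(g ** A ** transpose g) ** (g ** B ** transpose g) = g ** (A ** B) ** transpose g"
    if "g \<in> SO3" for g A B :: "'a^3^3"
  proof -
    have "(g ** A ** transpose g) ** (g ** B ** transpose g) = g ** A ** (transpose g ** g) ** B ** transpose g"
      by (simp only: matrix_mul_assoc)
    also have "\<dots> = g ** (A ** B) ** transpose g"
      using that by (simp add: SO3_def matrix_mul_assoc)
    finally show ?thesis .
  qed
  then show ?thesis using F H by (simp add: E3_iff mpoly_mult)
qed

lemma E3_transpose: "F \<in> E3 \<Longrightarrow> (\<lambda>c. transpose (F c)) \<in> E3"
  by (simp add: E3_iff mpoly_transpose matrix_transpose_mul transpose_transpose matrix_mul_assoc)

lemma is_poly_neg_arg: "is_poly f \<Longrightarrow> is_poly (\<lambda>c. f (- c))"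
proof (induction rule: is_poly.induct)
  case (coord k m)
  show ?case using is_poly_uminus[OF is_poly.coord[of k m]] by simp
qed (simp_all add: is_poly.const is_poly.add is_poly.mult)

lemma E3_neg_arg: "F \<in> E3 \<Longrightarrow> (\<lambda>c. F (- c)) \<in> E3"
  using is_poly_neg_arg[of "\<lambda>c. F c $ i $ j" for i j] by (simp add: E3_iff mpoly_def flip: so_act_neg)

lemma E3_mat:
  fixes f :: "'a::field_char_0 pt \<Rightarrow> 'a"
  assumes "f \<in> Inv3"
  shows "(\<lambda>c. mat (f c)) \<in> E3"
proof -
  have "g ** mat x ** transpose g = mat x" if "g \<in> SO3" for g :: "'a^3^3" and x
    unfolding mult_mat[of g] using SO3_right[OF that] by (simp flip: matrix_mul_assoc)
  then show ?thesis using assms by (auto simp: E3_iff Inv3_def mpoly_mat)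
qed

lemma Palg_Inv3: "f \<in> Palg \<Longrightarrow> f \<in> Inv3" for f :: "'a::field_char_0 pt \<Rightarrow> 'a"
proof -
  assume f: "f \<in> Palg"
  then have "\<exists>p. pol p \<and> f = (\<lambda>c. p (gam c))" by (simp only: Palg_iff)
  then have "\<And>h c. h \<in> SO3 \<Longrightarrow> f (rot h c) = f c" by (auto simp: gam_rot)
  then show ?thesis using Palg_is_poly[OF f] by (simp add: Inv3_iff)
qed

lemma gp_neg: "gp i j (- c) = gp i j c"
  by (simp add: gp_def)

lemma Palg_even: "f \<in> Palg \<Longrightarrow> f (- c) = f c" for f :: "'a::field_char_0 pt \<Rightarrow> 'a"
proof -
  assume "f \<in> Palg"
  then have "\<exists>p. pol p \<and> f = (\<lambda>c. p (gam c))" by (simp only: Palg_iff)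
  moreover have "gam (- c) = gam c" by (rule ext, rename_tac i, case_tac i) (simp_all add: gp_neg)
  ultimately show ?thesis by auto
qed

lemma det_Inv3: "det \<in> (Inv3 :: ('a::field_char_0 pt \<Rightarrow> 'a) set)"
  by (simp add: Inv3_iff is_poly_det det_rot)

lemma Inv3_mult: "f \<in> Inv3 \<Longrightarrow> g \<in> Inv3 \<Longrightarrow> (\<lambda>c. f c * g c) \<in> Inv3"
  by (simp add: Inv3_def is_poly.mult)

lemma Inv3_add: "f \<in> Inv3 \<Longrightarrow> g \<in> Inv3 \<Longrightarrow> (\<lambda>c. f c + g c) \<in> Inv3"
  by (simp add: Inv3_def is_poly.add)

lemma Inv3_const: "(\<lambda>c. a) \<in> Inv3"
  by (simp add: Inv3_def is_poly.const)

lemma E3_scale: "f \<in> Inv3 \<Longrightarrow> F \<in> E3 \<Longrightarrow> (\<lambda>c. mat (f c) ** F c) \<in> E3" for F :: "'a::field_char_0 mmap"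
  by (rule E3_mult[OF E3_mat])

lemma E3_cscale: "F \<in> E3 \<Longrightarrow> (\<lambda>c. mat a ** F c) \<in> E3" for F :: "'a::field_char_0 mmap"
  using E3_scale[OF Inv3_const] .

lemma E3_diff: "F \<in> E3 \<Longrightarrow> H \<in> E3 \<Longrightarrow> (\<lambda>c. F c - H c) \<in> E3" for F :: "'a::field_char_0 mmap"
  using E3_add[OF _ E3_cscale[of H "-1"], of F] by (simp add: mat_minus1)

lemma transpose_skew: "transpose (skew v) = - skew v" for v :: "'a::comm_ring_1^3"
  by (simp add: skew_def vec_eq_iff forall_3 transpose_nth)

lemma skew_unskew:
  fixes M :: "'a::field_char_0^3^3"
  assumes "transpose M = - M"
  shows "skew (unskew M) = M"
proof -
  have M: "M $ j $ i = - (M $ i $ j)" for i j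
    using arg_cong[OF assms, of "\<lambda>M. M $ i $ j"] by (simp add: transpose_nth)
  have d: "M $ i $ i = 0" for i
  proof -
    have "2 * M $ i $ i = 0" using M[of i i] by (simp add: eq_neg_iff_add_eq_0)
    then show ?thesis by simp
  qed
  show ?thesis using M[of 2 1] M[of 3 1] M[of 3 2] by (simp add: vec_eq_iff forall_3 skew_def unskew_def d)
qed

lemma E3_tv: "tv k \<in> (E3 :: 'a::field_char_0 mmap set)"
proof -
  have "is_poly (\<lambda>c :: 'a pt. tv k c $ i $ j)" for i j
    using exhaust_3[of i] exhaust_3[of j]
    by (elim disjE) (simp_all add: tv_def skew_def is_poly.coord is_poly.const is_poly_uminus)
  moreover have "tv k (so_act g c) = g ** tv k c ** transpose g" for g and c :: "'a pt"
  proof -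
    have "transpose (g ** skew (c $ k) ** transpose g) = - (g ** skew (c $ k) ** transpose g)"
      by (simp add: matrix_transpose_mul transpose_skew neg_mult transpose_transpose matrix_mul_assoc)
    then show ?thesis by (simp add: tv_def so_act_def skew_unskew)
  qed
  ultimately show ?thesis by (simp add: E3_iff mpoly_def)
qed

lemma E3_comm: "F \<in> E3 \<Longrightarrow> H \<in> E3 \<Longrightarrow> (\<lambda>c. comm (F c) (H c)) \<in> E3" for F :: "'a::field_char_0 mmap"
  unfolding comm_def by (intro E3_diff E3_mult)

subsection \<open>Types of covariants\<close>

text \<open>\<open>e\<close> is the sign under \<open>c \<mapsto> - c\<close> and \<open>s\<close>
  the sign under transposition. The four sign pairs tell the four non-scalar summands apart.\<close>

definition cov :: "'a \<Rightarrow> 'a \<Rightarrow> 'a::field_char_0 mmap \<Rightarrow> bool" where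
  "cov e s F \<longleftrightarrow> F \<in> E3 \<and> (\<forall>c. F (- c) = mat e ** F c \<and> transpose (F c) = mat s ** F c \<and> trace (F c) = 0)"

text \<open>Coefficients from \<open>Palg\<close> are even invariant scalars, so they alter neither
  sign and preserve vanishing traces.\<close>

lemma cov_span:
  assumes "\<And>G. G \<in> S \<Longrightarrow> cov e s G" and "F \<in> Pspan S"
  shows "cov e s F"
  using assms(2) unfolding Pspan_eq
proof (induction rule: spanR_induct)
  case zero
  have "(\<lambda>c. mat ((\<lambda>c. 0) c)) \<in> (E3 :: 'a mmap set)" by (rule E3_mat[OF Inv3_const])
  then show ?case by (simp add: cov_def trace_def transpose_def vec_eq_iff)
next
  case (cons p G H)
  have G: "cov e s G" by (rule assms(1)[OF cons(2)])
  have "(\<lambda>c. mat (p c) ** G c + H c) \<in> E3"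
    using G cons by (intro E3_add E3_scale Palg_Inv3) (simp_all add: cov_def)
  moreover have "mat x ** (mat y ** A) = mat y ** (mat x ** A)" for x y and A :: "'a^3^3"
    by (rule mult_mat_left)
  ultimately show ?case using G cons.IH cons.hyps
    by (simp add: cov_def Palg_even transpose_add transpose_mat_mult matrix_add_ldistrib trace_add trace_mat_mult)
qed

lemma tv_neg: "tv k (- c) = - tv k c" for c :: "'a::comm_ring_1 pt"
  by (simp add: tv_def skew_def vec_eq_iff forall_3)

lemma transpose_tv: "transpose (tv k c) = - tv k c" for c :: "'a::comm_ring_1 pt"
  by (simp add: tv_def transpose_skew)

lemma trace_comm: "trace (comm A B) = 0" for A :: "'a::comm_ring_1^3^3"
  unfolding comm_def trace_sub trace_mul_sym[of A B] by simp

lemma cov_tv: "cov (-1) (-1) (tv k)"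
  by (simp add: cov_def E3_tv tv_neg transpose_tv mat_minus1)
    (simp add: trace_def sum_3 tv_def skew_def)

lemma cov_comm: "cov 1 (-1) (\<lambda>c. comm (tv i c) (tv j c))"
  by (simp add: cov_def E3_comm E3_tv mat_minus1 trace_comm)
    (simp add: comm_def tv_neg neg_mult transpose_diff matrix_transpose_mul transpose_tv)

lemma trP_even: "trP i j (- c) = trP i j c"
  by (simp add: trP_eq gp_neg)

lemma gp_Inv3: "gp i j \<in> (Inv3 :: ('a::field_char_0 pt \<Rightarrow> 'a) set)"
  by (rule Palg_Inv3[OF gp_Palg])

lemma trP_Inv3: "(\<lambda>c. a * trP i j c) \<in> (Inv3 :: ('a::field_char_0 pt \<Rightarrow> 'a) set)"
  unfolding trP_eq by (intro Inv3_mult Inv3_const gp_Inv3)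

lemma cov_fsym: "cov 1 1 (fsym i j)"
proof -
  have "fsym i j \<in> (E3 :: 'a mmap set)"
    unfolding fsym_def by (intro E3_diff E3_cscale E3_add E3_mult E3_tv E3_mat trP_Inv3)
  moreover have "fsym i j (- c) = fsym i j c" for c :: "'a pt"
    by (simp add: fsym_def tv_neg neg_mult trP_even)
  moreover have "transpose (fsym i j c) = fsym i j c" for c :: "'a pt"
    by (simp add: fsym_def transpose_diff transpose_mat_mult transpose_add matrix_transpose_mul transpose_tv neg_mult transpose_mat add.commute)
      (rule mult_mat)
  moreover have "trace (fsym i j c) = 0" for c :: "'a pt"
    by (simp add: fsym_def trace_sub trace_mat_mult trace_add trace_mat trP_def trace_mul_sym[of "tv j c" "tv i c"])
  ultimately show ?thesis by (simp add: cov_def)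
qed

lemma cov_fijk: "cov (-1) 1 (fijk i j k)"
proof -
  have "fijk i j k \<in> (E3 :: 'a mmap set)"
    unfolding fijk_def by (intro E3_comm E3_add E3_mult E3_tv)
  moreover have "fijk i j k (- c) = - fijk i j k c" for c :: "'a pt"
    by (simp add: fijk_def comm_def tv_neg neg_mult)
  moreover have "transpose (fijk i j k c) = fijk i j k c" for c :: "'a pt"
    by (simp add: fijk_def comm_def transpose_diff transpose_add matrix_transpose_mul transpose_tv neg_mult add.commute)
  ultimately show ?thesis by (simp add: cov_def mat_minus1) (simp add: fijk_def trace_comm)
qed

lemma cov_fiij: "cov (-1) 1 (fiij i j)"
proof -
  have "fiij i j \<in> (E3 :: 'a mmap set)"
    unfolding fiij_def by (intro E3_comm E3_mult E3_tv)
  moreover have "fiij i j (- c) = - fiij i j c" for c :: "'a pt"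
    by (simp add: fiij_def comm_def tv_neg neg_mult)
  moreover have "transpose (fiij i j c) = fiij i j c" for c :: "'a pt"
    by (simp add: fiij_def comm_def transpose_diff matrix_transpose_mul transpose_tv neg_mult)
  ultimately show ?thesis by (simp add: cov_def mat_minus1) (simp add: fiij_def trace_comm)
qed

lemma cov_L2: "G \<in> set L2 \<Longrightarrow> cov (-1) (-1) G" and cov_L3: "G \<in> set L3 \<Longrightarrow> cov 1 (-1) G"
  and cov_F0: "G \<in> set F0 \<Longrightarrow> cov 1 1 G" and cov_F1: "G \<in> set F1 \<Longrightarrow> cov (-1) 1 G"
  by (auto simp: L2_def L3_def F0_def F1_def cov_tv cov_comm cov_fsym cov_fijk cov_fiij)

subsection \<open>Every covariant is a combination of the generators\<close>

lemma unskew_equivariant: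
  fixes F :: "'a::field_char_0 mmap"
  assumes F: "F \<in> E3" and sk: "\<And>c. transpose (F c) = - F c"
  shows "is_poly (\<lambda>c. unskew (F c) $ i)" "h \<in> SO3 \<Longrightarrow> unskew (F (rot h c)) = h *v unskew (F c)"
proof -
  have "is_poly (\<lambda>c. F c $ i $ j)" for i j using F by (simp add: E3_def)
  then show "is_poly (\<lambda>c. unskew (F c) $ i)"
    using exhaust_3[of i] by (elim disjE) (simp_all add: unskew_def)
  assume h: "h \<in> SO3"
  let ?g = "conj3 h" and ?u = "unskew (F c)"
  have g: "?g \<in> SO3" by (rule conj3_SO3[OF h])
  have "F (rot h c) = ?g ** skew ?u ** transpose ?g"
    using F g by (simp add: E3_def skew_unskew[OF sk] flip: so_act_eq_rot[OF g, unfolded conj3_conj3])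
  then have "unskew (F (rot h c)) = so_act ?g (\<chi> k. ?u) $ 1" by (simp add: so_act_def)
  also have "\<dots> = h *v ?u"
    unfolding so_act_eq_rot[OF g] conj3_conj3
    by (simp add: vec_eq_iff rot_nth matrix_vector_mult_def sum_3)
  finally show "unskew (F (rot h c)) = h *v ?u" .
qed

lemma Pspan_list: "length ps = length Fs \<Longrightarrow> set ps \<subseteq> Palg \<Longrightarrow> F = lincomb ps Fs \<Longrightarrow> F \<in> Pspan (set Fs)"
  unfolding Pspan_def by blast

lemma Palg_uminus: "p \<in> Palg \<Longrightarrow> (\<lambda>c. - p c) \<in> Palg" for p :: "'a::comm_ring_1 pt \<Rightarrow> 'a"
  using Palg.mult[OF Palg.const[of "-1"], of p] by simp

lemma Palg_diff: "p \<in> Palg \<Longrightarrow> q \<in> Palg \<Longrightarrow> (\<lambda>c. p c - q c) \<in> Palg" for p :: "'a::comm_ring_1 pt \<Rightarrow> 'a"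
  using Palg.add[OF _ Palg_uminus, of p q] by simp

lemma skew_L2: "skew (transpose c *v (\<chi> k. b k c)) = lincomb [b 1, b 2, b 3] L2 c" for c :: "'a::comm_ring_1 pt"
  by (simp add: L2_def vec_eq_iff forall_3 tv_def skew_def matrix_vector_mult_def sum_3 transpose_nth algebra_simps)

text \<open>The columns of \<open>adj C\<close> are cross products of rows of \<open>C\<close>, and
  commutators of skew-symmetric matrices correspond to cross products of axes. Passing from axes to
  coordinates has determinant -1 and so reverses cross products, which accounts for the
  signs.\<close>

lemma skew_L3: "skew (adj3 c *v (\<chi> k. b k c)) = lincomb [\<lambda>c. - b 3 c, b 2, \<lambda>c. - b 1 c] L3 c" for c :: "'a::comm_ring_1 pt"
  by (simp add: L3_def comm_def vec_eq_iff forall_3 mmult_nth mat_nth tv_def skew_def adj3_def matrix_vector_mult_def sum_3 algebra_simps)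

lemma odd_skew_in_span:
  fixes F :: "'a::field_char_0 mmap"
  assumes F: "F \<in> E3" and sk: "\<And>c. transpose (F c) = - F c" and odd: "\<And>c. F (- c) = - F c"
  shows "F \<in> Pspan (set L2)"
proof (rule odd_equivariant_vector[of "\<lambda>c. unskew (F c)", OF unskew_equivariant[OF F sk]])
  show "unskew (F (- c)) = - unskew (F c)" for c
    by (simp add: odd unskew_def vec_eq_iff forall_3)
  fix b :: "3 \<Rightarrow> 'a pt \<Rightarrow> 'a"
  assume b: "\<And>k. b k \<in> Palg" "\<And>c. unskew (F c) = transpose c *v (\<chi> k. b k c)"
  have "F c = lincomb [b 1, b 2, b 3] L2 c" for c
    using skew_unskew[OF sk, of c] unfolding b(2) skew_L2 by simp
  then show ?thesis by (intro Pspan_list[of "[b 1, b 2, b 3]"] ext) (simp_all add: b(1) L2_def)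
qed

lemma even_skew_in_span:
  fixes F :: "'a::field_char_0 mmap"
  assumes F: "F \<in> E3" and sk: "\<And>c. transpose (F c) = - F c" and even: "\<And>c. F (- c) = F c"
  shows "F \<in> Pspan (set L3)"
proof (rule even_equivariant_vector[of "\<lambda>c. unskew (F c)", OF unskew_equivariant[OF F sk]])
  show "unskew (F (- c)) = unskew (F c)" for c by (simp add: even)
  fix b :: "3 \<Rightarrow> 'a pt \<Rightarrow> 'a"
  assume b: "\<And>k. b k \<in> Palg" "\<And>c. unskew (F c) = adj3 c *v (\<chi> k. b k c)"
  let ?ps = "[\<lambda>c. - b 3 c, b 2, \<lambda>c. - b 1 c]"
  have "F c = lincomb ?ps L3 c" for c
    using skew_unskew[OF sk, of c] unfolding b(2) skew_L3 by simp
  then show ?thesis by (intro Pspan_list[of ?ps] ext) (simp_all add: b(1) L3_def Palg_uminus)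
qed

section \<open>Symmetric covariants as sums of products of vectors\<close>

definition Jm :: "'a::comm_ring_1^3^3" where
  "Jm = vector [vector [0, 0, -1], vector [0, 1, 0], vector [-1, 0, 0]]"

lemma Jm_Jm: "Jm ** Jm = mat 1" and Jm_transpose: "transpose Jm = Jm"
  by (simp_all add: Jm_def vec_eq_iff forall_3 mmult_nth mat_nth transpose_nth)

lemma conj3_Jm: "conj3 g = Jm ** g ** Jm"
  by (simp add: Jm_def conj3_def vec_eq_iff forall_3 mmult_nth)

lemma Jm_cancel: "X ** Jm ** Jm = X" "Jm ** (Jm ** X) = X" for X :: "'a::comm_ring_1^3^3"
proof -
  show "X ** Jm ** Jm = X" unfolding matrix_mul_assoc[symmetric] Jm_Jm by simp
  show "Jm ** (Jm ** X) = X" unfolding matrix_mul_assoc Jm_Jm by simp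
qed

lemma Jm_conj: "Jm ** (Jm ** X ** Jm) ** Jm = X" for X :: "'a::comm_ring_1^3^3"
  unfolding matrix_mul_assoc[symmetric] Jm_cancel(2) Jm_Jm by simp

lemma Jm_mat: "Jm ** mat x ** Jm = mat x"
  unfolding mult_mat[of Jm] by (simp only: Jm_Jm matrix_mul_assoc[symmetric] matrix_mul_rid)

text \<open>\<open>conj3 h\<close> is \<open>h\<close> conjugated by \<open>Jm\<close>, so
  conjugating the values of \<open>F\<close> as well makes \<open>h\<close> itself act on both
  sides, as \<open>eqv\<close> requires.\<close>

lemma eqv_conj:
  fixes F :: "'a::field_char_0 mmap"
  assumes F: "F \<in> E3" and sy: "\<And>c. transpose (F c) = F c"
  shows "eqv (\<lambda>c. Jm ** F c ** Jm)"
  unfolding eqv_def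
proof (intro conjI ballI allI)
  have "mpoly F" using F by (simp add: E3_iff)
  then show "mpoly (\<lambda>c. Jm ** F c ** Jm)" by (intro mpoly_mult mpoly_const)
  show "transpose (Jm ** F c ** Jm) = Jm ** F c ** Jm" for c
    by (simp add: matrix_transpose_mul Jm_transpose sy matrix_mul_assoc)
  fix h :: "'a^3^3" and c assume h: "h \<in> SO3"
  have "F (rot h c) = conj3 h ** F c ** transpose (conj3 h)"
    using F conj3_SO3[OF h] by (simp add: E3_iff flip: so_act_eq_rot[OF conj3_SO3[OF h], unfolded conj3_conj3])
  then have "Jm ** F (rot h c) ** Jm = (Jm ** Jm) ** h ** Jm ** F c ** Jm ** transpose h ** Jm ** Jm"
    unfolding conj3_Jm by (simp only: matrix_transpose_mul Jm_transpose matrix_mul_assoc)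
  then show "Jm ** F (rot h c) ** Jm = h ** (Jm ** F c ** Jm) ** transpose h"
    unfolding Jm_cancel Jm_Jm by (simp add: matrix_mul_assoc)
qed

definition outer :: "'a::comm_ring_1^3 \<Rightarrow> 'a^3 \<Rightarrow> 'a^3^3" where
  "outer v w = (\<chi> i j. v $ i * w $ j)"

lemma outer_nth: "outer v w $ i $ j = v $ i * w $ j"
  by (simp add: outer_def)

text \<open>The vector triple product: cross product matrices of \<open>a\<close> and
  \<open>b\<close> multiply to \<open>b a\<^sup>T - (a b) I\<close>, where \<open>a b\<close>
  denotes the inner product.\<close>

lemma tv_mult_tv: "tv i c ** tv j c = Jm ** outer (c $ j) (c $ i) ** Jm - mat (gp i j c)" for c :: "'a::comm_ring_1 pt"
  by (simp add: vec_eq_iff forall_3 mmult_nth tv_def skew_def Jm_def outer_nth mat_nth gp_def algebra_simps)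

lemma fsym_outer:
  fixes c :: "'a::field_char_0 pt"
  shows "fsym i j c = Jm ** (mat (1/2) ** (outer (c $ i) (c $ j) + outer (c $ j) (c $ i))) ** Jm - mat (1/3 * gp i j c)"
proof -
  have "fsym i j c = mat (1/2) ** (Jm ** (outer (c $ i) (c $ j) + outer (c $ j) (c $ i)) ** Jm) - mat (gp i j c) - mat (1/3 * trP i j c)"
    by (simp add: fsym_def tv_mult_tv gp_commute[of j i] vec_eq_iff matrix_add_ldistrib matrix_add_rdistrib3 mat_nth)
  moreover have "mat (1/2) ** (Jm ** (outer (c $ i) (c $ j) + outer (c $ j) (c $ i)) ** Jm)
      = Jm ** (mat (1/2) ** (outer (c $ i) (c $ j) + outer (c $ j) (c $ i))) ** Jm"
    unfolding mult_mat_left[of Jm] by (simp only: matrix_mul_assoc)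
  moreover have "(mat (gp i j c) + mat (1/3 * trP i j c) :: 'a^3^3) = mat (1/3 * gp i j c)"
    by (simp add: vec_eq_iff mat_nth trP_eq field_simps)
  ultimately show ?thesis by (simp only: diff_diff_eq)
qed

definition sym_of :: "(nat \<Rightarrow> 'a::field_char_0) \<Rightarrow> gi \<Rightarrow> 'a" where
  "sym_of p i = (case i of G11 \<Rightarrow> p 0 | G12 \<Rightarrow> 1/2 * p 1 | G13 \<Rightarrow> 1/2 * p 2 | G22 \<Rightarrow> p 3 | G23 \<Rightarrow> 1/2 * p 4 | G33 \<Rightarrow> p 5)"

text \<open>\<open>tr (Z G)\<close> for the symmetric matrix \<open>Z\<close> with entries
  \<open>z\<close>, which is also the trace of \<open>C\<^sup>T Z C\<close>.\<close>

definition gsum :: "(gi \<Rightarrow> 'a) \<Rightarrow> 'a::comm_ring_1 pt \<Rightarrow> 'a" where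
  "gsum z c = z G11 * gp 1 1 c + 2 * (z G12 * gp 1 2 c) + 2 * (z G13 * gp 1 3 c)
     + z G22 * gp 2 2 c + 2 * (z G23 * gp 2 3 c) + z G33 * gp 3 3 c"

text \<open>Each \<open>fsym\<close> is the traceless part of a symmetrized product of two rows, so
  a combination is the traceless part of \<open>C\<^sup>T Z C\<close>, conjugated by
  \<open>Jm\<close>.\<close>

lemma F0_comb:
  "lincomb [p 0, p 1, p 2, p 3, p 4, p 5] F0 c
   = Jm ** (transpose c ** symm (sym_of (\<lambda>i. p i c)) ** c) ** Jm - mat (1/3 * gsum (sym_of (\<lambda>i. p i c)) c)"
proof -
  have "transpose c ** symm z ** c = mat (z G11) ** outer (c$1) (c$1) + mat (z G12) ** (outer (c$1) (c$2) + outer (c$2) (c$1))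
      + mat (z G13) ** (outer (c$1) (c$3) + outer (c$3) (c$1)) + mat (z G22) ** outer (c$2) (c$2)
      + mat (z G23) ** (outer (c$2) (c$3) + outer (c$3) (c$2)) + mat (z G33) ** outer (c$3) (c$3)" for z
    by (simp add: vec_eq_iff forall_3 mmult_nth outer_nth mat_nth symm_def transpose_nth algebra_simps)
  then show ?thesis
    by (simp add: F0_def fsym_outer vec_eq_iff forall_3 mmult_nth mat_nth outer_nth Jm_def sym_of_def gsum_def)
      (simp add: field_simps)
qed

definition cr :: "'a::comm_ring_1^3 \<Rightarrow> 'a^3 \<Rightarrow> 'a^3" where
  "cr v w = vector [v$2 * w$3 - v$3 * w$2, v$3 * w$1 - v$1 * w$3, v$1 * w$2 - v$2 * w$1]"

text \<open>The scalar part of \<open>t\<^sub>i\<^sup>2\<close> drops out of the commutator, and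
  \<open>t\<^sub>j\<close> acts on the axis of \<open>t\<^sub>i\<close> by a cross product; the sign
  is again that of the passage from axes to coordinates.\<close>

lemma fiij_outer:
  "fiij i j c = - (Jm ** (outer (c$i) (cr (c$i) (c$j)) + outer (cr (c$i) (c$j)) (c$i)) ** Jm)"
  by (simp add: fiij_def comm_def vec_eq_iff forall_3 mmult_nth tv_def skew_def Jm_def outer_nth cr_def algebra_simps)

lemma fijk_outer:
  "fijk i j k c = - (Jm ** (outer (c$i) (cr (c$j) (c$k)) + outer (cr (c$j) (c$k)) (c$i)
     + (outer (c$j) (cr (c$i) (c$k)) + outer (cr (c$i) (c$k)) (c$j))) ** Jm)"
  by (simp add: fijk_def comm_def vec_eq_iff forall_3 mmult_nth tv_def skew_def Jm_def outer_nth cr_def algebra_simps)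

text \<open>\<open>mat_of p\<close> is the traceless matrix \<open>X\<close> for which the combination of \<open>F1\<close> with coefficients \<open>p\<close>
  is \<open>M + M\<^sup>T\<close> with \<open>M = C\<^sup>T X (adj C)\<^sup>T\<close>, up to conjugation by \<open>Jm\<close>.\<close>

definition mat_of :: "(nat \<Rightarrow> 'a::comm_ring_1) \<Rightarrow> mi \<Rightarrow> 'a" where
  "mat_of p m = (case m of M11 \<Rightarrow> p 6 - p 7 | M12 \<Rightarrow> p 2 | M13 \<Rightarrow> - p 0 | M21 \<Rightarrow> - p 4 | M22 \<Rightarrow> p 7
     | M23 \<Rightarrow> p 1 | M31 \<Rightarrow> p 5 | M32 \<Rightarrow> - p 3 | M33 \<Rightarrow> - p 6)"

definition sym_part :: "'a::comm_ring_1 pt \<Rightarrow> 'a^3^3 \<Rightarrow> 'a^3^3" where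
  "sym_part c X = transpose c ** X ** transpose (adj3 c) + transpose (transpose c ** X ** transpose (adj3 c))"

lemma Jm_sum:
  "Jm ** (mat a ** A + mat b ** B + mat c ** C + mat d ** D + mat e ** E + mat f ** F + mat g ** G + mat h ** H) ** Jm
   = mat a ** (Jm ** A ** Jm) + mat b ** (Jm ** B ** Jm) + mat c ** (Jm ** C ** Jm) + mat d ** (Jm ** D ** Jm)
     + mat e ** (Jm ** E ** Jm) + mat f ** (Jm ** F ** Jm) + mat g ** (Jm ** G ** Jm)
     + mat h ** (Jm ** H ** Jm)" for A :: "'a::comm_ring_1^3^3"
  unfolding matrix_add_ldistrib matrix_add_rdistrib3 mult_mat_left[of Jm] by (simp only: matrix_mul_assoc)

lemma F1_comb:
  "lincomb [p 0, p 1, p 2, p 3, p 4, p 5, p 6, p 7] F1 c = Jm ** sym_part c (matm (mat_of (\<lambda>i. p i c))) ** Jm"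
proof -
  let ?o = "\<lambda>v w :: 'a^3. outer v w + outer w v"
  let ?X = "matm (mat_of (\<lambda>i. p i c))"
  \<comment> \<open>The columns of \<open>adj C\<close> are cross products of rows, the middle one
    negated; an entry of \<open>X\<close> therefore weights the product of one row with one cross
    product.\<close>
  have a: "adj3 c $ i $ 1 = cr (c$2) (c$3) $ i" "adj3 c $ i $ 2 = - cr (c$1) (c$3) $ i" "adj3 c $ i $ 3 = cr (c$1) (c$2) $ i" for i
    using exhaust_3[of i] by (auto simp: adj3_def cr_def)
  have sw: "cr w v $ i = - cr v w $ i" for v w :: "'a^3" and i
    using exhaust_3[of i] by (auto simp: cr_def)
  have 1: "sym_part c ?X $ i $ j =
     - (p 0 c * ?o (c$1) (cr (c$1) (c$2)) $ i $ j + p 1 c * ?o (c$2) (cr (c$2) (c$1)) $ i $ j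
      + p 2 c * ?o (c$1) (cr (c$1) (c$3)) $ i $ j + p 3 c * ?o (c$3) (cr (c$3) (c$1)) $ i $ j
      + p 4 c * ?o (c$2) (cr (c$2) (c$3)) $ i $ j + p 5 c * ?o (c$3) (cr (c$3) (c$2)) $ i $ j
      + p 6 c * (?o (c$1) (cr (c$3) (c$2)) + ?o (c$3) (cr (c$1) (c$2))) $ i $ j
      + p 7 c * (?o (c$1) (cr (c$2) (c$3)) + ?o (c$2) (cr (c$1) (c$3))) $ i $ j)" for i j
    by (simp add: sym_part_def mmult_nth transpose_nth a outer_nth matm_def mat_of_def
        sw[of "c$2" "c$1"] sw[of "c$3" "c$1"] sw[of "c$3" "c$2"] algebra_simps)
  have "sym_part c ?X = - (mat (p 0 c) ** ?o (c$1) (cr (c$1) (c$2)) + mat (p 1 c) ** ?o (c$2) (cr (c$2) (c$1))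
      + mat (p 2 c) ** ?o (c$1) (cr (c$1) (c$3)) + mat (p 3 c) ** ?o (c$3) (cr (c$3) (c$1))
      + mat (p 4 c) ** ?o (c$2) (cr (c$2) (c$3)) + mat (p 5 c) ** ?o (c$3) (cr (c$3) (c$2))
      + mat (p 6 c) ** (?o (c$1) (cr (c$3) (c$2)) + ?o (c$3) (cr (c$1) (c$2)))
      + mat (p 7 c) ** (?o (c$1) (cr (c$2) (c$3)) + ?o (c$2) (cr (c$1) (c$3))))" (is "_ = - ?R")
    unfolding vec_eq_iff using 1 by (simp only: vector_uminus_component vector_add_component mat_mult_nth) simp
  then have "Jm ** sym_part c ?X ** Jm = - (Jm ** ?R ** Jm)" by (simp only: neg_mult)
  then show ?thesis unfolding Jm_sum by (simp add: F1_def fiij_outer fijk_outer neg_mult)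
qed

lemma even_sym_in_span:
  fixes F :: "'a::field_char_0 mmap"
  assumes F: "F \<in> E3" and sy: "\<And>c. transpose (F c) = F c" and even: "\<And>c. F (- c) = F c"
  shows "\<exists>p\<in>Palg. \<exists>H\<in>Pspan (set F0). \<forall>c. F c = mat (p c) + H c"
proof (rule even_equivariant_symmetric[OF eqv_conj[OF F sy]])
  show "Jm ** F (- c) ** Jm = Jm ** F c ** Jm" for c by (simp add: even)
  fix p :: "'a pt \<Rightarrow> 'a" and Z
  assume p: "p \<in> Palg" and Z: "\<And>i. Z i \<in> Palg"
    and e: "\<And>c. Jm ** F c ** Jm = mat (p c) + transpose c ** symm (\<lambda>i. Z i c) ** c"
  \<comment> \<open>The doubled off-diagonal coefficients undo the halving in
    \<open>sym_of\<close>.\<close>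
  define P where "P = (\<lambda>i. [Z G11, \<lambda>c. 2 * Z G12 c, \<lambda>c. 2 * Z G13 c, Z G22, \<lambda>c. 2 * Z G23 c, Z G33] ! i)"
  have sP: "sym_of (\<lambda>i. P i c) = (\<lambda>i. Z i c)" for c
    by (rule ext, rename_tac i, case_tac i) (simp_all add: sym_of_def P_def eval_nat_numeral)
  let ?ps = "[P 0, P 1, P 2, P 3, P 4, P 5]"
  let ?q = "\<lambda>c. p c + 1/3 * gsum (\<lambda>i. Z i c) c"
  have FF: "F c = mat (?q c) + lincomb ?ps F0 c" for c
  proof -
    have "F c = Jm ** (mat (p c) + transpose c ** symm (\<lambda>i. Z i c) ** c) ** Jm"
      unfolding e[symmetric] Jm_conj ..
    also have "\<dots> = mat (p c) + Jm ** (transpose c ** symm (\<lambda>i. Z i c) ** c) ** Jm"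
      unfolding matrix_add_ldistrib matrix_add_rdistrib3 Jm_mat ..
    finally have "F c = mat (p c) + Jm ** (transpose c ** symm (\<lambda>i. Z i c) ** c) ** Jm" .
    moreover have "(mat (?q c) :: 'a^3^3) = mat (p c) + mat (1/3 * gsum (\<lambda>i. Z i c) c)"
      by (simp add: vec_eq_iff mat_nth)
    ultimately show ?thesis unfolding F0_comb sP by simp
  qed
  have qP: "?q \<in> Palg"
    unfolding gsum_def by (intro Palg.add Palg.mult Palg.const p Z gp_Palg)
  have lP: "lincomb ?ps F0 \<in> Pspan (set F0)"
    by (rule Pspan_list[of ?ps F0]) (simp_all add: F0_def P_def Z Palg.mult[OF Palg.const] eval_nat_numeral)
  show ?thesis by (intro bexI[OF _ qP] bexI[OF _ lP] allI FF)
qed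

lemma odd_sym_in_span:
  fixes F :: "'a::field_char_0 mmap"
  assumes F: "F \<in> E3" and sy: "\<And>c. transpose (F c) = F c" and odd: "\<And>c. F (- c) = - F c"
  shows "\<exists>p\<in>Palg. \<exists>H\<in>Pspan (set F1). \<forall>c. F c = mat (det c * p c) + H c"
proof (rule odd_equivariant_symmetric[OF eqv_conj[OF F sy]])
  show "Jm ** F (- c) ** Jm = - (Jm ** F c ** Jm)" for c by (simp add: odd neg_mult)
  fix t :: "'a pt \<Rightarrow> 'a" and X
  assume t: "t \<in> Palg" and X: "\<And>m. X m \<in> Palg"
    and e: "\<And>c. Jm ** F c ** Jm = mat (det c * t c) + (transpose c ** matm (traceless (\<lambda>m. X m c)) ** transpose (adj3 c)
       + transpose (transpose c ** matm (traceless (\<lambda>m. X m c)) ** transpose (adj3 c)))"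
  \<comment> \<open>The inverse of \<open>mat_of\<close> on traceless matrices: there
    \<open>M11\<close> is the difference of the positions 6 and 7, so position 6 must be
    \<open>X M11 + X M22\<close>.\<close>
  define P where "P = (\<lambda>i. [\<lambda>c. - X M13 c, X M23, X M12, \<lambda>c. - X M32 c, \<lambda>c. - X M21 c, X M31,
     \<lambda>c. X M11 c + X M22 c, X M22] ! i)"
  have sP: "mat_of (\<lambda>i. P i c) = traceless (\<lambda>i. X i c)" for c
    by (rule ext, rename_tac i, case_tac i) (simp_all add: mat_of_def P_def traceless_def eval_nat_numeral)
  let ?ps = "[P 0, P 1, P 2, P 3, P 4, P 5, P 6, P 7]"
  have FF: "F c = mat (det c * t c) + lincomb ?ps F1 c" for c
  proof -
    have "F c = Jm ** (mat (det c * t c) + sym_part c (matm (traceless (\<lambda>m. X m c)))) ** Jm"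
      unfolding sym_part_def e[symmetric] Jm_conj ..
    then show ?thesis unfolding matrix_add_ldistrib matrix_add_rdistrib3 Jm_mat F1_comb sP .
  qed
  have lP: "lincomb ?ps F1 \<in> Pspan (set F1)"
    by (rule Pspan_list[of ?ps F1]) (simp_all add: F1_def P_def X Palg_uminus Palg.add eval_nat_numeral)
  show ?thesis by (intro bexI[OF _ t] bexI[OF _ lP] allI FF)
qed

text \<open>The projection to the sign type \<open>(e, s)\<close>: the average over the group of
  order 4 generated by the commuting involutions \<open>c \<mapsto> - c\<close> and transposition,
  weighted by its character.\<close>

definition part :: "'a \<Rightarrow> 'a \<Rightarrow> 'a::field_char_0 mmap \<Rightarrow> 'a mmap" where
  "part e s F c = mat (1/4) ** (F c + mat e ** F (- c) + mat s ** transpose (F c) + mat (e * s) ** transpose (F (- c)))"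

lemma part_E3: "F \<in> E3 \<Longrightarrow> part e s F \<in> E3"
proof -
  assume F: "F \<in> E3"
  have "(\<lambda>c. mat (1/4) ** (F c + mat e ** F (- c) + mat s ** transpose (F c) + mat (e * s) ** transpose (F (- c)))) \<in> E3"
    by (rule E3_cscale[OF E3_add[OF E3_add[OF E3_add[OF F E3_cscale[OF E3_neg_arg[OF F]]]
          E3_cscale[OF E3_transpose[OF F]]] E3_cscale[OF E3_neg_arg[OF E3_transpose[OF F]]]]])
  then show ?thesis by (simp add: part_def[abs_def])
qed

lemma part_nth: "part e s F c $ i $ j = 1/4 * (F c $ i $ j + e * F (- c) $ i $ j + s * F c $ j $ i + e * s * F (- c) $ j $ i)"
  by (simp add: part_def transpose_nth)

lemma part_neg:
  assumes "e = 1 \<or> e = -1"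
  shows "part e s F (- c) = mat e ** part e s F c"
proof -
  have *: "b + e * a + s * d + e * s * g = e * (a + e * b + s * g + e * s * d)" for a b d g
    using assms by (elim disjE) (simp_all add: algebra_simps)
  have "part e s F (- c) $ i $ j = e * part e s F c $ i $ j" for i j
    unfolding part_nth minus_minus by (rule trans[OF arg_cong[OF *, of "\<lambda>z. 1/4 * z"] mult.left_commute])
  then show ?thesis by (simp add: vec_eq_iff)
qed

lemma part_transpose:
  assumes "s = 1 \<or> s = -1"
  shows "transpose (part e s F c) = mat s ** part e s F c"
proof -
  have *: "d + e * g + s * a + e * s * b = s * (a + e * b + s * d + e * s * g)" for a b d g
    using assms by (elim disjE) (simp_all add: algebra_simps)
  have "part e s F c $ j $ i = s * part e s F c $ i $ j" for i j
    unfolding part_nth by (rule trans[OF arg_cong[OF *, of "\<lambda>z. 1/4 * z"] mult.left_commute])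
  then show ?thesis unfolding vec_eq_iff transpose_nth mat_mult_nth by blast
qed

lemma part_sum: "F c = part 1 1 F c + part (-1) 1 F c + part 1 (-1) F c + part (-1) (-1) F c"
proof -
  have q: "x = 1/4 * (x + 1 * y + 1 * z + 1 * 1 * w) + 1/4 * (x + -1 * y + 1 * z + -1 * 1 * w)
      + 1/4 * (x + 1 * y + -1 * z + 1 * -1 * w) + 1/4 * (x + -1 * y + -1 * z + -1 * -1 * w)" for x y z w :: 'a
    by (simp add: field_simps)
  have "F c $ i $ j = (part 1 1 F c + part (-1) 1 F c + part 1 (-1) F c + part (-1) (-1) F c) $ i $ j" for i j
    unfolding vector_add_component part_nth by (rule q)
  then show ?thesis unfolding vec_eq_iff by blast
qed

lemma mat_1_mult: "mat 1 ** M = M" for M :: "'a::comm_ring_1^3^3"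
  by (rule matrix_mul_lid)

lemma E31_iff: "F \<in> E31 \<longleftrightarrow> (\<exists>p\<in>Palg. \<exists>q\<in>Palg. F = (\<lambda>c :: 'a::field_char_0 pt. mat (p c + det c * q c)))"
proof -
  have 1: "lincomb [p, q] [Imap, tr3I] = (\<lambda>c :: 'a pt. mat (p c + det c * q c))" for p q
    by (rule ext) (simp add: Imap_def tr3I_def trace3_eq mat_mult_mat, simp add: vec_eq_iff mat_nth mult.commute)
  have "E31 = {lincomb ps [Imap, tr3I] | ps :: ('a pt \<Rightarrow> 'a) list. length ps = 2 \<and> set ps \<subseteq> Palg}"
    unfolding E31_def Pspan_eq using spanR_list[OF subring_Palg, of "[Imap, tr3I]"] by (simp add: numeral_2_eq_2)
  also have "\<dots> = {F. \<exists>p\<in>Palg. \<exists>q\<in>Palg. F = lincomb [p, q] [Imap, tr3I]}"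
  proof (intro set_eqI iffI)
    fix F :: "'a mmap" assume "F \<in> {lincomb ps [Imap, tr3I] | ps. length ps = 2 \<and> set ps \<subseteq> Palg}"
    then obtain ps where ps: "F = lincomb ps [Imap, tr3I]" "length ps = 2" "set ps \<subseteq> Palg" by blast
    then obtain p q where "ps = [p, q]" by (auto simp: numeral_2_eq_2 length_Suc_conv)
    then show "F \<in> {F. \<exists>p\<in>Palg. \<exists>q\<in>Palg. F = lincomb [p, q] [Imap, tr3I]}" using ps by auto
  next
    fix F :: "'a mmap" assume "F \<in> {F. \<exists>p\<in>Palg. \<exists>q\<in>Palg. F = lincomb [p, q] [Imap, tr3I]}"
    then obtain p q where "p \<in> Palg" "q \<in> Palg" "F = lincomb [p, q] [Imap, tr3I]" by blast
    then show "F \<in> {lincomb ps [Imap, tr3I] | ps. length ps = 2 \<and> set ps \<subseteq> Palg}"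
      by (intro CollectI exI[of _ "[p, q]"]) simp
  qed
  finally show ?thesis unfolding 1 by blast
qed

lemma Inv3_decomp:
  fixes f :: "'a::field_char_0 pt \<Rightarrow> 'a"
  assumes f: "f \<in> Inv3"
  obtains p q where "p \<in> Palg" "q \<in> Palg" "\<And>c. f c = p c + det c * q c"
proof -
  have n: "(\<lambda>c. f (- c)) \<in> Inv3"
    using f by (simp add: Inv3_iff is_poly_neg_arg rot_neg[symmetric])
  define p where "p c = 1/2 * (f c + f (- c))" for c
  define r where "r c = 1/2 * (f c + - 1 * f (- c))" for c
  have pI: "(\<lambda>c. p c) \<in> Inv3" unfolding p_def by (intro Inv3_mult Inv3_const Inv3_add f n)
  have pP: "(\<lambda>c. p c) \<in> Palg" by (rule even_invariant[OF pI]) (simp add: p_def add.commute)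
  have rI: "(\<lambda>c. r c) \<in> Inv3" unfolding r_def by (intro Inv3_mult Inv3_const Inv3_add f n)
  have rodd: "r (- c) = - r c" for c by (simp add: r_def field_simps)
  have fpr: "f c = p c + r c" for c by (simp add: p_def r_def field_simps)
  show ?thesis
  proof (rule odd_invariant[OF rI rodd])
    fix k assume k: "k \<in> Palg" "\<And>c. r c = det c * k c"
    have "f c = p c + det c * k c" for c unfolding fpr k(2) ..
    then show thesis by (rule that[OF pP k(1)])
  qed
qed

lemma E31_Inv3: "E31 = {(\<lambda>c :: 'a::field_char_0 pt. mat (f c)) | f. f \<in> Inv3}"
proof (intro set_eqI iffI)
  fix F :: "'a mmap" assume "F \<in> E31"
  then obtain p q where pq: "p \<in> Palg" "q \<in> Palg" "F = (\<lambda>c. mat (p c + det c * q c))" unfolding E31_iff by blast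
  have "(\<lambda>c. p c + det c * q c) \<in> Inv3" by (intro Inv3_add Inv3_mult det_Inv3 Palg_Inv3 pq)
  then show "F \<in> {(\<lambda>c. mat (f c)) | f. f \<in> Inv3}"
    unfolding pq(3) by (intro CollectI exI[of _ "\<lambda>c. p c + det c * q c"]) simp
next
  fix F :: "'a mmap" assume "F \<in> {(\<lambda>c. mat (f c)) | f. f \<in> Inv3}"
  then obtain f where f: "f \<in> Inv3" "F = (\<lambda>c. mat (f c))" by blast
  show "F \<in> E31"
  proof (rule Inv3_decomp[OF f(1)])
    fix p q assume "p \<in> Palg" "q \<in> Palg" "\<And>c. f c = p c + det c * q c"
    then have "(\<lambda>c. mat (f c)) = (\<lambda>c. mat (p c + det c * q c) :: 'a^3^3)" by simp
    with \<open>p \<in> Palg\<close> \<open>q \<in> Palg\<close> show ?thesis unfolding E31_iff f(2) by (intro bexI)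
  qed
qed

lemma E32_1_eq: "E32_1 = Pspan (set (L2 :: 'a::field_char_0 mmap list))"
  unfolding E32_1_def GLmod_tv Pspan_Kspan ..

lemma E32_0_eq: "E32_0 = Pspan (set (L3 :: 'a::field_char_0 mmap list))"
  unfolding E32_0_def GLmod_comm Pspan_Kspan ..

lemma E33_0_eq: "E33_0 = Pspan (set (F0 :: 'a::field_char_0 mmap list))"
  unfolding E33_0_def GLmod_fsym Pspan_Kspan ..

lemma E33_1_eq: "E33_1 = Pspan (set (F1 :: 'a::field_char_0 mmap list))"
  unfolding E33_1_def GLmod_fijk Pspan_Kspan ..

lemma E3_decomp:
  fixes F :: "'a::field_char_0 mmap"
  assumes F: "F \<in> E3"
  shows "\<exists>A\<in>E31. \<exists>B\<in>E32_1. \<exists>C\<in>E32_0. \<exists>D\<in>E33_0. \<exists>E\<in>E33_1. \<forall>c. F c = A c + B c + C c + D c + E c"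
proof -
  have "\<exists>p\<in>Palg. \<exists>H\<in>Pspan (set F0). \<forall>c. part 1 1 F c = mat (p c) + H c"
    by (rule even_sym_in_span[OF part_E3[OF F]]) (simp_all add: part_neg part_transpose mat_1_mult)
  then obtain p D where p: "p \<in> Palg" "D \<in> Pspan (set F0)" "\<And>c. part 1 1 F c = mat (p c) + D c" by blast
  have "\<exists>q\<in>Palg. \<exists>H\<in>Pspan (set F1). \<forall>c. part (-1) 1 F c = mat (det c * q c) + H c"
    by (rule odd_sym_in_span[OF part_E3[OF F]]) (simp_all add: part_neg part_transpose mat_1_mult mat_minus1)
  then obtain q E where q: "q \<in> Palg" "E \<in> Pspan (set F1)" "\<And>c. part (-1) 1 F c = mat (det c * q c) + E c" by blast
  have B: "part (-1) (-1) F \<in> Pspan (set L2)"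
    by (rule odd_skew_in_span[OF part_E3[OF F]]) (simp_all add: part_neg part_transpose mat_minus1)
  have C: "part 1 (-1) F \<in> Pspan (set L3)"
    by (rule even_skew_in_span[OF part_E3[OF F]]) (simp_all add: part_neg part_transpose mat_minus1 mat_1_mult)
  have A: "(\<lambda>c. mat (p c + det c * q c)) \<in> E31" unfolding E31_iff using p q by blast
  have "F c = mat (p c + det c * q c) + part (-1) (-1) F c + part 1 (-1) F c + D c + E c" for c
  proof -
    have "(mat (p c + det c * q c) :: 'a^3^3) = mat (p c) + mat (det c * q c)" by (simp add: vec_eq_iff mat_nth)
    then show ?thesis using part_sum[of F c] unfolding p(3) q(3) by (simp add: add_ac)
  qed
  then show ?thesis
    unfolding E32_1_eq E32_0_eq E33_0_eq E33_1_eq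
    by (intro bexI[OF _ A] bexI[OF _ B] bexI[OF _ C] bexI[OF _ p(2)] bexI[OF _ q(2)] allI)
qed


text \<open>Taking traces isolates \<open>A\<close>. The other four summands carry the four
  characters of the group generated by \<open>c \<mapsto> - c\<close> and transposition, so the four
  transformed equations separate them.\<close>

lemma E3_unique:
  fixes A :: "'a::field_char_0 mmap"
  assumes A: "A \<in> E31" and B: "B \<in> E32_1" and C: "C \<in> E32_0" and D: "D \<in> E33_0" and E: "E \<in> E33_1"
    and z: "\<And>c. A c + B c + C c + D c + E c = 0"
  shows "A c = 0 \<and> B c = 0 \<and> C c = 0 \<and> D c = 0 \<and> E c = 0"
proof -
  have cB: "cov (-1) (-1) B" by (rule cov_span[OF cov_L2 B[unfolded E32_1_eq]])
  have cC: "cov 1 (-1) C" by (rule cov_span[OF cov_L3 C[unfolded E32_0_eq]])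
  have cD: "cov 1 1 D" by (rule cov_span[OF cov_F0 D[unfolded E33_0_eq]])
  have cE: "cov (-1) 1 E" by (rule cov_span[OF cov_F1 E[unfolded E33_1_eq]])
  note cc = cB cC cD cE
  have tr: "trace (B c) = 0" "trace (C c) = 0" "trace (D c) = 0" "trace (E c) = 0" for c
    using cc by (simp_all add: cov_def)
  have tp: "transpose (B c) = - B c" "transpose (C c) = - C c" "transpose (D c) = D c" "transpose (E c) = E c" for c
    using cc by (simp_all add: cov_def mat_minus1 mat_1_mult)
  have ng: "B (- c) = - B c" "C (- c) = C c" "D (- c) = D c" "E (- c) = - E c" for c
    using cc by (simp_all add: cov_def mat_minus1 mat_1_mult)
  obtain f where f: "\<And>c. A c = mat (f c)" using A unfolding E31_iff by auto
  have "f c = 0" for c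
  proof -
    have "trace (A c + B c + C c + D c + E c) = 0" unfolding z by (simp add: trace_def)
    then show ?thesis by (simp add: trace_add tr f trace_mat)
  qed
  then have A0: "A c = 0" for c by (simp add: f)
  have z1: "B c + C c + D c + E c = 0" for c using z[of c] by (simp add: A0)
  have z2: "- B c - C c + D c + E c = 0" for c
  proof -
    have "transpose (B c + C c + D c + E c) = 0" unfolding z1 by (simp add: vec_eq_iff transpose_nth)
    then show ?thesis by (simp add: transpose_add tp)
  qed
  have z3: "- B c + C c + D c - E c = 0" for c using z1[of "- c"] by (simp add: ng)
  have z4: "B c - C c + D c - E c = 0" for c using z2[of "- c"] by (simp add: ng)
  have n: "B c $ i $ j + C c $ i $ j + D c $ i $ j + E c $ i $ j = 0"
    "- B c $ i $ j - C c $ i $ j + D c $ i $ j + E c $ i $ j = 0"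
    "- B c $ i $ j + C c $ i $ j + D c $ i $ j - E c $ i $ j = 0"
    "B c $ i $ j - C c $ i $ j + D c $ i $ j - E c $ i $ j = 0" for i j
    using arg_cong[OF z1[of c], of "\<lambda>M. M $ i $ j"] arg_cong[OF z2[of c], of "\<lambda>M. M $ i $ j"]
      arg_cong[OF z3[of c], of "\<lambda>M. M $ i $ j"] arg_cong[OF z4[of c], of "\<lambda>M. M $ i $ j"] by simp_all
  have "D c $ i $ j = 0" "E c $ i $ j = 0" "B c $ i $ j = 0" "C c $ i $ j = 0" for i j
  proof -
    note nn = n[of i j]
    have s: "4 * D c $ i $ j = 0" "4 * E c $ i $ j = 0" "4 * B c $ i $ j = 0" "4 * C c $ i $ j = 0"
      using nn by algebra+
    then show "D c $ i $ j = 0" "E c $ i $ j = 0" "B c $ i $ j = 0" "C c $ i $ j = 0" by simp_all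
  qed
  then show ?thesis by (simp add: A0 vec_eq_iff)
qed

section \<open>Relations\<close>

lemma Palg_zero_if_det:
  fixes p :: "'a::field_char_0 pt \<Rightarrow> 'a"
  assumes "p \<in> Palg" "\<And>c. det c * p c = 0"
  shows "p = (\<lambda>c. 0)"
proof
  fix c
  show "p c = 0"
    by (rule is_poly_domain[OF is_poly_det Palg_is_poly[OF assms(1)] assms(2), of "mat 1"]) simp
qed

lemma skew_zero: "skew v = 0 \<Longrightarrow> v = 0" for v :: "'a::ring_1^3"
  by (simp add: skew_def vec_eq_iff forall_3)

lemma list3: "length ps = 3 \<Longrightarrow> ps = [ps ! 0, ps ! 1, ps ! 2]"
  by (auto simp: eval_nat_numeral length_Suc_conv)

lemma list6: "length ps = 6 \<Longrightarrow> ps = [ps ! 0, ps ! 1, ps ! 2, ps ! 3, ps ! 4, ps ! 5]"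
  by (auto simp: eval_nat_numeral length_Suc_conv)

lemma list8: "length ps = 8 \<Longrightarrow> ps = [ps ! 0, ps ! 1, ps ! 2, ps ! 3, ps ! 4, ps ! 5, ps ! 6, ps ! 7]"
  by (auto simp: eval_nat_numeral length_Suc_conv)

lemma mat_det_mult_vec: "mat x *v v = (\<chi> i. x * v $ i)" for v :: "'a::comm_ring_1^3"
  by (simp add: vec_eq_iff forall_3 matrix_vector_mult_def sum_3 mat_nth)

lemma P_indep_L2: "P_indep (L2 :: 'a::field_char_0 mmap list)"
  unfolding P_indep_def
proof (intro allI impI, elim conjE)
  fix ps :: "('a pt \<Rightarrow> 'a) list"
  assume l: "length ps = length (L2 :: 'a mmap list)" and P: "set ps \<subseteq> Palg" and z: "lincomb ps L2 = (\<lambda>c. 0)"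
  define b where "b k = ps ! (if k = 1 then 0 else if k = 2 then 1 else 2)" for k :: 3
  have ps: "ps = [b 1, b 2, b 3]" using list3[of ps] l by (simp add: b_def L2_def)
  have "det c * b k c = 0" for k c
  proof -
    have "skew (transpose c *v (\<chi> k. b k c)) = 0" unfolding skew_L2 using z unfolding ps by (rule fun_cong)
    then have "transpose c *v (\<chi> k. b k c) = 0" by (rule skew_zero)
    then have "transpose (adj3 c) *v (transpose c *v (\<chi> k. b k c)) = 0" by (simp only: matrix_vector_mult_0_right)
    then have "mat (det c) *v (\<chi> k. b k c) = 0"
      by (simp only: matrix_vector_mul_assoc matrix_transpose_mul[symmetric] adj3_right transpose_mat)
    then have "(mat (det c) *v (\<chi> k. b k c)) $ k = 0" by simp
    then show ?thesis unfolding mat_det_mult_vec by simp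
  qed
  moreover have "b k \<in> Palg" for k using P unfolding ps using exhaust_3[of k] by auto
  ultimately have "b k = (\<lambda>c. 0)" for k using Palg_zero_if_det by blast
  then show "\<forall>p\<in>set ps. p = (\<lambda>c. 0)" unfolding ps by simp
qed

lemma P_indep_L3: "P_indep (L3 :: 'a::field_char_0 mmap list)"
  unfolding P_indep_def
proof (intro allI impI, elim conjE)
  fix ps :: "('a pt \<Rightarrow> 'a) list"
  assume l: "length ps = length (L3 :: 'a mmap list)" and P: "set ps \<subseteq> Palg" and z: "lincomb ps L3 = (\<lambda>c. 0)"
  define b where "b k = (if k = 1 then (\<lambda>c. - (ps ! 2) c) else if k = 2 then ps ! 1 else (\<lambda>c. - (ps ! 0) c))" for k :: 3
  have ps: "ps = [\<lambda>c. - b 3 c, b 2, \<lambda>c. - b 1 c]" using list3[of ps] l by (simp add: b_def L3_def)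
  have "det c * b k c = 0" for k c
  proof -
    have "skew (adj3 c *v (\<chi> k. b k c)) = 0" unfolding skew_L3 using z unfolding ps by (rule fun_cong)
    then have "adj3 c *v (\<chi> k. b k c) = 0" by (rule skew_zero)
    then have "c *v (adj3 c *v (\<chi> k. b k c)) = 0" by (simp only: matrix_vector_mult_0_right)
    then have "mat (det c) *v (\<chi> k. b k c) = 0"
      by (simp only: matrix_vector_mul_assoc adj3_right)
    then have "(mat (det c) *v (\<chi> k. b k c)) $ k = 0" by simp
    then show ?thesis unfolding mat_det_mult_vec by simp
  qed
  moreover have "b k \<in> Palg" for k
  proof -
    have "ps ! i \<in> Palg" if "i < 3" for i using P l that by (auto simp: L3_def)
    then show ?thesis unfolding b_def by (simp add: Palg_uminus)
  qed
  ultimately have "b k = (\<lambda>c. 0)" for k using Palg_zero_if_det by blast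
  then show "\<forall>p\<in>set ps. p = (\<lambda>c. 0)" unfolding ps by simp
qed

text \<open>Elements of \<open>Palg\<close> are even and \<open>det\<close> is odd, so passing to
  \<open>- c\<close> separates the two coefficients.\<close>

lemma P_indep_L1: "P_indep [Imap, tr3I :: 'a::field_char_0 mmap]"
  unfolding P_indep_def
proof (intro allI impI, elim conjE)
  fix ps :: "('a pt \<Rightarrow> 'a) list"
  assume l: "length ps = length [Imap, tr3I :: 'a mmap]" and P: "set ps \<subseteq> Palg"
    and z: "lincomb ps [Imap, tr3I] = (\<lambda>c. 0)"
  obtain p q where ps: "ps = [p, q]" using l by (auto simp: length_Suc_conv)
  have pq: "p \<in> Palg" "q \<in> Palg" using P ps by auto
  have s: "p c + q c * det c = 0" for c
  proof -
    have "lincomb ps [Imap, tr3I] c $ 1 $ 1 = 0" unfolding z by simp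
    then show ?thesis unfolding ps by (simp add: Imap_def tr3I_def trace3_eq mat_nth)
  qed
  have "p c - q c * det c = 0" for c
    using s[of "- c"] by (simp add: Palg_even[OF pq(1)] Palg_even[OF pq(2)] det_neg)
  then have "2 * p c = (p c + q c * det c) + (p c - q c * det c)" for c by simp
  then have p0: "p c = 0" for c using s \<open>\<And>c. p c - q c * det c = 0\<close> by simp
  then have "q = (\<lambda>c. 0)" using s by (intro Palg_zero_if_det[OF pq(2)]) (simp add: mult.commute)
  then show "\<forall>p\<in>set ps. p = (\<lambda>c. 0)" using p0 by (auto simp: ps)
qed

lemma Pspan_single: "F \<in> Pspan {G} \<Longrightarrow> \<exists>p\<in>Palg. F = (\<lambda>c. mat (p c) ** G c)"
proof -
  assume "F \<in> Pspan {G}"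
  then have "F \<in> {lincomb ps [G] | ps. length ps = length [G] \<and> set ps \<subseteq> Palg}"
    unfolding Pspan_eq using spanR_list[OF subring_Palg, of "[G]"] by simp
  then obtain ps where "F = lincomb ps [G]" "length ps = length [G]" "set ps \<subseteq> Palg" by blast
  then obtain p where "F = lincomb [p] [G]" "p \<in> Palg" by (auto simp: length_Suc_conv)
  then show ?thesis by auto
qed

lemma Pspan_mono: "S \<subseteq> T \<Longrightarrow> Pspan S \<subseteq> Pspan T"
  unfolding Pspan_def by blast

lemma dsum_list:
  fixes Fs :: "'a::field_char_0 mmap list"
  assumes ind: "P_indep Fs"
  shows "internal_dsum (Pspan (set Fs)) (map (\<lambda>F. Pspan {F}) Fs)"
  unfolding internal_dsum_def
proof (intro conjI ballI allI impI)
  show "N \<subseteq> Pspan (set Fs)" if N: "N \<in> set (map (\<lambda>F. Pspan {F}) Fs)" for N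
  proof -
    obtain F where F: "N = Pspan {F}" "F \<in> set Fs" using N by auto
    show ?thesis unfolding F(1) by (rule Pspan_mono) (simp add: F(2))
  qed
  have ms: "msum (map2 (\<lambda>p G c. mat (p c) ** G c) ps Gs) = lincomb ps Gs" if "length ps = length Gs"
    for ps and Gs :: "'a mmap list"
    using that by (induction ps Gs rule: list_induct2) (simp_all add: msum_def fun_eq_iff)
  fix F assume "F \<in> Pspan (set Fs)"
  then obtain ps where ps: "F = lincomb ps Fs" "length ps = length Fs" "set ps \<subseteq> Palg"
    unfolding Pspan_eq spanR_list[OF subring_Palg] by blast
  show "\<exists>Gs. length Gs = length (map (\<lambda>F. Pspan {F}) Fs) \<and> (\<forall>i<length (map (\<lambda>F. Pspan {F}) Fs). Gs ! i \<in> map (\<lambda>F. Pspan {F}) Fs ! i) \<and> F = msum Gs"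
  proof (intro exI conjI)
    show "F = msum (map2 (\<lambda>p G c. mat (p c) ** G c) ps Fs)" unfolding ms[OF ps(2)] by (rule ps(1))
    show "\<forall>i<length (map (\<lambda>F. Pspan {F}) Fs). map2 (\<lambda>p G c. mat (p c) ** G c) ps Fs ! i \<in> map (\<lambda>F. Pspan {F}) Fs ! i"
    proof (intro allI impI)
      fix i assume i: "i < length (map (\<lambda>F. Pspan {F}) Fs)"
      have "ps ! i \<in> Palg" using ps i by (simp add: subset_eq)
      then have "(\<lambda>c. mat ((ps ! i) c) ** (Fs ! i) c + (\<lambda>c. 0) c) \<in> Pspan {Fs ! i}"
        unfolding Pspan_eq by (intro spanR_cons spanR_zero) simp_all
      then show "map2 (\<lambda>p G c. mat (p c) ** G c) ps Fs ! i \<in> map (\<lambda>F. Pspan {F}) Fs ! i"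
        using i ps(2) by simp
    qed
  qed (simp add: ps(2))
next
  fix Gs i
  assume a: "length Gs = length (map (\<lambda>F. Pspan {F}) Fs) \<and> (\<forall>i<length (map (\<lambda>F. Pspan {F}) Fs). Gs ! i \<in> map (\<lambda>F. Pspan {F}) Fs ! i) \<and> msum Gs = (\<lambda>c. 0)"
    and i: "i < length (map (\<lambda>F. Pspan {F}) Fs)"
  have lG: "length Gs = length Fs" using a by simp
  have "\<forall>j. \<exists>p. j < length Fs \<longrightarrow> p \<in> Palg \<and> Gs ! j = (\<lambda>c. mat (p c) ** (Fs ! j) c)"
  proof
    fix j
    show "\<exists>p. j < length Fs \<longrightarrow> p \<in> Palg \<and> Gs ! j = (\<lambda>c. mat (p c) ** (Fs ! j) c)"
    proof (cases "j < length Fs")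
      case True
      then have "Gs ! j \<in> Pspan {Fs ! j}" using a by simp
      from Pspan_single[OF this] show ?thesis by blast
    qed simp
  qed
  from choice[OF this] obtain p where p: "\<forall>j. j < length Fs \<longrightarrow> p j \<in> Palg \<and> Gs ! j = (\<lambda>c. mat (p j c) ** (Fs ! j) c)" by (rule exE)
  let ?ps = "map p [0..<length Fs]"
  have "lincomb ?ps Fs = msum Gs"
  proof
    fix c
    have "lincomb ?ps Fs c = (\<Sum>j<length Fs. (Gs ! j) c)"
      unfolding lincomb_def by (rule sum.cong) (use p in auto)
    also have "\<dots> = msum Gs c"
      unfolding msum_def using lG by (simp add: sum_list_sum_nth atLeast0LessThan)
    finally show "lincomb ?ps Fs c = msum Gs c" .
  qed
  then have "lincomb ?ps Fs = (\<lambda>c. 0)" using a by simp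
  moreover have "set ?ps \<subseteq> Palg" using p by auto
  moreover have "length ?ps = length Fs" by simp
  ultimately have "\<forall>q\<in>set ?ps. q = (\<lambda>c. 0)" using ind[unfolded P_indep_def, rule_format] by blast
  then have "p i = (\<lambda>c. 0)" using i by simp
  then show "Gs ! i = (\<lambda>c. 0)" using p i by simp
qed

section \<open>Syzygies of the even symmetric covariants\<close>

lemma Palg_divide: "p \<in> Palg \<Longrightarrow> (\<lambda>c. p c / a) \<in> Palg" for p :: "'a::field_char_0 pt \<Rightarrow> 'a"
  using Palg.mult[OF Palg.const[of "1 / a"], of p] by simp

lemma trP_Palg: "trP i j \<in> (Palg :: ('a::field_char_0 pt \<Rightarrow> 'a) set)"
proof -
  have "(\<lambda>c. - 2 * gp i j c) \<in> (Palg :: ('a pt \<Rightarrow> 'a) set)" by (intro Palg.mult Palg.const gp_Palg)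
  moreover have "(\<lambda>c. - 2 * gp i j c) = (trP i j :: 'a pt \<Rightarrow> 'a)" by (simp add: trP_eq fun_eq_iff)
  ultimately show ?thesis by simp
qed

lemma mu0_Palg: "set mu0 \<subseteq> (Palg :: ('a::field_char_0 pt \<Rightarrow> 'a) set)"
  unfolding mu0_def power2_eq_square by (simp add: trP_Palg Palg.mult Palg_diff Palg_divide)

text \<open>A product of two traces is 4 times a product of Gram entries. Read through
  \<open>sym_of\<close>, which halves the off-diagonal coefficients, \<open>mu0\<close> is the
  symmetric matrix \<open>2 adj G\<close>.\<close>

lemma mu0_gp:
  "mu0 = [\<lambda>c :: 'a::field_char_0 pt. 2 * phi0 (gam c) (\<lambda>_. 1) G11, \<lambda>c. 4 * phi0 (gam c) (\<lambda>_. 1) G12, \<lambda>c. 4 * phi0 (gam c) (\<lambda>_. 1) G13,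
     \<lambda>c. 2 * phi0 (gam c) (\<lambda>_. 1) G22, \<lambda>c. 4 * phi0 (gam c) (\<lambda>_. 1) G23, \<lambda>c. 2 * phi0 (gam c) (\<lambda>_. 1) G33]"
  by (simp add: mu0_def fun_eq_iff trP_eq phi0_def power2_eq_square algebra_simps)

lemma phi0_scale: "phi0 g u i = u () * phi0 g (\<lambda>_. 1) i"
  by (cases i) (simp_all add: phi0_def algebra_simps)

text \<open>For the matrix \<open>Z\<close> of coefficients the relation reads
  \<open>C\<^sup>T Z C = s I\<close>. Moving \<open>C\<close> to the left and cancelling
  \<open>det C\<close> gives \<open>G Z = s I\<close>, and \<open>gram_scalar\<close> makes
  \<open>Z\<close> a multiple of \<open>adj G\<close>.\<close>

lemma F0_relation_imp:
  fixes ps :: "('a::field_char_0 pt \<Rightarrow> 'a) list"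
  assumes l: "length ps = 6" and P: "set ps \<subseteq> Palg" and z: "lincomb ps F0 = (\<lambda>c. 0)"
  shows "\<exists>q\<in>Palg. ps = map (\<lambda>m c. q c * m c) mu0"
proof -
  define p where "p i = ps ! i" for i
  have ps: "ps = [p 0, p 1, p 2, p 3, p 4, p 5]" using list6[OF l] by (simp add: p_def)
  have pP: "p i \<in> Palg" if "i < 6" for i using P l that by (auto simp: p_def)
  define w where "w i c = sym_of (\<lambda>j. p j c) i" for i c
  have wP: "w i \<in> Palg" for i
  proof -
    have "(\<lambda>c. w i c) \<in> Palg"
      unfolding w_def sym_of_def by (cases i) (simp_all add: pP Palg_divide)
    then show ?thesis by simp
  qed
  have wc: "sym_of (\<lambda>j. p j c) = (\<lambda>i. w i c)" for c by (simp add: w_def)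
  define s where "s c = 1/3 * gsum (\<lambda>i. w i c) c" for c
  have sp: "is_poly s"
  proof -
    have "(\<lambda>c. s c) \<in> Palg" unfolding s_def gsum_def by (intro Palg.add Palg.mult Palg.const wP gp_Palg)
    then show ?thesis by (simp add: Palg_is_poly)
  qed
  have T: "transpose c ** symm (\<lambda>i. w i c) ** c = mat (s c)" for c
  proof -
    have "lincomb [p 0, p 1, p 2, p 3, p 4, p 5] F0 c = 0" using z unfolding ps by (rule fun_cong)
    then have "Jm ** (transpose c ** symm (\<lambda>i. w i c) ** c) ** Jm = mat (s c)"
      unfolding F0_comb wc s_def by simp
    then have "Jm ** (Jm ** (transpose c ** symm (\<lambda>i. w i c) ** c) ** Jm) ** Jm = Jm ** mat (s c) ** Jm" by simp
    then show ?thesis unfolding Jm_conj Jm_mat .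
  qed
  have Wp: "mpoly (\<lambda>c. symm (\<lambda>i. w i c))"
  proof -
    have "is_poly (\<lambda>c. symm (\<lambda>i. w i c) $ i $ j)" for i j
      using exhaust_3[of i] exhaust_3[of j] wP[THEN Palg_is_poly] by (elim disjE) (simp_all add: symm_def)
    then show ?thesis by (simp add: mpoly_def)
  qed
  have GZ: "c ** transpose c ** symm (\<lambda>i. w i c) = mat (s c)" for c
  proof (rule mpoly_cancel_det[of "\<lambda>c. c ** transpose c ** symm (\<lambda>i. w i c)" "\<lambda>c. mat (s c)"])
    show "mpoly (\<lambda>c. c ** transpose c ** symm (\<lambda>i. w i c))" by (intro mpoly_mult mpoly_id mpoly_transpose Wp)
    show "mpoly (\<lambda>c. mat (s c))" by (rule mpoly_mat[OF sp])
    show "mat (det c) ** (c ** transpose c ** symm (\<lambda>i. w i c)) = mat (det c) ** mat (s c)" for c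
    proof -
      have "c ** (transpose c ** symm (\<lambda>i. w i c) ** c) ** adj3 c = (c ** transpose c ** symm (\<lambda>i. w i c)) ** (c ** adj3 c)"
        by (simp only: matrix_mul_assoc)
      then have "(c ** transpose c ** symm (\<lambda>i. w i c)) ** (c ** adj3 c) = mat (s c) ** (c ** adj3 c)"
        unfolding T mult_mat[of c] by (simp only: matrix_mul_assoc)
      then show ?thesis unfolding adj3_right mult_mat[of "c ** transpose c ** symm (\<lambda>i. w i c)"]
        by (simp only: mat_mult_mat mult.commute)
    qed
  qed
  obtain V where V: "\<And>i. pol (\<lambda>x. V x i)" "\<And>i c. w i c = V (gam c) i"
  proof (rule Palg_gam_choice[OF wP])
    fix V assume "\<And>k. pol (\<lambda>x. V x k)" "\<And>k c. w k c = V (gam c) k"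
    then show thesis by (rule that)
  qed
  have psi: "psi0 x (V x) k = 0" for x k
  proof (rule gam_algebraically_independent[of "\<lambda>x. psi0 x (V x) k"])
    show "pol (\<lambda>x. psi0 x (V x) k)" using cx0.psi_pol[of V UNIV k] V(1) by simp
    show "psi0 (gam c) (V (gam c)) k = 0" for c
      by (rule psi0_zero[of _ _ "s c"]) (use GZ[of c] in \<open>simp add: symm_gam V(2)\<close>)
  qed
  obtain U where U: "\<And>k. pol (\<lambda>x. U x k)" "\<And>x. V x = phi0 x (U x)"
  proof (rule gram_scalar[OF V(1) psi])
    fix U assume "\<And>k. pol (\<lambda>x. U x k)" "\<And>x. V x = phi0 x (U x)"
    then show thesis by (rule that)
  qed
  define q where "q c = 1/2 * U (gam c) ()" for c
  have qP: "q \<in> Palg"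
  proof -
    have "(\<lambda>c. U (gam c) ()) \<in> Palg" unfolding Palg_iff using U(1) by blast
    then have "(\<lambda>c. q c) \<in> Palg" unfolding q_def by (rule Palg.mult[OF Palg.const])
    then show ?thesis by simp
  qed
  have wU: "w i c = 2 * q c * phi0 (gam c) (\<lambda>_. 1) i" for i c
    unfolding V(2) U(2) q_def using phi0_scale[of "gam c" "U (gam c)" i] by simp
  have "p 0 c = w G11 c" "p 1 c = 2 * w G12 c" "p 2 c = 2 * w G13 c" "p 3 c = w G22 c" "p 4 c = 2 * w G23 c" "p 5 c = w G33 c" for c
    by (simp_all add: w_def sym_of_def)
  then have "ps = map (\<lambda>m c. q c * m c) mu0"
    unfolding ps mu0_gp by (simp add: fun_eq_iff wU)
  then show ?thesis using qP by blast
qed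

text \<open>For \<open>Z = 2 q adj G\<close> the product \<open>C\<^sup>T Z C\<close> is
  \<open>2 q det(C)\<^sup>2 I\<close>, so the combination is scalar; being traceless, it is
  zero.\<close>

lemma F0_relation:
  fixes q :: "'a::field_char_0 pt \<Rightarrow> 'a"
  assumes q: "q \<in> Palg"
  shows "lincomb (map (\<lambda>m c. q c * m c) mu0) F0 = (\<lambda>c. 0)"
proof
  fix c :: "'a pt"
  define p where "p i = map (\<lambda>m c. q c * m c) mu0 ! i" for i
  have ps: "map (\<lambda>m c. q c * m c) mu0 = [p 0, p 1, p 2, p 3, p 4, p 5]"
    using list6[of "map (\<lambda>m c. q c * m c) mu0"] by (simp add: p_def mu0_def)
  have "sym_of (\<lambda>i. p i c) = phi0 (gam c) (\<lambda>_. 2 * q c)"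
  proof
    fix i
    show "sym_of (\<lambda>i. p i c) i = phi0 (gam c) (\<lambda>_. 2 * q c) i"
      unfolding phi0_scale[of "gam c" "\<lambda>_. 2 * q c"]
      by (cases i) (simp_all add: sym_of_def p_def mu0_gp eval_nat_numeral)
  qed
  then have s: "symm (sym_of (\<lambda>i. p i c)) = mat (2 * q c) ** (transpose (adj3 c) ** adj3 c)"
    by (simp add: symm_phi0 symm_gam adj3_mult adj3_transpose)
  have ca: "transpose c ** transpose (adj3 c) = mat (det c)"
    by (simp only: matrix_transpose_mul[symmetric] adj3_left transpose_mat)
  have "transpose c ** symm (sym_of (\<lambda>i. p i c)) ** c
      = mat (2 * q c) ** ((transpose c ** transpose (adj3 c)) ** (adj3 c ** c))"
    unfolding s mult_mat_left[of "transpose c"] by (simp only: matrix_mul_assoc)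
  also have "\<dots> = mat (2 * q c * (det c * det c))" unfolding ca adj3_left by (simp only: mat_mult_mat)
  finally have T: "transpose c ** symm (sym_of (\<lambda>i. p i c)) ** c = mat (2 * q c * (det c * det c))" .
  let ?x = "2 * q c * (det c * det c) - 1/3 * gsum (sym_of (\<lambda>i. p i c)) c"
  have e: "lincomb (map (\<lambda>m c. q c * m c) mu0) F0 c = mat ?x"
    unfolding ps F0_comb T Jm_mat by (simp add: vec_eq_iff mat_nth)
  have "set (map (\<lambda>m c. q c * m c) mu0) \<subseteq> Palg"
    using mu0_Palg Palg.mult[OF q] by auto
  then have sp: "lincomb (map (\<lambda>m c. q c * m c) mu0) F0 \<in> Pspan (set F0)"
    by (intro Pspan_list[of "map (\<lambda>m c. q c * m c) mu0"]) (simp_all add: mu0_def F0_def)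
  have "cov 1 1 (lincomb (map (\<lambda>m c. q c * m c) mu0) F0)" by (rule cov_span[OF cov_F0 sp])
  then have "trace (mat ?x :: 'a^3^3) = 0" unfolding e[symmetric] by (simp add: cov_def)
  then have x0: "?x = 0" unfolding trace_mat by (metis mult_eq_0_iff zero_neq_numeral)
  show "lincomb (map (\<lambda>m c. q c * m c) mu0) F0 c = 0" unfolding e x0 by simp
qed

lemma mu0_injective:
  fixes q :: "'a::field_char_0 pt \<Rightarrow> 'a"
  assumes q: "q \<in> Palg" and z: "map (\<lambda>m c. q c * m c) mu0 = replicate 6 (\<lambda>c. 0)"
  shows "q = (\<lambda>c. 0)"
proof
  fix c
  have z': "(\<lambda>c. q c * (mu0 ! 5) c) = (\<lambda>c. 0)"
    using arg_cong[OF z, of "\<lambda>l. l ! 5"] by (simp add: mu0_def)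
  have "minor12 c * q c = 0" for c
  proof -
    have "4 * (minor12 c * q c) = 2 * (q c * (mu0 ! 5) c)"
      by (simp add: mu0_gp phi0_def minor12_def eval_nat_numeral algebra_simps)
    also have "\<dots> = 0" using fun_cong[OF z', of c] by simp
    finally show ?thesis by (metis mult_eq_0_iff zero_neq_numeral)
  qed
  note mz = this
  have mp: "is_poly (\<lambda>c. minor12 c)" using is_poly_gam[OF pol_minor12] by (simp add: minor12_gam)
  show "q c = 0"
    by (rule is_poly_domain[OF mp Palg_is_poly[OF q] mz, of "mat 1"]) (simp add: minor12_def gp_def mat_nth)
qed

subsection \<open>Relations between the odd symmetric covariants\<close>

definition skm :: "(gi \<Rightarrow> 'a::comm_ring_1) \<Rightarrow> 'a^3^3" where
  "skm w = vector [vector [0, w G12, w G13], vector [- w G12, 0, w G23], vector [- w G13, - w G23, 0]]"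

lemma matm_phi3: "matm (phi3 g w) = skm w ** symm g"
  by (simp add: matm_def phi3_def skm_def symm_def vec_eq_iff forall_3 mmult_nth algebra_simps)

lemma transpose_skm: "transpose (skm w) = - skm w"
  by (simp add: skm_def vec_eq_iff forall_3 transpose_nth)

lemma mu1_app_3:
  "mu1_app [a, b, d] = [\<lambda>c. trP 2 3 c * a c - trP 3 3 c * d c, \<lambda>c. trP 1 3 c * a c - trP 3 3 c * b c,
    \<lambda>c. trP 2 3 c * d c - trP 2 2 c * a c, \<lambda>c. trP 1 2 c * d c - trP 2 2 c * b c,
    \<lambda>c. trP 1 3 c * b c - trP 1 1 c * a c, \<lambda>c. trP 1 2 c * b c - trP 1 1 c * d c,
    \<lambda>c. trP 1 3 c * d c - trP 2 3 c * b c, \<lambda>c. trP 1 2 c * a c - trP 2 3 c * b c]"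
proof -
  have "(\<Sum>j<3. f j) = f 0 + f 1 + f 2" for f :: "nat \<Rightarrow> 'a" by (simp add: eval_nat_numeral)
  then show ?thesis by (simp add: mu1_app_def mu1_def zf_def fun_eq_iff)
qed

text \<open>Multiplying the relation by \<open>C\<close> and \<open>C\<^sup>T\<close> gives
  \<open>det C (G X + X\<^sup>T G) = 0\<close>. Hence \<open>X = S G\<close> with \<open>S\<close>
  skew-symmetric, and up to constants the three entries of \<open>S\<close> are the coordinates with
  respect to the columns of \<open>mu1\<close>.\<close>

lemma F1_relation_imp:
  fixes ps :: "('a::field_char_0 pt \<Rightarrow> 'a) list"
  assumes l: "length ps = 8" and P: "set ps \<subseteq> Palg" and z: "lincomb ps F1 = (\<lambda>c. 0)"
  shows "\<exists>qs. length qs = 3 \<and> set qs \<subseteq> Palg \<and> ps = mu1_app qs"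
proof -
  define p where "p i = ps ! i" for i
  have ps: "ps = [p 0, p 1, p 2, p 3, p 4, p 5, p 6, p 7]" using list8[OF l] by (simp add: p_def)
  have pP: "p i \<in> Palg" if "i < 8" for i using P l that by (auto simp: p_def)
  define x where "x m c = mat_of (\<lambda>j. p j c) m" for m c
  have xP: "x m \<in> Palg" for m
  proof -
    have "(\<lambda>c. x m c) \<in> Palg"
      unfolding x_def mat_of_def by (cases m) (simp_all add: pP Palg_uminus Palg_diff)
    then show ?thesis by simp
  qed
  have xc: "mat_of (\<lambda>j. p j c) = (\<lambda>m. x m c)" for c by (simp add: x_def)
  obtain V where V: "\<And>m. pol (\<lambda>x. V x m)" "\<And>m c. x m c = V (gam c) m"
  proof (rule Palg_gam_choice[OF xP])
    fix V assume "\<And>k. pol (\<lambda>x. V x k)" "\<And>k c. x k c = V (gam c) k"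
    then show thesis by (rule that)
  qed
  have xV: "(\<lambda>m. x m c) = V (gam c)" for c by (simp add: V(2))
  have d: "det c * phi2 (gam c) (V (gam c)) k = 0" for c k
  proof -
    let ?X = "matm (V (gam c))"
    have "lincomb [p 0, p 1, p 2, p 3, p 4, p 5, p 6, p 7] F1 c = 0" using z unfolding ps by (rule fun_cong)
    then have "Jm ** sym_part c ?X ** Jm = 0" unfolding F1_comb xc xV .
    then have "Jm ** (Jm ** sym_part c ?X ** Jm) ** Jm = 0" by simp
    then have "sym_part c ?X = 0" unfolding Jm_conj .
    then have "c ** sym_part c ?X ** transpose c = 0" by simp
    moreover have "c ** sym_part c ?X ** transpose c
        = (c ** transpose c ** ?X) ** transpose (c ** adj3 c) + (c ** adj3 c) ** (transpose ?X ** (c ** transpose c))"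
      unfolding sym_part_def matrix_add_ldistrib matrix_add_rdistrib3
      by (simp only: matrix_transpose_mul transpose_transpose matrix_mul_assoc)
    ultimately have "mat (det c) ** symm (phi2 (gam c) (V (gam c))) = 0"
      unfolding adj3_right transpose_mat mult_mat[of "c ** transpose c ** ?X"] symm_phi2 symm_gam matrix_add_ldistrib by simp
    then have "(mat (det c) ** symm (phi2 (gam c) (V (gam c)))) $ i $ j = 0" for i j by simp
    then have "det c * symm (phi2 (gam c) (V (gam c))) $ i $ j = 0" for i j by simp
    from this[of 1 1] this[of 1 2] this[of 1 3] this[of 2 2] this[of 2 3] this[of 3 3] show ?thesis
      by (cases k) (simp_all only: symm_def vector_3)
  qed
  have psi: "phi2 x (V x) k = 0" for x k
  proof (rule gam_algebraically_independent[of "\<lambda>x. phi2 x (V x) k"])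
    have pp: "pol (\<lambda>x. phi2 x (V x) k)" using cx3.psi_pol[of V UNIV k] V(1) by simp
    then show "pol (\<lambda>x. phi2 x (V x) k)" .
    show "phi2 (gam c) (V (gam c)) k = 0" for c
      by (rule is_poly_domain[OF is_poly_det is_poly_gam[OF pp] d, of "mat 1"]) simp
  qed
  obtain U where U: "\<And>k. pol (\<lambda>x. U x k)" "\<And>x. V x = phi3 x (U x)"
  proof (rule gram_skew[OF V(1) psi])
    fix U assume "\<And>k. pol (\<lambda>x. U x k)" "\<And>x. V x = phi3 x (U x)"
    then show thesis by (rule that)
  qed
  have UP: "(\<lambda>c. U (gam c) k) \<in> Palg" for k
    unfolding Palg_iff using U(1) by blast
  \<comment> \<open>Each \<open>trP\<close> is -2 times a Gram entry, hence the halves; order and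
    signs follow the columns of \<open>mu1\<close>.\<close>
  let ?qs = "[\<lambda>c. 1/2 * U (gam c) G12, \<lambda>c. 1/2 * U (gam c) G23, \<lambda>c. (-1/2) * U (gam c) G13]"
  have "p 0 c = - x M13 c" "p 1 c = x M23 c" "p 2 c = x M12 c" "p 3 c = - x M32 c" "p 4 c = - x M21 c"
    "p 5 c = x M31 c" "p 6 c = - x M33 c" "p 7 c = x M22 c" for c
    by (simp_all add: x_def mat_of_def)
  then have "ps = mu1_app ?qs"
    unfolding ps mu1_app_3 by (simp add: fun_eq_iff V(2) U(2) phi3_def trP_eq)
  moreover have "set ?qs \<subseteq> Palg" by (simp add: UP Palg_divide Palg_uminus)
  ultimately show ?thesis by (intro exI[of _ ?qs]) simp
qed

text \<open>For \<open>X = S G\<close> the matrix \<open>C\<^sup>T X (adj C)\<^sup>T\<close> is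
  \<open>det C\<close> times \<open>C\<^sup>T S C\<close>, which is skew-symmetric, so its symmetric
  part vanishes.\<close>

lemma F1_relation:
  fixes qs :: "('a::field_char_0 pt \<Rightarrow> 'a) list"
  assumes l: "length qs = 3"
  shows "lincomb (mu1_app qs) F1 = (\<lambda>c. 0)"
proof
  fix c :: "'a pt"
  obtain a b d where qs: "qs = [a, b, d]" using list3[OF l] by blast
  define p where "p i = mu1_app qs ! i" for i
  have ps: "mu1_app qs = [p 0, p 1, p 2, p 3, p 4, p 5, p 6, p 7]"
    using list8[of "mu1_app qs"] by (simp add: p_def mu1_app_def mu1_def)
  define w where "w k = (case k of G12 \<Rightarrow> 2 * a c | G23 \<Rightarrow> 2 * b c | G13 \<Rightarrow> - 2 * d c | _ \<Rightarrow> 0)" for k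
  have x: "mat_of (\<lambda>i. p i c) = phi3 (gam c) w"
    by (rule ext, rename_tac m, case_tac m)
      (simp_all add: mat_of_def p_def qs mu1_app_3 phi3_def w_def trP_eq eval_nat_numeral)
  have ca: "transpose c ** transpose (adj3 c) = mat (det c)"
    by (simp only: matrix_transpose_mul[symmetric] adj3_left transpose_mat)
  have M: "transpose c ** matm (phi3 (gam c) w) ** transpose (adj3 c) = mat (det c) ** (transpose c ** skm w ** c)"
  proof -
    have "transpose c ** matm (phi3 (gam c) w) ** transpose (adj3 c) = transpose c ** skm w ** c ** (transpose c ** transpose (adj3 c))"
      unfolding matm_phi3 symm_gam by (simp only: matrix_mul_assoc)
    then show ?thesis unfolding ca mult_mat[of "transpose c ** skm w ** c"] .
  qed
  have "transpose (transpose c ** skm w ** c) = - (transpose c ** skm w ** c)"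
    by (simp only: matrix_transpose_mul transpose_transpose transpose_skm neg_mult matrix_mul_assoc)
  then have "sym_part c (matm (mat_of (\<lambda>i. p i c))) = 0"
    unfolding sym_part_def x M transpose_mat_mult by (simp add: neg_mult)
  then show "lincomb (mu1_app qs) F1 c = 0" unfolding ps F1_comb by simp
qed

lemma mu1_injective:
  fixes qs :: "('a::field_char_0 pt \<Rightarrow> 'a) list"
  assumes l: "length qs = 3" and P: "set qs \<subseteq> Palg" and z: "mu1_app qs = replicate 8 (\<lambda>c. 0)"
  shows "qs = replicate 3 (\<lambda>c. 0)"
proof -
  obtain a b d where qs: "qs = [a, b, d]" using list3[OF l] by blast
  have pq: "is_poly a" "is_poly b" "is_poly d" using P Palg_is_poly unfolding qs by auto
  have e: "trP 2 3 c * a c = trP 3 3 c * d c" "trP 1 3 c * a c = trP 3 3 c * b c" "trP 2 3 c * d c = trP 2 2 c * a c" for c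
    using z unfolding qs mu1_app_3 by (simp_all add: fun_eq_iff eval_nat_numeral)
  have e': "gp 2 3 c * a c = gp 3 3 c * d c" "gp 1 3 c * a c = gp 3 3 c * b c" "gp 2 3 c * d c = gp 2 2 c * a c" for c
    using e[of c] unfolding trP_eq by simp_all
  \<comment> \<open>Two of the rows form a linear system in \<open>a\<close> and \<open>d\<close>
    whose determinant is, up to sign, this minor.\<close>
  have m: "(gp 2 2 c * gp 3 3 c - gp 2 3 c * gp 2 3 c) * a c = 0" for c
  proof -
    have "(gp 2 2 c * gp 3 3 c - gp 2 3 c * gp 2 3 c) * a c = gp 3 3 c * (gp 2 2 c * a c) - gp 2 3 c * (gp 2 3 c * a c)"
      by (simp add: algebra_simps)
    then show ?thesis unfolding e'(1) e'(3)[symmetric] by (simp add: mult_ac)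
  qed
  have a0: "a c = 0" for c
    by (rule is_poly_domain[OF is_poly_diff[OF is_poly.mult[OF is_poly_gp is_poly_gp] is_poly.mult[OF is_poly_gp is_poly_gp]] pq(1) m, of "mat 1"])
      (simp add: gp_def mat_nth)
  have n: "gp 3 3 (mat 1 :: 'a pt) \<noteq> 0" by (simp add: gp_def mat_nth)
  have "d c = 0" for c
    by (rule is_poly_domain[OF is_poly_gp pq(3) _ n]) (use e'(1) a0 in simp)
  moreover have "b c = 0" for c
    by (rule is_poly_domain[OF is_poly_gp pq(2) _ n]) (use e'(2) a0 in simp)
  ultimately show ?thesis using a0 by (simp add: qs fun_eq_iff eval_nat_numeral)
qed

lemma mu1_Palg: "\<forall>row \<in> set (mu1 :: ('a::field_char_0 pt \<Rightarrow> 'a) list list). set row \<subseteq> Palg"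
  by (simp add: mu1_def zf_def trP_Palg Palg_uminus Palg.const)

lemma trP_0: "trP i j 0 = 0"
  by (simp add: trP_eq gp_def)

text \<open>The relations among the generators have coefficients vanishing at the origin, whereas a
  constant coefficient equals its value there.\<close>

lemma K_indep_if_relations:
  fixes Fs :: "'a::field_char_0 mmap list"
  assumes "\<And>ps. length ps = length Fs \<Longrightarrow> set ps \<subseteq> Palg \<Longrightarrow> lincomb ps Fs = (\<lambda>c. 0) \<Longrightarrow> \<forall>p\<in>set ps. p 0 = 0"
  shows "K_indep Fs"
  unfolding K_indep_def
proof (intro allI impI ballI, elim conjE)
  fix ps p assume ps: "length ps = length Fs" "set ps \<subseteq> range (\<lambda>a (c :: 'a pt). a)" "lincomb ps Fs = (\<lambda>c. 0)" and p: "p \<in> set ps"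
  have "set ps \<subseteq> Palg" using ps(2) Palg.const by blast
  then have "p 0 = 0" using assms ps p by blast
  moreover obtain a where "p = (\<lambda>c. a)" using ps(2) p by blast
  ultimately show "p = (\<lambda>c. 0)" by simp
qed

lemma K_indep_F0: "K_indep (F0 :: 'a::field_char_0 mmap list)"
proof (rule K_indep_if_relations)
  fix ps :: "('a pt \<Rightarrow> 'a) list"
  assume "length ps = length (F0 :: 'a mmap list)" "set ps \<subseteq> Palg" "lincomb ps F0 = (\<lambda>c. 0)"
  then have "\<exists>q\<in>Palg. ps = map (\<lambda>m c. q c * m c) mu0" by (intro F0_relation_imp) (simp_all add: F0_def)
  then show "\<forall>p\<in>set ps. p 0 = 0" by (auto simp: mu0_def trP_0)
qed

lemma K_indep_F1: "K_indep (F1 :: 'a::field_char_0 mmap list)"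
proof (rule K_indep_if_relations)
  fix ps :: "('a pt \<Rightarrow> 'a) list"
  assume "length ps = length (F1 :: 'a mmap list)" "set ps \<subseteq> Palg" "lincomb ps F1 = (\<lambda>c. 0)"
  then have "\<exists>qs. length qs = 3 \<and> set qs \<subseteq> Palg \<and> ps = mu1_app qs" by (intro F1_relation_imp) (simp_all add: F1_def)
  then obtain qs where qs: "length qs = 3" "ps = mu1_app qs" by blast
  obtain a b d where "qs = [a, b, d]" using list3[OF qs(1)] by blast
  then show "\<forall>p\<in>set ps. p 0 = 0" unfolding qs(2) by (simp add: mu1_app_3 trP_0)
qed

lemma list5: "length Fs = 5 \<Longrightarrow> \<exists>A B C D E. Fs = [A, B, C, D, E]"
  by (auto simp: eval_nat_numeral length_Suc_conv)

lemma all5: "(\<forall>i<(5::nat). Q i) \<longleftrightarrow> Q 0 \<and> Q 1 \<and> Q 2 \<and> Q 3 \<and> Q 4"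
  by (auto simp: eval_nat_numeral less_Suc_eq)

lemma dsum_E3: "internal_dsum (E3 :: 'a::field_char_0 mmap set) [E31, E32_1, E32_0, E33_0, E33_1]"
  unfolding internal_dsum_def
proof (intro conjI ballI allI impI)
  fix N :: "'a mmap set" assume "N \<in> set [E31, E32_1, E32_0, E33_0, E33_1]"
  moreover have "(E31 :: 'a mmap set) \<subseteq> E3" unfolding E31_Inv3 using E3_mat by blast
  moreover have "(E32_1 :: 'a mmap set) \<subseteq> E3"
    unfolding E32_1_eq using cov_span[OF cov_L2] by (auto simp: cov_def)
  moreover have "(E32_0 :: 'a mmap set) \<subseteq> E3"
    unfolding E32_0_eq using cov_span[OF cov_L3] by (auto simp: cov_def)
  moreover have "(E33_0 :: 'a mmap set) \<subseteq> E3"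
    unfolding E33_0_eq using cov_span[OF cov_F0] by (auto simp: cov_def)
  moreover have "(E33_1 :: 'a mmap set) \<subseteq> E3"
    unfolding E33_1_eq using cov_span[OF cov_F1] by (auto simp: cov_def)
  ultimately show "N \<subseteq> E3" by auto
next
  fix F :: "'a mmap" assume "F \<in> E3"
  from E3_decomp[OF this] obtain A B C D E where m: "A \<in> E31" "B \<in> E32_1" "C \<in> E32_0" "D \<in> E33_0" "E \<in> E33_1"
    and e: "\<And>c. F c = A c + B c + C c + D c + E c" by blast
  have "F = msum [A, B, C, D, E]" by (rule ext) (simp add: e msum_def add.assoc)
  then show "\<exists>Fs. length Fs = length [E31, E32_1, E32_0, E33_0, E33_1]
      \<and> (\<forall>i<length [E31, E32_1, E32_0, E33_0, E33_1]. Fs ! i \<in> [E31, E32_1, E32_0, E33_0, E33_1] ! i) \<and> F = msum Fs"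
    using m by (intro exI[of _ "[A, B, C, D, E]"]) (simp add: all5 eval_nat_numeral less_Suc_eq)
next
  fix Fs :: "'a mmap list" and i
  assume a: "length Fs = length [E31, E32_1, E32_0, E33_0, E33_1 :: 'a mmap set]
      \<and> (\<forall>i<length [E31, E32_1, E32_0, E33_0, E33_1 :: 'a mmap set]. Fs ! i \<in> [E31, E32_1, E32_0, E33_0, E33_1] ! i) \<and> msum Fs = (\<lambda>c. 0)"
    and i: "i < length [E31, E32_1, E32_0, E33_0, E33_1 :: 'a mmap set]"
  have "length Fs = 5" using a by simp
  then obtain A B C D E where Fs: "Fs = [A, B, C, D, E]" using list5 by blast
  have m: "A \<in> E31" "B \<in> E32_1" "C \<in> E32_0" "D \<in> E33_0" "E \<in> E33_1"
    using a unfolding Fs by (simp_all add: eval_nat_numeral less_Suc_eq all_conj_distrib imp_disjL)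
  have "A c + B c + C c + D c + E c = 0" for c
  proof -
    have "msum Fs c = 0" using a by simp
    then show ?thesis unfolding Fs by (simp add: msum_def add.assoc)
  qed
  from E3_unique[OF m this] have "A = (\<lambda>c. 0)" "B = (\<lambda>c. 0)" "C = (\<lambda>c. 0)" "D = (\<lambda>c. 0)" "E = (\<lambda>c. 0)"
    by (simp_all add: fun_eq_iff)
  then show "Fs ! i = (\<lambda>c. 0)" using i unfolding Fs by (auto simp: eval_nat_numeral less_Suc_eq)
qed

lemma E33_0_lincomb: "E33_0 = {lincomb ps F0 | ps :: ('a::field_char_0 pt \<Rightarrow> 'a) list. length ps = 6 \<and> set ps \<subseteq> Palg}"
proof -
  have "length (F0 :: 'a mmap list) = 6" by (simp add: F0_def)
  then show ?thesis unfolding E33_0_eq Pspan_eq spanR_list[OF subring_Palg] by simp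
qed

lemma E33_1_lincomb: "E33_1 = {lincomb ps F1 | ps :: ('a::field_char_0 pt \<Rightarrow> 'a) list. length ps = 8 \<and> set ps \<subseteq> Palg}"
proof -
  have "length (F1 :: 'a mmap list) = 8" by (simp add: F1_def)
  then show ?thesis unfolding E33_1_eq Pspan_eq spanR_list[OF subring_Palg] by simp
qed

text \<open>Module maps are given by lists of coefficients. A free resolution is thus spelled out as
  three facts: the generators span, the kernel of their \<open>lincomb\<close> map is the image of
  \<open>mu0\<close> or \<open>mu1\<close>, and that matrix is injective over
  \<open>Palg\<close>.\<close>

theorem theorem5p6:
  shows
  "\<comment> \<open>(i)\<close>
   internal_dsum (E3 :: ('a::field_char_0 mmap) set) [E31, E32_1, E32_0, E33_0, E33_1]
   \<and> internal_dsum (E31 :: 'a mmap set) [Pspan {Imap}, Pspan {tr3I}]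
   \<and> (E31 :: 'a mmap set) = {(\<lambda>c. mat (f c)) | f. f \<in> Inv3}
   \<comment> \<open>(ii)\<close>
   \<and> (E32_1 :: 'a mmap set) = Pspan {tv 1, tv 2, tv 3}
   \<and> internal_dsum (E32_1 :: 'a mmap set) [Pspan {tv 1}, Pspan {tv 2}, Pspan {tv 3}]
   \<and> P_indep [tv 1 :: 'a mmap, tv 2, tv 3]
   \<and> (E32_0 :: 'a mmap set) = Pspan {\<lambda>c. comm (tv 1 c) (tv 2 c), \<lambda>c. comm (tv 1 c) (tv 3 c),
                                     \<lambda>c. comm (tv 2 c) (tv 3 c)}
   \<and> internal_dsum (E32_0 :: 'a mmap set) [Pspan {\<lambda>c. comm (tv 1 c) (tv 2 c)},
        Pspan {\<lambda>c. comm (tv 1 c) (tv 3 c)}, Pspan {\<lambda>c. comm (tv 2 c) (tv 3 c)}]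
   \<and> P_indep [\<lambda>c. comm (tv 1 c) (tv 2 c) :: 'a^3^3, \<lambda>c. comm (tv 1 c) (tv 3 c),
              \<lambda>c. comm (tv 2 c) (tv 3 c)]
   \<comment> \<open>(iii)\<close>
   \<and> Kspan (set F0) = GLmod {g33_0 :: 'a mmap} \<and> K_indep (F0 :: 'a mmap list)
   \<and> (E33_0 :: 'a mmap set) = {lincomb ps F0 | ps. length ps = 6 \<and> set ps \<subseteq> Palg}
   \<and> set (mu0 :: ('a pt \<Rightarrow> 'a) list) \<subseteq> Palg
   \<and> (\<forall>q \<in> (Palg :: ('a pt \<Rightarrow> 'a) set).
        map (\<lambda>m. \<lambda>c. q c * m c) mu0 = replicate 6 (\<lambda>c. 0) \<longrightarrow> q = (\<lambda>c. 0))
   \<and> (\<forall>ps :: ('a pt \<Rightarrow> 'a) list. length ps = 6 \<and> set ps \<subseteq> Palg \<longrightarrow>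
        (lincomb ps F0 = (\<lambda>c. 0) \<longleftrightarrow> (\<exists>q\<in>Palg. ps = map (\<lambda>m. \<lambda>c. q c * m c) mu0)))
   \<comment> \<open>(iv)\<close>
   \<and> Kspan (set F1) = GLmod {g33_1 :: 'a mmap} \<and> K_indep (F1 :: 'a mmap list)
   \<and> (E33_1 :: 'a mmap set) = {lincomb ps F1 | ps. length ps = 8 \<and> set ps \<subseteq> Palg}
   \<and> (\<forall>row \<in> set (mu1 :: ('a pt \<Rightarrow> 'a) list list). set row \<subseteq> Palg)
   \<and> (\<forall>qs :: ('a pt \<Rightarrow> 'a) list. length qs = 3 \<and> set qs \<subseteq> Palg \<and>
        mu1_app qs = replicate 8 (\<lambda>c. 0) \<longrightarrow> qs = replicate 3 (\<lambda>c. 0))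
   \<and> (\<forall>ps :: ('a pt \<Rightarrow> 'a) list. length ps = 8 \<and> set ps \<subseteq> Palg \<longrightarrow>
        (lincomb ps F1 = (\<lambda>c. 0) \<longleftrightarrow>
           (\<exists>qs. length qs = 3 \<and> set qs \<subseteq> Palg \<and> ps = mu1_app qs)))"
proof -
  have 1: "internal_dsum (E31 :: 'a mmap set) [Pspan {Imap}, Pspan {tr3I}]"
    unfolding E31_def using dsum_list[OF P_indep_L1] by simp
  have 2: "(E32_1 :: 'a mmap set) = Pspan {tv 1, tv 2, tv 3}"
    unfolding E32_1_eq by (simp add: L2_def)
  have 3: "internal_dsum (E32_1 :: 'a mmap set) [Pspan {tv 1}, Pspan {tv 2}, Pspan {tv 3}]"
    unfolding E32_1_eq using dsum_list[OF P_indep_L2] by (simp add: L2_def)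
  have 4: "P_indep [tv 1 :: 'a mmap, tv 2, tv 3]"
    using P_indep_L2 unfolding L2_def .
  have 5: "(E32_0 :: 'a mmap set) = Pspan {\<lambda>c. comm (tv 1 c) (tv 2 c), \<lambda>c. comm (tv 1 c) (tv 3 c),
      \<lambda>c. comm (tv 2 c) (tv 3 c)}"
    unfolding E32_0_eq by (simp add: L3_def)
  have 6: "internal_dsum (E32_0 :: 'a mmap set) [Pspan {\<lambda>c. comm (tv 1 c) (tv 2 c)},
      Pspan {\<lambda>c. comm (tv 1 c) (tv 3 c)}, Pspan {\<lambda>c. comm (tv 2 c) (tv 3 c)}]"
    unfolding E32_0_eq using dsum_list[OF P_indep_L3] by (simp add: L3_def)
  have 7: "P_indep [\<lambda>c. comm (tv 1 c) (tv 2 c) :: 'a^3^3, \<lambda>c. comm (tv 1 c) (tv 3 c),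
      \<lambda>c. comm (tv 2 c) (tv 3 c)]"
    using P_indep_L3 unfolding L3_def .
  have 8: "\<forall>q \<in> (Palg :: ('a pt \<Rightarrow> 'a) set).
      map (\<lambda>m. \<lambda>c. q c * m c) mu0 = replicate 6 (\<lambda>c. 0) \<longrightarrow> q = (\<lambda>c. 0)"
    using mu0_injective by blast
  have 9: "\<forall>ps :: ('a pt \<Rightarrow> 'a) list. length ps = 6 \<and> set ps \<subseteq> Palg \<longrightarrow>
      (lincomb ps F0 = (\<lambda>c. 0) \<longleftrightarrow> (\<exists>q\<in>Palg. ps = map (\<lambda>m. \<lambda>c. q c * m c) mu0))"
    using F0_relation_imp F0_relation by blast
  have 10: "\<forall>qs :: ('a pt \<Rightarrow> 'a) list. length qs = 3 \<and> set qs \<subseteq> Palg \<and>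
      mu1_app qs = replicate 8 (\<lambda>c. 0) \<longrightarrow> qs = replicate 3 (\<lambda>c. 0)"
    using mu1_injective by blast
  have 11: "\<forall>ps :: ('a pt \<Rightarrow> 'a) list. length ps = 8 \<and> set ps \<subseteq> Palg \<longrightarrow>
      (lincomb ps F1 = (\<lambda>c. 0) \<longleftrightarrow> (\<exists>qs. length qs = 3 \<and> set qs \<subseteq> Palg \<and> ps = mu1_app qs))"
    using F1_relation_imp F1_relation by blast
  show ?thesis
    by (intro conjI dsum_E3 1 E31_Inv3 2 3 4 5 6 7 GLmod_fsym[symmetric] K_indep_F0 E33_0_lincomb mu0_Palg 8 9
        GLmod_fijk[symmetric] K_indep_F1 E33_1_lincomb mu1_Palg 10 11)
qed

end
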